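(* Let $T$ be an expanding polynomial of degree $d\ge 2$ with real Julia set $E$, let $\mu$ be the balanced measure on $E$, and let $J=J(\mu)$ be the one-sided Jacobi matrix associated with $\mu$, with diagonal entries $q_0,q_1,q_2,\dots$ and off-diagonal entries $p_1,p_2,\dots$. Put $d_n=d^n$. Then for every $\epsilon>0$ there exists a positive integer $n$ such that $$|p_{k+s d_n^2}-p_k|\le \epsilon,\qquad |q_{k+s d_n^2}-q_k|\le\epsilon$$ for all integers $s\ge 0$ and all $k=1,2,\dots,d_n$.
   Context: A polynomial $T$ of degree $d\ge2$ with Julia set $E$ is expanding if there are $A>0$, $c>1$ with $|T_n'(x)|\ge A c^n$ for all $x\in E$ and $n\ge1$, where $T_n=T^{\circ n}$ is the $n$-th iterate, of degree $d_n=d^n$. It is assumed that $E\subset\mathbb R$; the coordinate is normalized so that the smallest interval containing $E$ is $[-\xi,\xi]$, and $T^{-1}([-\xi,\xi])\subset[-\xi,\xi]$ (full preimage in $\mathbb C$). The balanced measure $\mu$ is the probability measure on $E$ with $L^*\mu=\mu$, i.e. $\int Lg\,d\mu=\int g\,d\mu$ for continuous $g$, where $Lg(x)=\frac1d\sum_{T(y)=x}g(y)$. The Jacobi matrix $J(\mu)$ acting on $\ell^2(\mathbb Z_+)$ is the tridiagonal symmetric matrix with diagonal $q_0,q_1,\dots$ and off-diagonal entries $p_1,p_2,\dots>0$, determined by the three-term recurrence $\lambda P_k(\lambda)=p_kP_{k-1}(\lambda)+q_kP_k(\lambda)+p_{k+1}P_{k+1}(\lambda)$ for the polynomials $P_k$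 (degree $k$, positive leading coefficient, $P_{-1}=0$) orthonormal in $L^2_{d\mu}$. *)

theory Defs
  imports "HOL-Probability.Probability_Measure" "HOL-Computational_Algebra.Polynomial"
begin

text \<open>Normality in the extended sense: a sequence tending to infinity locally uniformly
  counts as convergent (to the point at infinity of the Riemann sphere). The set \<open>U\<close> is
  meant to be a region and the members of \<open>F\<close> to be holomorphic on it.\<close>

definition normal_family_on :: "complex set \<Rightarrow> (complex \<Rightarrow> complex) set \<Rightarrow> bool" where
  "normal_family_on U F \<longleftrightarrow>
     (\<forall>f :: nat \<Rightarrow> complex \<Rightarrow> complex. range f \<subseteq> F \<longrightarrow>
        (\<exists>r. strict_mono r \<and>
           ((\<exists>g. \<forall>K. compact K \<and> K \<subseteq> U \<longrightarrow>
                 uniform_limit K (\<lambda>n. f (r n)) g sequentially) \<or>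
            (\<forall>K. compact K \<and> K \<subseteq> U \<longrightarrow>
                 (\<forall>B. \<forall>\<^sub>F n in sequentially. \<forall>z\<in>K. norm (f (r n) z) > B)))))"

definition fatou_set :: "complex poly \<Rightarrow> complex set" where
  "fatou_set T =
     {z. \<exists>U. open U \<and> connected U \<and> z \<in> U \<and> normal_family_on U (range (\<lambda>n. poly T ^^ n))}"

definition julia_set :: "complex poly \<Rightarrow> complex set" where
  "julia_set T = - fatou_set T"

definition expanding :: "complex poly \<Rightarrow> bool" where
  "expanding T \<longleftrightarrow>
     (\<exists>A>0. \<exists>c>1. \<forall>x\<in>julia_set T. \<forall>n\<ge>1. norm (deriv (poly T ^^ n) x) \<ge> A * c ^ n)"

text \<open>Preimages are counted with multiplicity, so that \<open>L 1 = 1\<close> everywhere. For an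
  expanding polynomial and \<open>x\<close> in the Julia set all preimages are simple.\<close>

definition transfer_operator :: "complex poly \<Rightarrow> (complex \<Rightarrow> complex) \<Rightarrow> complex \<Rightarrow> complex" where
  "transfer_operator T g x =
     1 / of_nat (degree T) * (\<Sum>y | poly T y = x. of_nat (order y (T - [:x:])) * g y)"

text \<open>The underlying measurable space is the Julia set itself with its Borel sets, so only
  the values of \<open>g\<close> on the Julia set matter.\<close>

definition balanced_measure :: "complex poly \<Rightarrow> complex measure \<Rightarrow> bool" where
  "balanced_measure T M \<longleftrightarrow>
     prob_space M \<and> sets M = sets (restrict_space borel (julia_set T)) \<and>
     (\<forall>g. continuous_on (julia_set T) g \<longrightarrow>
        (\<integral>x. transfer_operator T g x \<partial>M) = (\<integral>x. g x \<partial>M))"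

definition orthonormal_polys :: "real measure \<Rightarrow> (nat \<Rightarrow> real poly) \<Rightarrow> bool" where
  "orthonormal_polys M P \<longleftrightarrow>
     (\<forall>k. degree (P k) = k \<and> lead_coeff (P k) > 0) \<and>
     (\<forall>i j. (\<integral>x. poly (P i) x * poly (P j) x \<partial>M) = (if i = j then 1 else 0))"

text \<open>Diagonal \<open>q 0, q 1, \<dots>\<close> and off-diagonal \<open>p 1, p 2, \<dots>\<close>; the value \<open>p 0\<close> is not used.\<close>

definition jacobi_matrix :: "(nat \<Rightarrow> real) \<Rightarrow> (nat \<Rightarrow> real) \<Rightarrow> nat \<Rightarrow> nat \<Rightarrow> real" where
  "jacobi_matrix p q i j =
     (if i = j then q i else if j = Suc i then p j else if i = Suc j then p i else 0)"

definition is_jacobi_matrix_of :: "(nat \<Rightarrow> nat \<Rightarrow> real) \<Rightarrow> real measure \<Rightarrow> bool" where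
  "is_jacobi_matrix_of J M \<longleftrightarrow>
     (\<exists>p q P. J = jacobi_matrix p q \<and> (\<forall>k\<ge>1. p k > 0) \<and> orthonormal_polys M P \<and>
        (\<forall>k x. x * poly (P k) x =
           p k * (if k = 0 then 0 else poly (P (k - 1)) x) + q k * poly (P k) x
           + p (k + 1) * poly (P (k + 1)) x))"

end

theory Submission
  imports Defs "HOL-Computational_Algebra.Fundamental_Theorem_Algebra"
begin

text \<open>Write \<open>a\<^sub>k = p\<^sub>k\<^sup>2\<close> and \<open>b\<^sub>k = q\<^sub>k\<close>, let \<open>Q\<^sub>k\<close> be the monic orthogonal polynomials of \<open>\<mu>\<close>, and let \<open>F\<close> be
the \<open>n\<close>-th iterate of \<open>T\<close>, of degree \<open>D = d ^ n\<close> and leading coefficient \<open>L\<close>. Balance of \<open>\<mu>\<close>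
gives \<open>Q\<^bsub>jD\<^esub> = L powi (- j) * (Q\<^sub>j \<circ> F)\<close>, so the multiples of \<open>D\<close> cut the Jacobi matrix into blocks.

The point is that a block can be diagonalized explicitly. Let \<open>c\<close> be a critical point of \<open>F\<close>. By
balance the Cauchy transform \<open>S\<^sub>k c = \<integral>x. Q\<^sub>k x / (c - x) \<partial>\<mu>\<close> carries a factor \<open>F' c\<close> whenever \<open>D\<close>
divides \<open>k\<close>, and so it vanishes there. As \<open>S\<close> also solves the three-term recurrence, it restricts to
an eigenvector, with eigenvalue \<open>c\<close>, of the rows strictly between \<open>jD\<close> and \<open>(j + 1) D\<close>. The \<open>D - 1\<close>
critical points are real and simple, hence they are all the eigenvalues. With
\<open>\<phi>\<^sub>j = Q\<^bsub>j+1\<^esub> / Q\<^sub>j\<close>, the block belongs to the discrete measure that has weight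
\<open>D * \<bar>\<phi>\<^sub>j (F c)\<bar> / \<bar>F'' c\<bar>\<close> at \<open>c\<close> (lemma \<open>block_orthogonality\<close>). Its total mass is
\<open>a\<^bsub>jD+1\<^esub>\<close>, and \<open>a\<^bsub>(j+1)D\<^esub>\<close> is \<open>a\<^bsub>j+1\<^esub>\<close> times the sum of \<open>D / (\<bar>F'' c\<bar> * \<bar>\<phi>\<^sub>j (F c)\<bar>)\<close>
(lemma \<open>block_inverse_sum\<close>). Only \<open>\<phi>\<^sub>j\<close> depends on \<open>j\<close>.

First consequence: \<open>a\<^bsub>jD\<^esub>\<close> tends to 0 as \<open>n\<close> grows, uniformly in \<open>j \<ge> 1\<close>. Sort the critical points of
\<open>F\<close> by the iterate at which they become critical. The formula for \<open>a\<^sub>1\<close> bounds the sum of the masses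
of all generations, so they are summable. Critical values of \<open>T\<close> lie outside \<open>[- \<xi>, \<xi>]\<close> and escape to
infinity, so in the formula for \<open>a\<^bsub>jD\<^esub>\<close> an old generation comes with a small factor. The result is a
convolution of a summable sequence with a null sequence (lemma \<open>inverse_sum_tendsto_0\<close>).

Second consequence: for \<open>m = s D\<close> with \<open>s \<ge> 1\<close> the block from \<open>mD\<close> to \<open>(m + 1) D\<close> is close to the
first one. Indeed \<open>b\<^sub>m = b\<^sub>0\<close> and \<open>\<phi>\<^sub>m = \<phi>\<^sub>0 - a\<^sub>m / \<phi>\<^bsub>m-1\<^esub>\<close> with \<open>a\<^sub>m\<close> small, so the weights of the two
blocks have a ratio close to 1 at every critical point. This is why the shift is by \<open>s D\<^sup>2\<close>: already
\<open>m\<close> has to be a multiple of \<open>D\<close>. Closeness of the weights passes to the coefficients with constants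
that do not depend on the size of the block, because monic orthogonal polynomials minimize the norm
(lemmas \<open>orthogonal_polys_perturbation\<close> and \<open>block_comparison\<close>).

The facts about \<open>T\<close> behind this are elementary once the Julia set is known to be the set of points
that do not escape (lemma \<open>julia_set_real_eq\<close>): it is completely invariant, \<open>T\<close> has real
coefficients, and a critical value inside \<open>[- \<xi>, \<xi>]\<close> would contradict Laguerre's inequality or, at the
end points, the expanding property.\<close>

section \<open>Polynomials with simple roots\<close>

lemma degree_diff_const:
  fixes p :: "'a::ab_group_add poly"
  assumes "degree p > 0"
  shows "degree (p - [:x:]) = degree p"
proof -
  have "degree (p + [:-x:]) = degree p" using assms by (intro degree_add_eq_left) simp
  moreover have "p - [:x:] = p + [:-x:]" by (rule poly_eqI) (simp add: coeff_pCons split: nat.splits)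
  ultimately show ?thesis by (simp only:)
qed

lemma pderiv_linear_times:
  "pderiv ([:-y, 1:] * q) = q + [:-y, 1:] * pderiv (q :: 'a::idom poly)"
  by (subst pderiv_mult) (simp add: pderiv_pCons del: mult_pCons_left)

lemma poly_pderiv_linear_factors:
  fixes x :: "'a::field"
  assumes "p = smult a (\<Prod>y\<in>#A. [:-y, 1:])" "x \<notin># A"
  shows "poly (pderiv p) x = poly p x * (\<Sum>y\<in>#A. 1 / (x - y))"
proof -
  have "poly (pderiv (\<Prod>y\<in>#A. [:-y, 1:])) x =
      poly (\<Prod>y\<in>#A. [:-y, 1:]) x * (\<Sum>y\<in>#A. 1 / (x - y))" using assms(2)
  proof (induction A)
    case (add y A)
    then have "x - y \<noteq> 0" by auto
    with add show ?case
      by (simp add: pderiv_linear_times distrib_left mult.assoc mult.left_commute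
            del: mult_pCons_left)
  qed simp
  then show ?thesis using assms(1) by (simp add: pderiv_smult)
qed

text \<open>This is \<open>(p' / p)' = - (\<Sum>y\<in>#A. 1 / (x - y)\<^sup>2)\<close>, multiplied out. At a critical point of a
polynomial with real roots it gives the sign of the second derivative (Laguerre's inequality).\<close>

lemma poly_pderiv2_linear_factors:
  fixes x :: "'a::field"
  assumes "p = smult a (\<Prod>y\<in>#A. [:-y, 1:])" "x \<notin># A"
  shows "poly p x * poly (pderiv (pderiv p)) x =
    (poly (pderiv p) x)\<^sup>2 - (poly p x)\<^sup>2 * (\<Sum>y\<in>#A. 1 / (x - y)\<^sup>2)"
proof -
  let ?P = "\<lambda>A. \<Prod>y\<in>#A. [:-y, 1::'a:]"
  have "poly (?P A) x * poly (pderiv (pderiv (?P A))) x =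
     (poly (pderiv (?P A)) x)\<^sup>2 - (poly (?P A) x)\<^sup>2 * (\<Sum>y\<in>#A. 1 / (x - y)\<^sup>2)" using assms(2)
  proof (induction A)
    case (add y A)
    define q q1 q2 where "q = poly (?P A) x" "q1 = poly (pderiv (?P A)) x"
      "q2 = poly (pderiv (pderiv (?P A))) x"
    define s where "s = (\<Sum>y\<in>#A. 1 / (x - y)\<^sup>2)"
    define u where "u = x - y"
    have IH: "q * q2 = q1\<^sup>2 - q\<^sup>2 * s" and u: "u \<noteq> 0"
      using add by (auto simp: q_q1_q2_def s_def u_def)
    have p0: "poly (?P (add_mset y A)) x = u * q"
      by (simp add: q_q1_q2_def u_def del: mult_pCons_left)
    have p1: "poly (pderiv (?P (add_mset y A))) x = q + u * q1"
      by (simp add: q_q1_q2_def u_def pderiv_linear_times del: mult_pCons_left)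
    have p2: "poly (pderiv (pderiv (?P (add_mset y A)))) x = 2 * q1 + u * q2"
      by (simp add: q_q1_q2_def u_def pderiv_linear_times pderiv_add del: mult_pCons_left)
    have s: "(\<Sum>z\<in>#add_mset y A. 1 / (x - z)\<^sup>2) = 1 / u\<^sup>2 + s"
      by (simp add: s_def u_def)
    have "(u * q)\<^sup>2 * (1 / u\<^sup>2 + s) = q\<^sup>2 + u\<^sup>2 * (q\<^sup>2 * s)"
      using u by (simp add: field_simps power2_eq_square)
    also have "q\<^sup>2 * s = q1\<^sup>2 - q * q2" using IH by simp
    finally have "(u * q)\<^sup>2 * (1 / u\<^sup>2 + s) = q\<^sup>2 + u\<^sup>2 * (q1\<^sup>2 - q * q2)" .
    then show ?case unfolding p0 p1 p2 s
      by (simp add: power2_eq_square algebra_simps)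
  qed simp
  then have "a * a * (poly (?P A) x * poly (pderiv (pderiv (?P A))) x) =
     a * a * ((poly (pderiv (?P A)) x)\<^sup>2 - (poly (?P A) x)\<^sup>2 * (\<Sum>y\<in>#A. 1 / (x - y)\<^sup>2))"
    by simp
  then show ?thesis
    using assms(1) by (simp add: pderiv_smult power2_eq_square algebra_simps)
qed

definition simple_split :: "'a::field poly \<Rightarrow> 'a set \<Rightarrow> bool" where
  "simple_split p R \<longleftrightarrow>
     finite R \<and> p \<noteq> 0 \<and> p = smult (lead_coeff p) (\<Prod>y\<in>R. [:-y, 1:])"

lemma simple_split_mset:
  assumes "simple_split p R"
  shows "p = smult (lead_coeff p) (\<Prod>y\<in>#mset_set R. [:-y, 1:])"
  using assms by (simp add: simple_split_def prod_unfold_prod_mset)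

lemma simple_split_degree: "simple_split p R \<Longrightarrow> degree p = card R"
proof -
  assume a: "simple_split p R"
  then have "degree p = degree (\<Prod>y\<in>R. [:-y, 1:])"
    by (metis degree_smult_eq leading_coeff_0_iff simple_split_def)
  also have "\<dots> = card R" by (subst degree_prod_eq_sum_degree) auto
  finally show ?thesis .
qed

lemma simple_split_root: "simple_split p R \<Longrightarrow> poly p x = 0 \<longleftrightarrow> x \<in> R"
proof -
  assume a: "simple_split p R"
  then have "poly p x = poly (smult (lead_coeff p) (\<Prod>y\<in>R. [:-y, 1:])) x"
    by (simp add: simple_split_def)
  then have "poly p x = lead_coeff p * (\<Prod>y\<in>R. x - y)"
    by (simp add: poly_prod)
  then show ?thesis using a by (auto simp: simple_split_def)
qed

lemma simple_split_remove:
  assumes "simple_split p R" "y \<in> R"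
  shows "p = [:-y, 1:] * smult (lead_coeff p) (\<Prod>z\<in>R - {y}. [:-z, 1:])"
proof -
  have "(\<Prod>y\<in>R. [:-y, 1:]) = [:-y, 1:] * (\<Prod>z\<in>R - {y}. [:-z, 1:])"
    using assms by (intro prod.remove) (auto simp: simple_split_def)
  then show ?thesis using assms by (metis mult_smult_right simple_split_def)
qed

lemma simple_split_pderiv_root:
  assumes "simple_split p R" "y \<in> R"
  shows "poly (pderiv p) y = lead_coeff p * poly (\<Prod>z\<in>R - {y}. [:-z, 1:]) y"
    and "poly (pderiv p) y \<noteq> 0"
proof -
  define q where "q = smult (lead_coeff p) (\<Prod>z\<in>R - {y}. [:-z, 1:])"
  have "p = [:-y, 1:] * q" using simple_split_remove[OF assms] by (simp add: q_def)
  then have "pderiv p = q + [:-y, 1:] * pderiv q"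
    by (simp only: pderiv_linear_times)
  then show 1: "poly (pderiv p) y = lead_coeff p * poly (\<Prod>z\<in>R - {y}. [:-z, 1:]) y"
    by (simp add: q_def)
  then show "poly (pderiv p) y \<noteq> 0"
    using assms by (auto simp: simple_split_def poly_prod)
qed

lemma simple_splitI_card:
  fixes p :: "'a::field poly"
  assumes "p \<noteq> 0" "finite R" "card R = degree p" "\<And>y. y \<in> R \<Longrightarrow> poly p y = 0"
  shows "simple_split p R"
proof -
  define m where "m = (\<Prod>y\<in>R. [:-y, 1:])"
  have dm: "degree m = card R" unfolding m_def
    by (subst degree_prod_eq_sum_degree) auto
  have lm: "lead_coeff m = 1" unfolding m_def by (simp add: lead_coeff_prod)
  have "p = smult (lead_coeff p) m"
  proof (rule poly_eqI_degree_lead_coeff[where n = "degree p" and A = R])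
    show "coeff p (degree p) = coeff (smult (lead_coeff p) m) (degree p)"
      using lm dm assms by simp
    show "poly p x = poly (smult (lead_coeff p) m) x" if "x \<in> R" for x
    proof -
      have "poly m x = 0" using that assms(2) unfolding m_def by (auto simp: poly_prod)
      then show ?thesis using assms(4)[OF that] by simp
    qed
  qed (use assms dm in auto)
  then show ?thesis using assms by (simp add: simple_split_def m_def)
qed

text \<open>Euler's identity: apply Lagrange interpolation to \<open>g\<close> and compare the coefficients of degree
\<open>card R - 1\<close>.\<close>

lemma sum_roots_div_pderiv:
  fixes p g :: "'a::field poly"
  assumes s: "simple_split p R" and d: "degree g < card R"
  shows "(\<Sum>y\<in>R. poly g y / poly (pderiv p) y) = coeff g (card R - 1) / lead_coeff p"
proof -
  define l where "l = (\<lambda>y. \<Prod>z\<in>R - {y}. [:-z, 1::'a:])"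
  have fin: "finite R" using s by (simp add: simple_split_def)
  have deg: "degree (l y) = card R - 1" if "y \<in> R" for y
    unfolding l_def using that fin by (subst degree_prod_eq_sum_degree) auto
  have lead: "coeff (l y) (card R - 1) = 1" if "y \<in> R" for y
    unfolding deg[OF that, symmetric] by (simp add: l_def lead_coeff_prod)
  have nz: "poly (l y) y \<noteq> 0" for y
    using fin by (auto simp: l_def poly_prod)
  have off: "poly (l y) z = 0" if "y \<in> R" "z \<in> R" "z \<noteq> y" for y z
    using that fin by (auto simp: l_def poly_prod)
  define G where "G = (\<Sum>y\<in>R. smult (poly g y / poly (l y) y) (l y))"
  have "g = G"
  proof (rule poly_eqI_degree[where A = R])
    fix x assume x: "x \<in> R"
    have "poly G x = (\<Sum>y\<in>R. if y = x then poly g x else 0)"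
      unfolding G_def poly_sum by (intro sum.cong) (use nz off x in auto)
    then show "poly g x = poly G x" using fin x by simp
  next
    show "degree G < card R"
      unfolding G_def using d deg fin
      by (intro degree_sum_less) (auto intro: le_less_trans[OF degree_smult_le])
  qed (use d in auto)
  then have "coeff g (card R - 1) = coeff G (card R - 1)" by simp
  also have "\<dots> = (\<Sum>y\<in>R. poly g y / poly (l y) y)"
    unfolding G_def coeff_sum using lead by (intro sum.cong) auto
  also have "\<dots> = lead_coeff p * (\<Sum>y\<in>R. poly g y / poly (pderiv p) y)"
    unfolding sum_distrib_left
    by (intro sum.cong)
      (use s in \<open>auto simp: simple_split_pderiv_root[OF s] l_def simple_split_def nz[unfolded l_def]\<close>)
  finally show ?thesis using s by (simp add: simple_split_def)
qed

text \<open>Writing \<open>g = g * F' / F'\<close> makes the sum accessible to Euler's identity. If \<open>degree g < degree F\<close>,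
divide \<open>g * F'\<close> by \<open>F\<close>: on the roots it equals \<open>x * G + H\<close>, where the quotient \<open>G\<close> has degree less
than \<open>degree F - 1\<close>. So \<open>x\<close> does not reach the relevant coefficient and the sum is constant. For higher
degrees divide \<open>g\<close> by \<open>F\<close>; each division extracts one factor \<open>x\<close>.\<close>

lemma preimage_sum_poly:
  fixes F g :: "'a::field_char_0 poly"
  assumes "degree F > 0"
  shows "\<exists>h. degree F * degree h \<le> degree g \<and>
     (\<forall>x R. simple_split (F - [:x:]) R \<longrightarrow> (\<Sum>y\<in>R. poly g y) = poly h x)"
proof (induction "degree g" arbitrary: g rule: less_induct)
  case less
  let ?D = "degree F"
  have degF: "degree (F - [:x:]) = ?D" for x using assms by (rule degree_diff_const)
  then have lead: "lead_coeff (F - [:x:]) = lead_coeff F" for x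
    using assms by (simp add: coeff_pCons split: nat.splits)
  show ?case
  proof (cases "degree g < ?D")
    case True
    define G H where "G = (g * pderiv F) div F" "H = (g * pderiv F) mod F"
    have GH: "g * pderiv F = G * F + H" by (simp add: G_H_def)
    have F0: "F \<noteq> 0" using assms by auto
    have dH: "degree H < ?D" unfolding G_H_def
      using assms degree_mod_less[OF F0, of "g * pderiv F"] by auto
    have dG: "degree G < ?D - 1 \<or> G = 0"
    proof (cases "G = 0")
      case False
      have "degree (G * F) = degree G + ?D" using False F0 by (simp add: degree_mult_eq)
      moreover have "degree (G * F) \<le> max (degree (g * pderiv F)) (degree H)"
        using GH degree_diff_le_max[of "g * pderiv F" H] by simp
      moreover have "degree (g * pderiv F) \<le> degree g + (?D - 1)"
        using degree_mult_le[of g "pderiv F"] by (simp add: degree_pderiv)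
      ultimately show ?thesis using dH True by auto
    qed simp
    have cG: "coeff G (?D - 1) = 0" using dG by (auto intro: coeff_eq_0)
    let ?h = "[:coeff H (?D - 1) / lead_coeff F:]"
    have "(\<Sum>y\<in>R. poly g y) = poly ?h x" if s: "simple_split (F - [:x:]) R" for x R
    proof -
      define K where "K = smult x G + H"
      have card: "card R = ?D" using simple_split_degree[OF s] degF by simp
      have dK: "degree K < card R" unfolding K_def card
        using dG dH assms by (intro degree_add_less) (auto intro: le_less_trans[OF degree_smult_le])
      have "poly g y = poly K y / poly (pderiv (F - [:x:])) y" if "y \<in> R" for y
      proof -
        have Fy: "poly F y = x" using simple_split_root[OF s, of y] that by simp
        have "poly (g * pderiv F) y = poly K y" unfolding GH K_def by (simp add: Fy)
        moreover have "pderiv (F - [:x:]) = pderiv F" by (simp add: pderiv_diff pderiv_pCons)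
        ultimately show ?thesis using simple_split_pderiv_root(2)[OF s that] by (simp add: field_simps)
      qed
      then have "(\<Sum>y\<in>R. poly g y) = coeff K (card R - 1) / lead_coeff (F - [:x:])"
        using sum_roots_div_pderiv[OF s dK] by simp
      also have "\<dots> = poly ?h x" unfolding lead card K_def using cG by simp
      finally show ?thesis .
    qed
    then show ?thesis by (intro exI[of _ ?h]) auto
  next
    case False
    define G H where "G = g div F" "H = g mod F"
    have GH: "g = G * F + H" by (simp add: G_H_def)
    have F0: "F \<noteq> 0" using assms by auto
    have dH: "degree H < ?D" unfolding G_H_def
      using assms degree_mod_less[OF F0, of g] by auto
    have G0: "G \<noteq> 0" using False dH GH by auto
    have dg: "degree g = degree G + ?D"
    proof -
      have "degree (G * F) = degree G + ?D" using G0 F0 by (rule degree_mult_eq)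
      then show ?thesis unfolding GH using dH by (subst degree_add_eq_left) auto
    qed
    obtain hG where hG: "?D * degree hG \<le> degree G"
      "\<And>x R. simple_split (F - [:x:]) R \<Longrightarrow> (\<Sum>y\<in>R. poly G y) = poly hG x"
      using less[of G] dg assms by auto
    obtain hH where hH: "?D * degree hH \<le> degree H"
      "\<And>x R. simple_split (F - [:x:]) R \<Longrightarrow> (\<Sum>y\<in>R. poly H y) = poly hH x"
      using less[of H] dH False by auto
    let ?h = "[:0, 1:] * hG + hH"
    have "(\<Sum>y\<in>R. poly g y) = poly ?h x" if s: "simple_split (F - [:x:]) R" for x R
    proof -
      have "poly F y = x" if "y \<in> R" for y using simple_split_root[OF s, of y] that by simp
      then have "(\<Sum>y\<in>R. poly g y) = x * (\<Sum>y\<in>R. poly G y) + (\<Sum>y\<in>R. poly H y)"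
        unfolding GH sum_distrib_left by (simp add: sum.distrib mult.commute)
      then show ?thesis using hG(2)[OF s] hH(2)[OF s] by simp
    qed
    moreover have "?D * degree ?h \<le> degree g"
    proof -
      have "degree hH = 0"
      proof (rule ccontr)
        assume "degree hH \<noteq> 0"
        then have "?D * 1 \<le> ?D * degree hH" by (intro mult_le_mono2) simp
        also have "\<dots> \<le> degree H" by (rule hH(1))
        finally show False using dH by simp
      qed
      moreover have "degree ([:0, 1:] * hG) \<le> 1 + degree hG" 
        using degree_mult_le[of "[:0, 1:]" hG] by simp
      ultimately have "degree ?h \<le> 1 + degree hG"
        by (intro degree_add_le) auto
      then have "?D * degree ?h \<le> ?D * (1 + degree hG)" by (rule mult_le_mono2)
      then show ?thesis using hG(1) dg by simp
    qed
    ultimately show ?thesis by blast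
  qed
qed

section \<open>Perturbation of orthogonal polynomials\<close>

text \<open>The monic orthogonal polynomials of the Jacobi matrix with diagonal \<open>b\<close> and squared off-diagonal
entries \<open>a\<close>. The monic form avoids square roots, and also signs when \<open>T\<close> has a negative leading
coefficient.\<close>

fun rec_poly :: "(nat \<Rightarrow> real) \<Rightarrow> (nat \<Rightarrow> real) \<Rightarrow> nat \<Rightarrow> real poly" where
  "rec_poly b a 0 = 1"
| "rec_poly b a (Suc 0) = [:- b 0, 1:]"
| "rec_poly b a (Suc (Suc k)) =
     [:- b (Suc k), 1:] * rec_poly b a (Suc k) - smult (a (Suc k)) (rec_poly b a k)"

lemma rec_poly_degree_lead:
  "degree (rec_poly b a k) = k \<and> lead_coeff (rec_poly b a k) = 1"
proof (induction k rule: induct_nat_012)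
  case (ge2 k)
  let ?q = "[:- b (Suc k), 1:] * rec_poly b a (Suc k)"
  have nz: "rec_poly b a (Suc k) \<noteq> 0" using ge2(2) by auto
  have dq: "degree ?q = Suc (Suc k)" using nz ge2 by (subst degree_mult_eq) auto
  have lq: "lead_coeff ?q = 1" using ge2 by (subst lead_coeff_mult) auto
  have "degree (smult (a (Suc k)) (rec_poly b a k)) < degree ?q"
    using ge2 dq degree_smult_le[of "a (Suc k)" "rec_poly b a k"] by linarith
  then have "degree (rec_poly b a (Suc (Suc k))) = degree ?q"
    using degree_add_eq_left[of "- smult (a (Suc k)) (rec_poly b a k)" ?q]
    by (simp del: mult_pCons_left)
  moreover have "coeff (rec_poly b a (Suc (Suc k))) (Suc (Suc k)) = 1"
  proof -
    have "coeff (smult (a (Suc k)) (rec_poly b a k)) (Suc (Suc k)) = 0"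
      using ge2 by (intro coeff_eq_0) (auto intro: le_less_trans[OF degree_smult_le])
    then show ?thesis using lq dq by (simp del: mult_pCons_left)
  qed
  ultimately show ?case using dq by simp
qed auto

lemma degree_rec_poly [simp]: "degree (rec_poly b a k) = k"
  and lead_rec_poly [simp]: "coeff (rec_poly b a k) k = 1"
  using rec_poly_degree_lead[of b a k] by auto

lemma rec_poly_subleading: "coeff (rec_poly b a (Suc k)) k = - (\<Sum>i\<le>k. b i)"
proof (induction k)
  case (Suc k)
  have "coeff (rec_poly b a k) (Suc k) = 0" by (intro coeff_eq_0) auto
  then show ?case using Suc by (simp add: coeff_pCons)
qed simp

text \<open>The recurrence determines a solution from its first entry. The bound \<open>n\<close> is for solutions on a
finite segment, such as one block read backwards.\<close>

lemma rec_poly_solution: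
  assumes y1: "1 \<le> n \<Longrightarrow> y 1 = (c - b 0) * y 0"
    and y2: "\<And>i. Suc (Suc i) \<le> n \<Longrightarrow> y (Suc (Suc i)) = (c - b (Suc i)) * y (Suc i) - a (Suc i) * y i"
    and "k \<le> n"
  shows "y k = y 0 * poly (rec_poly b a k) c"
  using \<open>k \<le> n\<close>
proof (induction k rule: induct_nat_012)
  case 1
  then show ?case using y1 by simp
next
  case (ge2 i)
  have IH: "y (Suc i) = y 0 * poly (rec_poly b a (Suc i)) c" "y i = y 0 * poly (rec_poly b a i) c"
    by (rule ge2; use ge2(3) in simp)+
  show ?case unfolding y2[OF ge2(3)] IH by (simp add: algebra_simps)
qed simp

text \<open>The remainder \<open>g - smult (coeff g k) p\<close> has degree less than \<open>k\<close>, so it is orthogonal to \<open>p\<close>.\<close>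

lemma orthogonal_pythagoras:
  fixes w :: "real \<Rightarrow> real" and p g :: "real poly"
  assumes "finite C" and deg: "degree p = k" and lead: "coeff p k = 1"
    and orth: "\<And>g. degree g \<le> k \<Longrightarrow> (\<Sum>c\<in>C. w c * poly (p * g) c) = H * coeff g k"
    and g: "degree g \<le> k"
  shows "(\<Sum>c\<in>C. w c * poly (g * g) c) =
    H * (coeff g k)\<^sup>2 + (\<Sum>c\<in>C. w c * (poly (g - smult (coeff g k) p) c)\<^sup>2)"
proof -
  define t where "t = coeff g k"
  define r where "r = g - smult t p"
  have r: "degree r \<le> k" "coeff r k = 0"
    using g deg lead by (auto simp: r_def t_def intro!: degree_diff_le order_trans[OF degree_smult_le])
  have "(\<Sum>c\<in>C. w c * poly (g * g) c) = (\<Sum>c\<in>C. t\<^sup>2 * (w c * poly (p * p) c) + 2 * t * (w c * poly (p * r) c)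
      + w c * (poly r c)\<^sup>2)"
    by (intro sum.cong refl) (simp add: r_def power2_eq_square algebra_simps)
  also have "\<dots> = t\<^sup>2 * (\<Sum>c\<in>C. w c * poly (p * p) c) + 2 * t * (\<Sum>c\<in>C. w c * poly (p * r) c)
      + (\<Sum>c\<in>C. w c * (poly r c)\<^sup>2)"
    by (simp only: sum.distrib sum_distrib_left)
  also have "\<dots> = H * t\<^sup>2 + (\<Sum>c\<in>C. w c * (poly r c)\<^sup>2)"
    using orth[of p] orth[of r] deg lead r by (simp del: poly_mult)
  finally show ?thesis by (simp add: t_def r_def)
qed

text \<open>The numbers \<open>H0 k\<close> and \<open>H1 k\<close> are the minima of the squared norm over monic polynomials of degree
\<open>k\<close>, so they inherit the comparison of the weights. Moreover \<open>p1 k\<close> is an almost optimal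
competitor for \<open>w0\<close>. By Pythagoras the difference \<open>p1 k - p0 k\<close> has small norm, which bounds its top
coefficient. No constant depends on the number of points or on \<open>K\<close>.\<close>

lemma orthogonal_polys_perturbation:
  fixes w0 w1 :: "real \<Rightarrow> real" and p0 p1 :: "nat \<Rightarrow> real poly"
  assumes fin: "finite C"
    and w: "\<And>c. c \<in> C \<Longrightarrow> 0 \<le> w1 c" "\<And>c. c \<in> C \<Longrightarrow> w1 c \<le> w0 c"
      "\<And>c. c \<in> C \<Longrightarrow> (1 - \<delta>) * w0 c \<le> w1 c"
    and \<delta>: "\<delta> < 1"
    and p0: "\<And>k. degree (p0 k) = k" "\<And>k. coeff (p0 k) k = 1"
    and p1: "\<And>k. degree (p1 k) = k" "\<And>k. coeff (p1 k) k = 1"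
    and o0: "\<And>k g. k \<le> K \<Longrightarrow> degree g \<le> k \<Longrightarrow> (\<Sum>c\<in>C. w0 c * poly (p0 k * g) c) = H0 k * coeff g k"
    and o1: "\<And>k g. k \<le> K \<Longrightarrow> degree g \<le> k \<Longrightarrow> (\<Sum>c\<in>C. w1 c * poly (p1 k * g) c) = H1 k * coeff g k"
  shows "k \<le> K \<Longrightarrow> (1 - \<delta>) * H0 k \<le> H1 k" "k \<le> K \<Longrightarrow> H1 k \<le> H0 k"
    and "Suc k \<le> K \<Longrightarrow> (1 - \<delta>) * (H0 k * (coeff (p1 (Suc k)) k - coeff (p0 (Suc k)) k)\<^sup>2) \<le> \<delta> * H0 (Suc k)"
proof -
  have w0: "0 \<le> w0 c" if "c \<in> C" for c using w that by fastforce
  have nn0: "0 \<le> (\<Sum>c\<in>C. w0 c * (poly q c)\<^sup>2)" and nn1: "0 \<le> (\<Sum>c\<in>C. w1 c * (poly q c)\<^sup>2)" for q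
    using w w0 by (auto intro!: sum_nonneg mult_nonneg_nonneg)
  have H1: "H1 k \<le> H0 k" if k: "k \<le> K" for k
  proof -
    have "H1 k \<le> (\<Sum>c\<in>C. w1 c * poly (p0 k * p0 k) c)"
      using orthogonal_pythagoras[OF fin p1 o1[OF k], of "p0 k"] p0 nn1[of "p0 k - p1 k"] by simp
    also have "\<dots> \<le> (\<Sum>c\<in>C. w0 c * poly (p0 k * p0 k) c)"
      using w by (intro sum_mono mult_right_mono) auto
    also have "\<dots> = H0 k" using o0[OF k, of "p0 k"] p0 by simp
    finally show ?thesis .
  qed
  have H01: "(1 - \<delta>) * (H0 k + (\<Sum>c\<in>C. w0 c * (poly (p1 k - p0 k) c)\<^sup>2)) \<le> H1 k" if k: "k \<le> K" for k
  proof -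
    have "H0 k + (\<Sum>c\<in>C. w0 c * (poly (p1 k - p0 k) c)\<^sup>2) = (\<Sum>c\<in>C. w0 c * poly (p1 k * p1 k) c)"
      using orthogonal_pythagoras[OF fin p0 o0[OF k], of "p1 k"] p1 by simp
    then have "(1 - \<delta>) * (H0 k + (\<Sum>c\<in>C. w0 c * (poly (p1 k - p0 k) c)\<^sup>2)) =
        (\<Sum>c\<in>C. (1 - \<delta>) * w0 c * poly (p1 k * p1 k) c)"
      by (simp add: sum_distrib_left mult_ac)
    also have "\<dots> \<le> (\<Sum>c\<in>C. w1 c * poly (p1 k * p1 k) c)"
      using w by (intro sum_mono mult_right_mono) auto
    also have "\<dots> = H1 k" using o1[OF k, of "p1 k"] p1 by simp
    finally show ?thesis .
  qed
  show "(1 - \<delta>) * H0 k \<le> H1 k" if "k \<le> K"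
  proof -
    have "(1 - \<delta>) * H0 k \<le> (1 - \<delta>) * (H0 k + (\<Sum>c\<in>C. w0 c * (poly (p1 k - p0 k) c)\<^sup>2))"
      using \<delta> nn0[of "p1 k - p0 k"] by (intro mult_left_mono) auto
    then show ?thesis using H01[OF that] by linarith
  qed
  show "H1 k \<le> H0 k" if "k \<le> K" using H1[OF that] .
  show "(1 - \<delta>) * (H0 k * (coeff (p1 (Suc k)) k - coeff (p0 (Suc k)) k)\<^sup>2) \<le> \<delta> * H0 (Suc k)"
    if k: "Suc k \<le> K"
  proof -
    define r where "r = p1 (Suc k) - p0 (Suc k)"
    have r: "degree r \<le> k"
    proof (rule degree_le, intro allI impI)
      fix i assume "k < i"
      then consider "i = Suc k" | "i > Suc k" by linarith
      then show "coeff r i = 0" by cases (auto simp: r_def p0 p1 coeff_eq_0)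
    qed
    have "H0 k * (coeff r k)\<^sup>2 \<le> (\<Sum>c\<in>C. w0 c * poly (r * r) c)"
      using orthogonal_pythagoras[OF fin p0 o0[of k] r] k nn0[of "r - smult (coeff r k) (p0 k)"] by simp
    then have "(1 - \<delta>) * (H0 k * (coeff r k)\<^sup>2) \<le> (1 - \<delta>) * (\<Sum>c\<in>C. w0 c * (poly r c)\<^sup>2)"
      using \<delta> by (intro mult_left_mono) (auto simp: power2_eq_square)
    also have "\<dots> \<le> H1 (Suc k) - (1 - \<delta>) * H0 (Suc k)"
      using H01[OF k] by (simp add: r_def algebra_simps)
    also have "\<dots> \<le> \<delta> * H0 (Suc k)" using H1[OF k] by (simp add: algebra_simps)
    finally show ?thesis by (simp add: r_def)
  qed
qed

section \<open>Orthogonal polynomials of a compactly supported measure\<close>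

lemmas Lint_cong = Bochner_Integration.integral_cong

text \<open>A measure together with its Jacobi coefficients; \<open>a k\<close> is the square of the \<open>k\<close>-th off-diagonal
entry.\<close>

locale jacobi_measure = prob_space M for M :: "real measure" +
  fixes E :: "real set" and \<xi> :: real and b a :: "nat \<Rightarrow> real"
  assumes sets_M: "sets M = sets borel"
    and AE_E: "AE x in M. x \<in> E"
    and compact_E: "compact E"
    and E_bound: "E \<subseteq> {-\<xi>..\<xi>}"
    and a_pos: "k \<ge> 1 \<Longrightarrow> a k > 0"
    and orth: "(\<integral>x. poly (rec_poly b a i) x * poly (rec_poly b a j) x \<partial>M) =
        (if i = j then \<Prod>l=1..i. a l else 0)"
begin

abbreviation Q :: "nat \<Rightarrow> real poly" where "Q \<equiv> rec_poly b a"

definition h :: "nat \<Rightarrow> real" where "h k = (\<Prod>l=1..k. a l)"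

lemma h_0 [simp]: "h 0 = 1" and h_Suc: "h (Suc k) = h k * a (Suc k)"
  by (simp_all add: h_def)

lemma h_pos: "h k > 0"
  unfolding h_def using a_pos by (intro prod_pos) auto

lemma integrable_continuous:
  fixes f :: "real \<Rightarrow> real"
  assumes "f \<in> borel_measurable borel" "continuous_on E f"
  shows "integrable M f"
proof -
  have "bounded (f ` E)"
    using compact_continuous_image[OF assms(2) compact_E] compact_imp_bounded by blast
  then obtain B where "\<And>x. x \<in> E \<Longrightarrow> norm (f x) \<le> B" by (auto simp: bounded_iff)
  then have "AE x in M. norm (f x) \<le> B" using AE_E by auto
  moreover have "f \<in> borel_measurable M"
    using assms(1) measurable_cong_sets[OF sets_M refl] by blast
  ultimately show ?thesis by (intro integrable_const_bound)
qed

lemma poly_measurable [measurable]: "poly (p::real poly) \<in> borel_measurable borel"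
  by (intro borel_measurable_continuous_onI) (auto intro: continuous_intros)

lemma integrable_poly [simp]: "integrable M (poly p)"
  by (intro integrable_continuous) (auto intro: continuous_intros)

lemma measurable_M [measurable_cong]: "sets M = sets borel"
  by (rule sets_M)

lemma integral_poly_mono:
  assumes "\<And>x. x \<in> E \<Longrightarrow> poly p x \<le> poly q x"
  shows "(\<integral>x. poly p x \<partial>M) \<le> (\<integral>x. poly q x \<partial>M)"
  using AE_E assms by (intro integral_mono_AE) auto

lemma integral_Q_mult:
  assumes "degree g \<le> k"
  shows "(\<integral>x. poly (Q k * g) x \<partial>M) = h k * coeff g k"
proof -
  have "(\<integral>x. poly (Q k * g) x \<partial>M) = h k * coeff g k" if "degree g \<le> n" "n \<le> k" for n
    using that
  proof (induction n arbitrary: g)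
    case 0
    then obtain c where g: "g = [:c:]" by (meson degree_eq_zeroE le_zero_eq)
    have "(\<integral>x. poly (Q k * g) x \<partial>M) = (\<integral>x. poly (Q k) x * poly (Q 0) x * c \<partial>M)"
      by (simp add: g mult.commute)
    also have "\<dots> = (if k = 0 then h k * c else 0)"
      using orth[of k 0] by (simp add: h_def)
    finally show ?case by (simp add: g coeff_pCons split: nat.splits)
  next
    case (Suc n)
    define c where "c = coeff g (Suc n)"
    define g' where "g' = g - smult c (Q (Suc n))"
    have g': "degree g' \<le> n"
    proof (rule degree_le, intro allI impI)
      fix i assume "n < i"
      then consider "i = Suc n" | "i > Suc n" by linarith
      then show "coeff g' i = 0"
        by cases (use Suc.prems(1) in \<open>auto simp: g'_def c_def coeff_eq_0\<close>)
    qed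
    have IH: "(\<integral>x. poly (Q k * g') x \<partial>M) = h k * coeff g' k"
      using Suc g' by auto
    have "(\<integral>x. poly (Q k * g) x \<partial>M) =
        (\<integral>x. poly (Q k) x * poly (Q (Suc n)) x * c + poly (Q k * g') x \<partial>M)"
      by (intro Lint_cong) (auto simp: g'_def algebra_simps)
    also have "\<dots> = (\<integral>x. poly (Q k) x * poly (Q (Suc n)) x * c \<partial>M) + (\<integral>x. poly (Q k * g') x \<partial>M)"
    proof (rule Bochner_Integration.integral_add)
      have "(\<lambda>x. poly (Q k) x * poly (Q (Suc n)) x * c) = poly (smult c (Q k * Q (Suc n)))"
        by (simp add: fun_eq_iff)
      then show "integrable M (\<lambda>x. poly (Q k) x * poly (Q (Suc n)) x * c)"
        by (simp only: integrable_poly)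
    qed (rule integrable_poly)
    also have "\<dots> = (if k = Suc n then h k * c else 0) + h k * coeff g' k"
      unfolding IH using orth[of k "Suc n"] by (simp add: h_def)
    also have "\<dots> = h k * coeff g k"
    proof (cases "k = Suc n")
      case True
      then show ?thesis using g' by (simp add: c_def coeff_eq_0)
    next
      case False
      then have "coeff g k = 0" "coeff g' k = 0" using Suc.prems g' by (auto intro!: coeff_eq_0)
      then show ?thesis using False by simp
    qed
    finally show ?case .
  qed
  then show ?thesis using assms by blast
qed

text \<open>The difference of the two sides is the integral of the square of \<open>g - smult (coeff g k) (Q k)\<close>.\<close>

lemma integral_square_ge:
  assumes "degree g \<le> k"
  shows "(\<integral>x. poly (g * g) x \<partial>M) \<ge> h k * (coeff g k)\<^sup>2"
proof -
  define c where "c = coeff g k"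
  let ?r = "g - smult c (Q k)"
  have "0 \<le> (\<integral>x. poly (?r * ?r) x \<partial>M)"
    using integral_poly_mono[of 0 "?r * ?r"] by simp
  also have "\<dots> = (\<integral>x. poly (g * g) x - (2 * c) * poly (Q k * g) x
       + c\<^sup>2 * poly (Q k * Q k) x \<partial>M)"
    by (intro Lint_cong) (auto simp: algebra_simps power2_eq_square)
  also have "\<dots> = (\<integral>x. poly (g * g) x \<partial>M) - (2 * c) * (\<integral>x. poly (Q k * g) x \<partial>M)
       + c\<^sup>2 * (\<integral>x. poly (Q k * Q k) x \<partial>M)"
    by (simp del: poly_mult)
  also have "\<dots> = (\<integral>x. poly (g * g) x \<partial>M) - h k * c\<^sup>2"
    using integral_Q_mult[OF assms] integral_Q_mult[of "Q k" k]
    by (simp add: c_def power2_eq_square algebra_simps del: poly_mult)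
  finally show ?thesis by (simp add: c_def)
qed

text \<open>If \<open>f - Q k\<close> were a nonzero polynomial, of degree \<open>l\<close> say, then \<open>l < k\<close>, so it would be orthogonal
to \<open>Q l\<close>. But its inner product with \<open>Q l\<close> is \<open>h l\<close> times its leading coefficient.\<close>

lemma monic_orthogonal_unique:
  assumes "degree f = k" "coeff f k = 1"
    and o: "\<And>g. degree g < k \<Longrightarrow> (\<integral>x. poly (f * g) x \<partial>M) = 0"
  shows "f = Q k"
proof (rule ccontr)
  define r where "r = f - Q k"
  assume "f \<noteq> Q k"
  then have r0: "r \<noteq> 0" by (simp add: r_def)
  have dr: "degree r < k"
  proof -
    have "degree r \<le> k" unfolding r_def using assms by (intro degree_diff_le) auto
    moreover have "coeff r k = 0" using assms by (simp add: r_def)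
    ultimately show ?thesis using r0 by (metis leading_coeff_0_iff nat_less_le)
  qed
  have "h (degree r) * lead_coeff r = (\<integral>x. poly (Q (degree r) * r) x \<partial>M)"
    using integral_Q_mult[of r "degree r"] by simp
  also have "\<dots> = (\<integral>x. poly (f * Q (degree r)) x - poly (Q k * Q (degree r)) x \<partial>M)"
    by (intro Lint_cong) (auto simp: r_def algebra_simps)
  also have "\<dots> = (\<integral>x. poly (f * Q (degree r)) x \<partial>M) - (\<integral>x. poly (Q k * Q (degree r)) x \<partial>M)"
    by (intro Bochner_Integration.integral_diff integrable_poly)
  also have "\<dots> = 0"
    using o[of "Q (degree r)"] dr integral_Q_mult[of "Q (degree r)" k]
    by (simp add: coeff_eq_0 del: poly_mult)
  finally show False using h_pos[of "degree r"] r0 by simp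
qed

lemma Q_shift:
  "[:0, 1:] * Q k = Q (Suc k) + smult (b k) (Q k) + (if k = 0 then 0 else smult (a k) (Q (k - 1)))"
proof (cases k)
  case (Suc i)
  have "Q (Suc (Suc i)) = [:0, 1:] * Q (Suc i) - smult (b (Suc i)) (Q (Suc i)) - smult (a (Suc i)) (Q i)"
    by (simp add: algebra_simps)
  then show ?thesis using Suc by simp
qed simp

lemma xi_nonneg: "\<xi> \<ge> 0"
proof (rule ccontr)
  assume "\<not> \<xi> \<ge> 0"
  then have "E = {}" using E_bound by auto
  then have "AE x in M. False" using AE_E by auto
  then show False using prob_space_axioms by (simp add: prob_space.AE_False)
qed

lemma integral_x_Q_square: "(\<integral>x. poly (Q k * ([:0, 1:] * Q k)) x \<partial>M) = b k * h k"
proof -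
  have "(\<integral>x. poly (Q k * ([:0, 1:] * Q k)) x \<partial>M) =
      (\<integral>x. poly (Q k * Q (Suc k)) x + b k * poly (Q k * Q k) x
        + poly (Q k * (if k = 0 then 0 else smult (a k) (Q (k - 1)))) x \<partial>M)"
    unfolding Q_shift by (intro Lint_cong) (auto simp: algebra_simps)
  also have "\<dots> = (\<integral>x. poly (Q (Suc k) * Q k) x \<partial>M) + b k * (\<integral>x. poly (Q k * Q k) x \<partial>M)
        + (\<integral>x. poly (Q k * (if k = 0 then 0 else smult (a k) (Q (k - 1)))) x \<partial>M)"
    by (simp del: poly_mult add: mult.commute)
  also have "\<dots> = b k * h k"
  proof -
    have 1: "(\<integral>x. poly (Q (Suc k) * Q k) x \<partial>M) = 0"
      using integral_Q_mult[of "Q k" "Suc k"] by (simp add: coeff_eq_0)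
    have 2: "(\<integral>x. poly (Q k * Q k) x \<partial>M) = h k"
      using integral_Q_mult[of "Q k" k] by simp
    let ?g = "if k = 0 then 0 else smult (a k) (Q (k - 1))"
    have "degree ?g \<le> k" by (auto intro: order_trans[OF degree_smult_le])
    moreover have "coeff ?g k = 0" by (simp add: coeff_eq_0)
    ultimately have 3: "(\<integral>x. poly (Q k * ?g) x \<partial>M) = 0" using integral_Q_mult[of ?g k] by simp
    show ?thesis unfolding 1 2 3 by simp
  qed
  finally show ?thesis .
qed

lemma b_bound: "\<bar>b k\<bar> \<le> \<xi>"
proof -
  note eq = integral_x_Q_square[of k]
  have hk: "(\<integral>x. poly (smult c (Q k * Q k)) x \<partial>M) = c * h k" for c
    using integral_Q_mult[of "Q k" k] by (simp del: poly_mult)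
  have "b k * h k \<le> \<xi> * h k" unfolding eq[symmetric] hk[of \<xi>, symmetric]
  proof (rule integral_poly_mono)
    fix x assume "x \<in> E"
    then have "x * (poly (Q k) x)\<^sup>2 \<le> \<xi> * (poly (Q k) x)\<^sup>2"
      using E_bound by (intro mult_right_mono) auto
    then show "poly (Q k * ([:0, 1:] * Q k)) x \<le> poly (smult \<xi> (Q k * Q k)) x"
      by (simp add: power2_eq_square algebra_simps)
  qed
  moreover have "(-\<xi>) * h k \<le> b k * h k" unfolding eq[symmetric] hk[of "-\<xi>", symmetric]
  proof (rule integral_poly_mono)
    fix x assume "x \<in> E"
    then have "(-\<xi>) * (poly (Q k) x)\<^sup>2 \<le> x * (poly (Q k) x)\<^sup>2"
      using E_bound by (intro mult_right_mono) auto
    then show "poly (smult (-\<xi>) (Q k * Q k)) x \<le> poly (Q k * ([:0, 1:] * Q k)) x"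
      by (simp add: power2_eq_square algebra_simps)
  qed
  ultimately have "b k \<le> \<xi>" "-\<xi> \<le> b k" using h_pos[of k] mult_right_le_imp_le by blast+
  then show ?thesis by simp
qed

lemma a_bound: "a (Suc k) \<le> \<xi>\<^sup>2"
proof -
  let ?g = "[:0, 1:] * Q k"
  have "Q k \<noteq> 0" using lead_rec_poly[of b a k] by (metis coeff_0 zero_neq_one)
  then have "degree ?g = Suc k" by simp
  moreover have "coeff ?g (Suc k) = 1" by simp
  ultimately have "h (Suc k) \<le> (\<integral>x. poly (?g * ?g) x \<partial>M)"
    using integral_square_ge[of ?g "Suc k"] by simp
  also have "\<dots> \<le> (\<integral>x. poly (smult (\<xi>\<^sup>2) (Q k * Q k)) x \<partial>M)"
  proof (rule integral_poly_mono)
    fix x assume "x \<in> E"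
    then have "-\<xi> \<le> x" "x \<le> \<xi>" using E_bound by auto
    then have "x\<^sup>2 \<le> \<xi>\<^sup>2" by (intro abs_le_square_iff[THEN iffD1]) auto
    then have "x\<^sup>2 * (poly (Q k) x)\<^sup>2 \<le> \<xi>\<^sup>2 * (poly (Q k) x)\<^sup>2" by (intro mult_right_mono) auto
    then show "poly (?g * ?g) x \<le> poly (smult (\<xi>\<^sup>2) (Q k * Q k)) x"
      by (simp add: power2_eq_square algebra_simps)
  qed
  also have "\<dots> = h k * \<xi>\<^sup>2"
    using integral_Q_mult[of "Q k" k] by (simp del: poly_mult add: mult.commute)
  finally show ?thesis using h_pos[of k] by (simp add: h_Suc)
qed

text \<open>The only part of the spectral weights of a block that depends on the block.\<close>

definition \<phi> :: "nat \<Rightarrow> real \<Rightarrow> real" where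
  "\<phi> j v = poly (Q (Suc j)) v / poly (Q j) v"

text \<open>Up to a factor, the polynomial \<open>f\<close> in the proof is the Christoffel-Darboux kernel at \<open>v\<close>. The integral
of \<open>(v - x) * f\<^sup>2\<close> can be evaluated by orthogonality, and \<open>\<bar>v - x\<bar> \<ge> \<bar>v\<bar> - \<xi>\<close> on \<open>E\<close>.\<close>

lemma Q_ratio_lower:
  assumes v: "\<bar>v\<bar> > \<xi>"
  shows "sgn v * (poly (Q (Suc j)) v * poly (Q j) v) \<ge> (\<bar>v\<bar> - \<xi>) * (poly (Q j) v)\<^sup>2"
proof -
  define s t where "s = poly (Q j) v" and "t = poly (Q (Suc j)) v"
  define A where "A = smult s (Q (Suc j)) - smult t (Q j)"
  have "poly A v = 0" by (simp add: A_def s_def t_def)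
  then obtain f where f: "A = [:-v, 1:] * f" by (metis dvdE poly_eq_0_iff_dvd)
  have "degree A \<le> Suc j" unfolding A_def
    by (intro degree_diff_le) (auto intro: order_trans[OF degree_smult_le])
  moreover have "degree A = Suc (degree f)" if "f \<noteq> 0"
    unfolding f using that by (subst degree_mult_eq) auto
  ultimately have df: "degree f \<le> j" by (cases "f = 0") auto
  have "coeff A (Suc j) = coeff f j" unfolding f using df by (simp add: coeff_eq_0)
  then have cf: "coeff f j = s" by (simp add: A_def coeff_eq_0)
  have "(\<bar>v\<bar> - \<xi>) * (h j * s\<^sup>2) \<le> (\<bar>v\<bar> - \<xi>) * (\<integral>x. poly (f * f) x \<partial>M)"
    using integral_square_ge[OF df] v by (intro mult_left_mono) (auto simp: cf)
  also have "\<dots> = (\<integral>x. poly (smult (\<bar>v\<bar> - \<xi>) (f * f)) x \<partial>M)"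
    by (simp del: poly_mult)
  also have "\<dots> \<le> (\<integral>x. poly (smult (- sgn v) (A * f)) x \<partial>M)"
  proof (rule integral_poly_mono)
    fix x assume "x \<in> E"
    then have "\<bar>v\<bar> - \<xi> \<le> sgn v * (v - x)" using E_bound v xi_nonneg
      by (auto simp: sgn_if abs_if split: if_splits)
    then have "(\<bar>v\<bar> - \<xi>) * (poly f x)\<^sup>2 \<le> sgn v * (v - x) * (poly f x)\<^sup>2"
      by (intro mult_right_mono) auto
    then show "poly (smult (\<bar>v\<bar> - \<xi>) (f * f)) x \<le> poly (smult (- sgn v) (A * f)) x"
      unfolding f by (simp add: power2_eq_square algebra_simps)
  qed
  also have "\<dots> = - sgn v * (\<integral>x. poly (A * f) x \<partial>M)" by (simp del: poly_mult)
  also have "(\<integral>x. poly (A * f) x \<partial>M) =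
      (\<integral>x. s * poly (Q (Suc j) * f) x - t * poly (Q j * f) x \<partial>M)"
    by (intro Lint_cong) (auto simp: A_def algebra_simps)
  also have "\<dots> = s * (\<integral>x. poly (Q (Suc j) * f) x \<partial>M) - t * (\<integral>x. poly (Q j * f) x \<partial>M)"
    by (simp del: poly_mult rec_poly.simps)
  also have "\<dots> = - t * (h j * s)"
    using integral_Q_mult[of f "Suc j"] integral_Q_mult[of f j] df cf
    by (simp add: coeff_eq_0 del: poly_mult rec_poly.simps)
  finally have "h j * ((\<bar>v\<bar> - \<xi>) * s\<^sup>2) \<le> h j * (sgn v * (t * s))"
    by (simp add: algebra_simps)
  then show ?thesis using h_pos[of j] by (simp add: s_def t_def)
qed

lemma Q_nonzero: "\<bar>v\<bar> > \<xi> \<Longrightarrow> poly (Q j) v \<noteq> 0"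
proof (induction j)
  case (Suc j)
  then have "(\<bar>v\<bar> - \<xi>) * (poly (Q j) v)\<^sup>2 > 0" by simp
  then show ?case using Q_ratio_lower[OF Suc.prems, of j] by (auto simp del: rec_poly.simps)
qed simp

lemma \<phi>_lower: "\<bar>v\<bar> > \<xi> \<Longrightarrow> sgn v * \<phi> j v \<ge> \<bar>v\<bar> - \<xi>"
proof -
  assume v: "\<bar>v\<bar> > \<xi>"
  define s t where "s = poly (Q j) v" and "t = poly (Q (Suc j)) v"
  have s: "s \<noteq> 0" using Q_nonzero[OF v] by (simp add: s_def)
  then have "(\<bar>v\<bar> - \<xi>) * s\<^sup>2 \<le> (sgn v * \<phi> j v) * s\<^sup>2"
    using Q_ratio_lower[OF v, of j]
    by (simp add: \<phi>_def s_def[symmetric] t_def[symmetric] power2_eq_square del: rec_poly.simps)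
  then show ?thesis using s by simp
qed

lemma \<phi>_abs: "\<bar>v\<bar> > \<xi> \<Longrightarrow> \<bar>\<phi> j v\<bar> = sgn v * \<phi> j v"
  using \<phi>_lower[of v j] xi_nonneg by (cases "v > 0") (auto simp: sgn_if split: if_splits)

lemma \<phi>_0: "\<phi> 0 v = v - b 0" by (simp add: \<phi>_def)

lemma \<phi>_Suc: "\<bar>v\<bar> > \<xi> \<Longrightarrow> \<phi> (Suc j) v = v - b (Suc j) - a (Suc j) / \<phi> j v"
proof -
  assume v: "\<bar>v\<bar> > \<xi>"
  have "poly (Q (Suc (Suc j))) v =
      (v - b (Suc j)) * poly (Q (Suc j)) v - a (Suc j) * poly (Q j) v"
    by (simp add: algebra_simps)
  then show ?thesis unfolding \<phi>_def using Q_nonzero[OF v, of j] Q_nonzero[OF v, of "Suc j"]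
    by (simp del: rec_poly.simps add: field_simps)
qed

text \<open>The functions of the second kind: a further solution of the recurrence, independent of \<open>Q\<close>.\<close>

definition S :: "nat \<Rightarrow> real \<Rightarrow> real" where
  "S k c = (\<integral>x. poly (Q k) x / (c - x) \<partial>M)"

lemma integrable_Cauchy:
  assumes "c \<notin> E"
  shows "integrable M (\<lambda>x. poly p x / (c - x))"
  by (rule integrable_continuous) (use assms in \<open>auto intro!: continuous_intros\<close>)

lemma S_shift:
  assumes "c \<notin> E"
  shows "(\<integral>x. poly ([:0, 1:] * p) x / (c - x) \<partial>M) = c * (\<integral>x. poly p x / (c - x) \<partial>M) - (\<integral>x. poly p x \<partial>M)"
proof -
  have "(\<integral>x. poly ([:0, 1:] * p) x / (c - x) \<partial>M) = (\<integral>x. c * (poly p x / (c - x)) - poly p x \<partial>M)"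
  proof (rule integral_cong_AE)
    show "AE x in M. poly ([:0, 1:] * p) x / (c - x) = c * (poly p x / (c - x)) - poly p x"
      using AE_E
    proof eventually_elim
      case (elim x)
      then have "c - x \<noteq> 0" using assms by auto
      then show ?case by (simp add: field_simps)
    qed
  qed measurable
  also have "\<dots> = c * (\<integral>x. poly p x / (c - x) \<partial>M) - (\<integral>x. poly p x \<partial>M)"
    by (simp only: Bochner_Integration.integral_diff[OF integrable_mult_right[OF
          integrable_Cauchy[OF assms]] integrable_poly] integral_mult_right_zero)
  finally show ?thesis .
qed

lemma integral_Cauchy_linear:
  assumes "c \<notin> E"
  shows "(\<integral>x. poly p x / (c - x) - (u * (poly q x / (c - x)) + v * (poly r x / (c - x))) \<partial>M) =
    (\<integral>x. poly p x / (c - x) \<partial>M) - (u * (\<integral>x. poly q x / (c - x) \<partial>M) + v * (\<integral>x. poly r x / (c - x) \<partial>M))"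
proof -
  note i = integrable_Cauchy[OF assms]
  show ?thesis
    by (simp only: Bochner_Integration.integral_diff[OF i Bochner_Integration.integrable_add[OF
          integrable_mult_right[OF i] integrable_mult_right[OF i]]]
        Bochner_Integration.integral_add[OF integrable_mult_right[OF i] integrable_mult_right[OF i]]
        integral_mult_right_zero)
qed

lemma S_rec:
  assumes c: "c \<notin> E"
  shows "S 1 c = (c - b 0) * S 0 c - 1"
    and "S (Suc (Suc k)) c = (c - b (Suc k)) * S (Suc k) c - a (Suc k) * S k c"
proof -
  have "S 1 c = (\<integral>x. poly ([:0, 1:] * Q 0) x / (c - x)
      - (b 0 * (poly (Q 0) x / (c - x)) + 0 * (poly 0 x / (c - x))) \<partial>M)"
    unfolding S_def by (intro Lint_cong) (auto simp: diff_divide_distrib)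
  also have "\<dots> = (\<integral>x. poly ([:0, 1:] * Q 0) x / (c - x) \<partial>M) - b 0 * S 0 c"
    unfolding S_def integral_Cauchy_linear[OF c] by simp
  also have "\<dots> = (c - b 0) * S 0 c - 1"
  proof -
    have "(\<integral>x. poly (Q 0) x \<partial>M) = (\<integral>x. 1 \<partial>M)"
      by (intro Lint_cong) auto
    also have "\<dots> = 1" by (simp add: prob_space)
    finally have "(\<integral>x. poly (Q 0) x \<partial>M) = 1" .
    then show ?thesis unfolding S_shift[OF c] S_def[symmetric]
      by (simp add: algebra_simps del: rec_poly.simps)
  qed
  finally show "S 1 c = (c - b 0) * S 0 c - 1" .
  have "S (Suc (Suc k)) c = (\<integral>x. poly ([:0, 1:] * Q (Suc k)) x / (c - x)
      - (b (Suc k) * (poly (Q (Suc k)) x / (c - x)) + a (Suc k) * (poly (Q k) x / (c - x))) \<partial>M)"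
    unfolding S_def
    by (intro Lint_cong)
      (auto simp: diff_divide_distrib add_divide_distrib algebra_simps)
  also have "\<dots> = (\<integral>x. poly ([:0, 1:] * Q (Suc k)) x / (c - x) \<partial>M)
      - (b (Suc k) * S (Suc k) c + a (Suc k) * S k c)"
    unfolding S_def by (rule integral_Cauchy_linear[OF c])
  also have "\<dots> = (c - b (Suc k)) * S (Suc k) c - a (Suc k) * S k c"
  proof -
    have "(\<integral>x. poly (Q (Suc k)) x \<partial>M) = 0" using integral_Q_mult[of 1 "Suc k"]
      by (simp del: rec_poly.simps)
    then show ?thesis unfolding S_shift[OF c] S_def[symmetric] by (simp add: algebra_simps)
  qed
  finally show "S (Suc (Suc k)) c = (c - b (Suc k)) * S (Suc k) c - a (Suc k) * S k c" .
qed

text \<open>The discrete Wronskian of the two solutions gets the factor \<open>a (Suc k)\<close> in each step.\<close>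

lemma casoratian:
  assumes c: "c \<notin> E"
  shows "poly (Q k) c * S (Suc k) c - poly (Q (Suc k)) c * S k c = - h k"
proof (induction k)
  case 0
  show ?case using S_rec(1)[OF c] by simp
next
  case (Suc k)
  have Q2: "poly (Q (Suc (Suc k))) c = (c - b (Suc k)) * poly (Q (Suc k)) c - a (Suc k) * poly (Q k) c"
    by (simp add: algebra_simps)
  have "poly (Q (Suc k)) c * S (Suc (Suc k)) c - poly (Q (Suc (Suc k))) c * S (Suc k) c =
    a (Suc k) * (poly (Q k) c * S (Suc k) c - poly (Q (Suc k)) c * S k c)"
    unfolding Q2 S_rec(2)[OF c] by (simp add: algebra_simps del: rec_poly.simps)
  also have "\<dots> = - h (Suc k)" unfolding Suc h_Suc by simp
  finally show ?case .
qed

end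

section \<open>Critical points of the iterates\<close>

text \<open>What is needed of an expanding polynomial with real Julia set \<open>E\<close>. All preimages of points of
\<open>{-\<xi>..\<xi>}\<close> are real and simple, so the transfer operator is a plain sum over the root set \<open>R\<close>.\<close>

locale balanced_jacobi = jacobi_measure M E \<xi> b a for M E \<xi> b a +
  fixes T :: "real poly"
  assumes degree_T: "degree T \<ge> 2"
    and E_iff: "poly T x \<in> E \<longleftrightarrow> x \<in> E"
    and split_T: "x \<in> {-\<xi>..\<xi>} \<Longrightarrow> \<exists>R\<subseteq>{-\<xi>..\<xi>}. simple_split (T - [:x:]) R"
    and split_pderiv_T: "\<exists>R\<subseteq>{-\<xi>..\<xi>}. simple_split (pderiv T) R"
    and balanced: "g \<in> borel_measurable borel \<Longrightarrow> continuous_on E g \<Longrightarrow>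
      k \<in> borel_measurable borel \<Longrightarrow>
      (\<And>x R. x \<in> E \<Longrightarrow> simple_split (T - [:x:]) R \<Longrightarrow> (\<Sum>y\<in>R. g y) = real (degree T) * k x) \<Longrightarrow>
      (\<integral>x. k x \<partial>M) = (\<integral>x. g x \<partial>M)"
    and escape: "\<bar>v\<bar> > \<xi> \<Longrightarrow> filterlim (\<lambda>i. \<bar>(poly T ^^ i) v\<bar>) at_top sequentially"
begin

abbreviation d :: nat where "d \<equiv> degree T"

fun F :: "nat \<Rightarrow> real poly" where
  "F 0 = [:0, 1:]"
| "F (Suc n) = pcompose (F n) T"

lemma poly_F_Suc [simp]: "poly (F (Suc n)) x = poly (F n) (poly T x)"
  by (simp add: poly_pcompose)

lemma F_add: "F (m + n) = pcompose (F m) (F n)"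
  by (induction n) (simp_all add: pcompose_assoc)

lemma F_1: "F (Suc 0) = T" by (simp add: pcompose_pCons)

lemma degree_F: "degree (F n) = d ^ n"
  by (induction n) (simp_all add: degree_pcompose mult.commute)

lemma degree_F_pos: "degree (F n) > 0"
  unfolding degree_F using degree_T by simp

lemma E_iff_F: "poly (F n) x \<in> E \<longleftrightarrow> x \<in> E"
  by (induction n arbitrary: x) (simp_all add: E_iff poly_pcompose)

text \<open>Distinct points have disjoint preimages, so there are as many roots as the degree allows.\<close>

lemma split_compose:
  assumes p: "degree p > 0"
    and R: "simple_split p R" "R \<subseteq> {-\<xi>..\<xi>}"
    and q: "degree q > 0"
    and s: "\<And>x. x \<in> {-\<xi>..\<xi>} \<Longrightarrow> \<exists>R\<subseteq>{-\<xi>..\<xi>}. simple_split (q - [:x:]) R"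
  shows "simple_split (pcompose p q) {y. poly q y \<in> R}" "{y. poly q y \<in> R} \<subseteq> {-\<xi>..\<xi>}"
proof -
  define R' where "R' = (\<lambda>x. {y. poly q y = x})"
  have R': "R' x \<subseteq> {-\<xi>..\<xi>}" "simple_split (q - [:x:]) (R' x)" if x: "x \<in> R" for x
  proof -
    have "x \<in> {-\<xi>..\<xi>}" using x R(2) by blast
    from s[OF this] obtain R1 where R1: "R1 \<subseteq> {-\<xi>..\<xi>}" "simple_split (q - [:x:]) R1" by blast
    have "R1 = R' x" using simple_split_root[OF R1(2)] by (auto simp: R'_def)
    then show "R' x \<subseteq> {-\<xi>..\<xi>}" "simple_split (q - [:x:]) (R' x)" using R1 by auto
  qed
  have eq: "{y. poly q y \<in> R} = (\<Union>x\<in>R. R' x)" by (auto simp: R'_def)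
  then show "{y. poly q y \<in> R} \<subseteq> {-\<xi>..\<xi>}" using R'(1) by blast
  have fin: "finite R" using R by (simp add: simple_split_def)
  have card: "card (R' x) = degree q" "finite (R' x)" if "x \<in> R" for x
    using simple_split_degree[OF R'(2)[OF that]] degree_diff_const[OF q] R'(2)[OF that]
    by (auto simp: simple_split_def)
  have "card (\<Union>x\<in>R. R' x) = (\<Sum>x\<in>R. card (R' x))"
    using fin card by (intro card_UN_disjoint) (auto simp: R'_def)
  then have "card {y. poly q y \<in> R} = card R * degree q"
    unfolding eq using card by simp
  then have c: "card {y. poly q y \<in> R} = degree (pcompose p q)"
    using simple_split_degree[OF R(1)] by (simp add: degree_pcompose)
  have "degree (pcompose p q) > 0" using p q by (simp add: degree_pcompose)
  then have nz: "pcompose p q \<noteq> 0" by auto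
  show "simple_split (pcompose p q) {y. poly q y \<in> R}"
  proof (rule simple_splitI_card[OF nz])
    show "finite {y. poly q y \<in> R}" unfolding eq using fin card by auto
    show "poly (pcompose p q) y = 0" if "y \<in> {y. poly q y \<in> R}" for y
      using simple_split_root[OF R(1), of "poly q y"] that by (simp add: poly_pcompose)
  qed (rule c)
qed

lemma split_F:
  "x \<in> {-\<xi>..\<xi>} \<Longrightarrow> \<exists>R\<subseteq>{-\<xi>..\<xi>}. simple_split (F n - [:x:]) R"
proof (induction n arbitrary: x)
  case 0
  have "F 0 - [:x:] = [:-x, 1:]" by simp
  moreover have "simple_split [:-x, 1:] {x}" by (auto simp: simple_split_def)
  ultimately show ?case using 0 by (intro exI[of _ "{x}"]) auto
next
  case (Suc n)
  then obtain R where R: "R \<subseteq> {-\<xi>..\<xi>}" "simple_split (F n - [:x:]) R" by blast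
  have "degree (F n - [:x:]) > 0"
    unfolding degree_diff_const[OF degree_F_pos] by (rule degree_F_pos)
  moreover have "degree T > 0" using degree_T by simp
  ultimately have "simple_split (pcompose (F n - [:x:]) T) {y. poly T y \<in> R}"
      and "{y. poly T y \<in> R} \<subseteq> {-\<xi>..\<xi>}"
    using split_compose[OF _ R(2,1) _ split_T] by blast+
  moreover have "pcompose (F n - [:x:]) T = F (Suc n) - [:x:]" by (simp add: pcompose_diff)
  ultimately show ?case by (intro exI[of _ "{y. poly T y \<in> R}"]) auto
qed

lemma F_outside: "\<bar>v\<bar> > \<xi> \<Longrightarrow> \<bar>poly (F n) v\<bar> > \<xi>"
proof (rule ccontr)
  assume v: "\<bar>v\<bar> > \<xi>" and "\<not> \<bar>poly (F n) v\<bar> > \<xi>"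
  then have "poly (F n) v \<in> {-\<xi>..\<xi>}" by auto
  then obtain R where R: "R \<subseteq> {-\<xi>..\<xi>}" "simple_split (F n - [:poly (F n) v:]) R"
    using split_F by blast
  then have "v \<in> R" using simple_split_root[OF R(2), of v] by simp
  then have "v \<in> {-\<xi>..\<xi>}" using R(1) by blast
  then show False using v by auto
qed

lemma zero_in_interval: "0 \<in> {-\<xi>..\<xi>}" using xi_nonneg by simp

text \<open>The quotient \<open>F' v / (F v - x)\<close> is the sum of \<open>1 / (v - y)\<close> over the \<open>d ^ n\<close> preimages \<open>y\<close> of \<open>x\<close>. These
terms have the same sign and absolute values between \<open>1 / (\<bar>v\<bar> + \<xi>)\<close> and \<open>1 / (\<bar>v\<bar> - \<xi>)\<close>.\<close>

lemma F_log_derivative: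
  assumes v: "\<bar>v\<bar> > \<xi>" and x: "x \<in> {-\<xi>..\<xi>}"
  shows "real (d ^ n) * \<bar>poly (F n) v - x\<bar> \<le> (\<bar>v\<bar> + \<xi>) * \<bar>poly (pderiv (F n)) v\<bar>"
    and "(\<bar>v\<bar> - \<xi>) * \<bar>poly (pderiv (F n)) v\<bar> \<le> real (d ^ n) * \<bar>poly (F n) v - x\<bar>"
proof -
  obtain R where R: "R \<subseteq> {-\<xi>..\<xi>}" "simple_split (F n - [:x:]) R" using split_F[OF x] by blast
  have card: "card R = d ^ n"
    using simple_split_degree[OF R(2)] degree_diff_const[OF degree_F_pos] degree_F by simp
  have fin: "finite R" using R(2) by (simp add: simple_split_def)
  have "v \<notin> {-\<xi>..\<xi>}" using v by auto
  then have "v \<notin> R" using R(1) by blast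
  then have v': "v \<notin># mset_set R" using fin by simp
  have eq: "poly (pderiv (F n)) v = (poly (F n) v - x) * (\<Sum>y\<in>R. 1 / (v - y))"
    using poly_pderiv_linear_factors[OF simple_split_mset[OF R(2)] v']
    unfolding sum_unfold_sum_mset[symmetric] by (simp add: pderiv_diff pderiv_pCons)
  define s where "s = (\<Sum>y\<in>R. 1 / (v - y))"
  have s: "sgn v * s = (\<Sum>y\<in>R. 1 / (sgn v * (v - y)))"
    unfolding s_def sum_distrib_left using v xi_nonneg
    by (intro sum.cong) (auto simp: sgn_if minus_divide_right)
  have bnd: "\<bar>v\<bar> - \<xi> \<le> sgn v * (v - y)" "sgn v * (v - y) \<le> \<bar>v\<bar> + \<xi>" if "y \<in> R" for y
  proof -
    have "-\<xi> \<le> y" "y \<le> \<xi>" using that R by auto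
    then show "\<bar>v\<bar> - \<xi> \<le> sgn v * (v - y)" "sgn v * (v - y) \<le> \<bar>v\<bar> + \<xi>"
      using v xi_nonneg by (auto simp: sgn_if abs_if split: if_splits)
  qed
  have pos: "0 < sgn v * (v - y)" if "y \<in> R" for y
    using bnd(1)[OF that] v by linarith
  have pos': "0 < \<bar>v\<bar> + \<xi>" using v xi_nonneg by linarith
  have "(\<Sum>y\<in>R. 1 / (\<bar>v\<bar> + \<xi>)) \<le> sgn v * s"
    unfolding s by (intro sum_mono divide_left_mono) (use bnd pos pos' in auto)
  then have lo: "real (d ^ n) \<le> (\<bar>v\<bar> + \<xi>) * (sgn v * s)"
    using card v xi_nonneg by (simp add: field_simps)
  have "sgn v * s \<le> (\<Sum>y\<in>R. 1 / (\<bar>v\<bar> - \<xi>))"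
    unfolding s by (intro sum_mono divide_left_mono) (use bnd pos v in auto)
  then have hi: "(\<bar>v\<bar> - \<xi>) * (sgn v * s) \<le> real (d ^ n)"
    using card v xi_nonneg by (simp add: field_simps)
  have "0 < (\<bar>v\<bar> + \<xi>) * (sgn v * s)"
    by (rule less_le_trans[OF _ lo]) (use degree_T in simp)
  then have "0 < sgn v * s" using v xi_nonneg by (simp add: zero_less_mult_iff)
  then have "\<bar>s\<bar> = sgn v * s" by (auto simp: sgn_if abs_if split: if_splits)
  then have abs: "\<bar>poly (pderiv (F n)) v\<bar> = \<bar>poly (F n) v - x\<bar> * (sgn v * s)"
    unfolding eq s_def[symmetric] by (simp add: abs_mult)
  show "real (d ^ n) * \<bar>poly (F n) v - x\<bar> \<le> (\<bar>v\<bar> + \<xi>) * \<bar>poly (pderiv (F n)) v\<bar>"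
    using mult_right_mono[OF lo abs_ge_zero[of "poly (F n) v - x"]] unfolding abs
    by (simp add: mult_ac)
  show "(\<bar>v\<bar> - \<xi>) * \<bar>poly (pderiv (F n)) v\<bar> \<le> real (d ^ n) * \<bar>poly (F n) v - x\<bar>"
    using mult_right_mono[OF hi abs_ge_zero[of "poly (F n) v - x"]] unfolding abs
    by (simp add: mult_ac)
qed

definition crit :: "nat \<Rightarrow> real set" where
  "crit n = {c. poly (pderiv (F n)) c = 0}"

text \<open>The generation of points that are critical for \<open>F (Suc n)\<close> but not for \<open>F n\<close>.\<close>

definition new_crit :: "nat \<Rightarrow> real set" where
  "new_crit n = {c. poly (F n) c \<in> crit (Suc 0)}"

lemma pderiv_F_add:
  "pderiv (F (m + n)) = pcompose (pderiv (F m)) (F n) * pderiv (F n)"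
  unfolding F_add by (rule pderiv_pcompose)

lemma crit_0: "crit 0 = {}" by (auto simp: crit_def pderiv_pCons)

lemma crit_Suc: "crit (Suc n) = crit n \<union> new_crit n"
  using pderiv_F_add[of "Suc 0" n]
  by (auto simp: crit_def new_crit_def poly_pcompose simp del: F.simps)

text \<open>Preimages of points of \<open>{-\<xi>..\<xi>}\<close> are simple roots, hence not critical.\<close>

lemma crit_value_outside: "c \<in> crit n \<Longrightarrow> \<bar>poly (F n) c\<bar> > \<xi>"
proof (rule ccontr)
  assume c: "c \<in> crit n" and "\<not> \<bar>poly (F n) c\<bar> > \<xi>"
  then have "poly (F n) c \<in> {-\<xi>..\<xi>}" by auto
  then obtain R where R: "simple_split (F n - [:poly (F n) c:]) R"
    using split_F by blast
  then have "c \<in> R" using simple_split_root[OF R, of c] by simp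
  then show False using simple_split_pderiv_root(2)[OF R] c
    by (auto simp: crit_def pderiv_diff pderiv_pCons)
qed

lemma split_crit_1: "simple_split (pderiv T) (crit (Suc 0))" "crit (Suc 0) \<subseteq> {-\<xi>..\<xi>}"
proof -
  obtain R where R: "R \<subseteq> {-\<xi>..\<xi>}" "simple_split (pderiv T) R" using split_pderiv_T by blast
  then have "R = crit (Suc 0)" using simple_split_root[OF R(2)] F_1
    by (auto simp: crit_def simp del: F.simps)
  then show "simple_split (pderiv T) (crit (Suc 0))" "crit (Suc 0) \<subseteq> {-\<xi>..\<xi>}" using R by auto
qed

lemma crit_new_disjoint: "crit n \<inter> new_crit n = {}"
proof -
  have "poly (F n) c \<notin> {-\<xi>..\<xi>}" if "c \<in> crit n" for c
    using crit_value_outside[OF that] by auto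
  then show ?thesis using split_crit_1(2) unfolding new_crit_def by blast
qed

lemma finite_card_new_crit: "finite (new_crit n)" "card (new_crit n) = (d - 1) * d ^ n"
proof -
  have "degree (pderiv T) > 0" using degree_T by (simp add: degree_pderiv)
  from split_compose(1)[OF this split_crit_1 degree_F_pos split_F]
  have s: "simple_split (pcompose (pderiv T) (F n)) (new_crit n)" by (simp add: new_crit_def)
  then show "finite (new_crit n)" by (simp add: simple_split_def)
  show "card (new_crit n) = (d - 1) * d ^ n"
    using simple_split_degree[OF s] by (simp add: degree_pcompose degree_F degree_pderiv)
qed

lemma finite_card_crit: "finite (crit n) \<and> card (crit n) = d ^ n - 1"
proof (induction n)
  case (Suc n)
  have "d ^ n - 1 + (d - 1) * d ^ n = d ^ Suc n - 1"
  proof -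
    obtain e where e: "d = Suc e" using degree_T by (cases d) auto
    have "d ^ n \<ge> 1" using degree_T by simp
    then have "d ^ n - 1 + e * d ^ n = (1 + e) * d ^ n - 1" by (simp add: algebra_simps)
    then show ?thesis using e by simp
  qed
  then show ?case unfolding crit_Suc
    using Suc finite_card_new_crit[of n] crit_new_disjoint[of n] by (simp add: card_Un_disjoint)
qed (simp add: crit_0)

lemma split_crit: "simple_split (pderiv (F n)) (crit n)"
proof (rule simple_splitI_card)
  show "pderiv (F n) \<noteq> 0" using degree_F_pos[of n] pderiv_eq_0_iff[of "F n"] by auto
qed (use finite_card_crit in \<open>auto simp: degree_pderiv degree_F crit_def\<close>)

lemma crit_not_E: "c \<in> crit n \<Longrightarrow> c \<notin> E"
proof -
  assume "c \<in> crit n"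
  then have "poly (F n) c \<notin> {-\<xi>..\<xi>}" using crit_value_outside by fastforce
  then show ?thesis using E_iff_F[of n c] E_bound by blast
qed

abbreviation F2 :: "nat \<Rightarrow> real \<Rightarrow> real" where
  "F2 n c \<equiv> poly (pderiv (pderiv (F n))) c"

text \<open>Laguerre's inequality for \<open>F n\<close>, all of whose roots are real and simple.\<close>

lemma second_derivative_crit:
  assumes "c \<in> crit n"
  shows "poly (F n) c * F2 n c < 0"
proof -
  obtain R where R: "R \<subseteq> {-\<xi>..\<xi>}" "simple_split (F n - [:0:]) R"
    using split_F[OF zero_in_interval] by blast
  then have R2: "simple_split (F n) R" by simp
  have F0: "poly (F n) c \<noteq> 0" using crit_value_outside[OF assms] xi_nonneg by auto
  then have c: "c \<notin> R" using simple_split_root[OF R2] by auto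
  have fin: "finite R" using R2 by (simp add: simple_split_def)
  have "R \<noteq> {}" using simple_split_degree[OF R2] degree_F_pos[of n] by auto
  then have "(\<Sum>y\<in>R. 1 / (c - y)\<^sup>2) > 0" using c fin by (intro sum_pos) auto
  moreover have "poly (F n) c * F2 n c =
      - ((poly (F n) c)\<^sup>2 * (\<Sum>y\<in>R. 1 / (c - y)\<^sup>2))"
  proof -
    have c': "c \<notin># mset_set R" using c fin by simp
    have sum: "(\<Sum>y\<in>#mset_set R. 1 / (c - y)\<^sup>2) = (\<Sum>y\<in>R. 1 / (c - y)\<^sup>2)"
      by (rule sum_unfold_sum_mset[symmetric])
    have pd: "poly (pderiv (F n)) c = 0" using assms unfolding crit_def by blast
    show ?thesis
      unfolding poly_pderiv2_linear_factors[OF simple_split_mset[OF R2] c'] sum pd by simp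
  qed
  ultimately show ?thesis using F0 by simp
qed

section \<open>Invariance under the polynomial\<close>


text \<open>Balance, applied to \<open>f (T x) / (c - x)\<close>. Here \<open>f (T x)\<close> is constant on preimages, and the sum of
\<open>1 / (c - y)\<close> over the preimages \<open>y\<close> of \<open>x\<close> is the logarithmic derivative of \<open>T - x\<close> at \<open>c\<close>.\<close>

lemma Cauchy_transform_step:
  assumes c: "c \<notin> E"
  shows "(\<integral>x. poly (pcompose f T) x / (c - x) \<partial>M) =
    poly (pderiv T) c / d * (\<integral>x. poly f x / (poly T c - x) \<partial>M)"
proof -
  let ?g = "\<lambda>x. poly (pcompose f T) x / (c - x)"
  let ?k = "\<lambda>x. poly (pderiv T) c / d * (poly f x / (poly T c - x))"
  have Tc: "poly T c \<notin> E" using c E_iff by simp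
  have "(\<integral>x. ?k x \<partial>M) = (\<integral>x. ?g x \<partial>M)"
  proof (rule balanced)
    show "continuous_on E ?g" using c by (auto intro!: continuous_intros)
    fix x R assume x: "x \<in> E" and R: "simple_split (T - [:x:]) R"
    have ne: "poly T c \<noteq> x" using Tc x by auto
    have fin: "finite R" using R by (simp add: simple_split_def)
    have "c \<notin> R" using simple_split_root[OF R, of c] ne by simp
    then have c': "c \<notin># mset_set R" using fin by simp
    have eq: "poly (pderiv T) c = (poly T c - x) * (\<Sum>y\<in>R. 1 / (c - y))"
      using poly_pderiv_linear_factors[OF simple_split_mset[OF R] c']
      unfolding sum_unfold_sum_mset[symmetric] by (simp add: pderiv_diff pderiv_pCons)
    have "(\<Sum>y\<in>R. ?g y) = (\<Sum>y\<in>R. poly f x * (1 / (c - y)))"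
    proof (intro sum.cong refl)
      fix y assume "y \<in> R"
      then have "poly T y = x" using simple_split_root[OF R, of y] by simp
      then show "?g y = poly f x * (1 / (c - y))" by (simp add: poly_pcompose)
    qed
    also have "\<dots> = poly f x * (\<Sum>y\<in>R. 1 / (c - y))" by (rule sum_distrib_left[symmetric])
    also have "(\<Sum>y\<in>R. 1 / (c - y)) = poly (pderiv T) c / (poly T c - x)"
      unfolding eq using ne by simp
    finally show "(\<Sum>y\<in>R. ?g y) = real d * ?k x" using degree_T by simp
  qed measurable
  then have "(\<integral>x. ?g x \<partial>M) = (\<integral>x. ?k x \<partial>M)" by (rule sym)
  also have "\<dots> = poly (pderiv T) c / d * (\<integral>x. poly f x / (poly T c - x) \<partial>M)"
    by (rule integral_mult_right_zero)
  finally show ?thesis .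
qed

lemma Cauchy_transform:
  "c \<notin> E \<Longrightarrow> (\<integral>x. poly (pcompose f (F n)) x / (c - x) \<partial>M) =
    poly (pderiv (F n)) c / d ^ n * (\<integral>x. poly f x / (poly (F n) c - x) \<partial>M)"
proof (induction n arbitrary: c)
  case 0
  then show ?case by (simp add: pderiv_pCons pcompose_idR)
next
  case (Suc n)
  have Tc: "poly T c \<notin> E" using Suc.prems E_iff by simp
  have "(\<integral>x. poly (pcompose f (F (Suc n))) x / (c - x) \<partial>M) =
      (\<integral>x. poly (pcompose (pcompose f (F n)) T) x / (c - x) \<partial>M)"
    by (simp add: pcompose_assoc)
  also have "\<dots> = poly (pderiv T) c / d * (poly (pderiv (F n)) (poly T c) / d ^ n *
      (\<integral>x. poly f x / (poly (F n) (poly T c) - x) \<partial>M))"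
    unfolding Cauchy_transform_step[OF Suc.prems] Suc.IH[OF Tc] ..
  also have "\<dots> = poly (pderiv (F (Suc n))) c / d ^ Suc n *
      (\<integral>x. poly f x / (poly (F (Suc n)) c - x) \<partial>M)"
    by (simp add: pderiv_pcompose poly_pcompose)
  finally show ?case .
qed

text \<open>The adjoint of composition with \<open>T\<close> maps polynomials to polynomials and divides degrees by \<open>d\<close>.\<close>

lemma integral_compose_T:
  "\<exists>k. d * degree k \<le> degree g \<and>
     (\<forall>f. (\<integral>x. poly (pcompose f T * g) x \<partial>M) = (\<integral>x. poly (f * k) x \<partial>M))"
proof -
  have "degree T > 0" using degree_T by simp
  from preimage_sum_poly[OF this, of g]
  obtain h where h: "d * degree h \<le> degree g"
    "\<And>x R. simple_split (T - [:x:]) R \<Longrightarrow> (\<Sum>y\<in>R. poly g y) = poly h x" by blast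
  have "(\<integral>x. poly (pcompose f T * g) x \<partial>M) = (\<integral>x. poly (f * smult (1 / d) h) x \<partial>M)" for f
  proof (rule balanced[symmetric])
    show "continuous_on E (poly (pcompose f T * g))" by (intro continuous_intros)
    fix x R assume x: "x \<in> E" and R: "simple_split (T - [:x:]) R"
    have "(\<Sum>y\<in>R. poly (pcompose f T * g) y) = (\<Sum>y\<in>R. poly f x * poly g y)"
    proof (intro sum.cong refl)
      fix y assume "y \<in> R"
      then have "poly T y = x" using simple_split_root[OF R, of y] by simp
      then show "poly (pcompose f T * g) y = poly f x * poly g y" by (simp add: poly_pcompose)
    qed
    also have "\<dots> = poly f x * poly h x" using h(2)[OF R] by (simp add: sum_distrib_left[symmetric])
    finally show "(\<Sum>y\<in>R. poly (pcompose f T * g) y) = real d * poly (f * smult (1 / d) h) x"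
      using degree_T by simp
  qed measurable
  then show ?thesis using h(1) degree_smult_le[of "1/d" h]
    by (intro exI[of _ "smult (1 / d) h"]) (auto intro: order_trans[OF mult_le_mono2])
qed

lemma integral_compose_T_low:
  assumes "degree g < d"
  shows "(\<integral>x. poly (pcompose f T * g) x \<partial>M) = (\<integral>x. poly g x \<partial>M) * (\<integral>x. poly f x \<partial>M)"
proof -
  obtain k where k: "d * degree k \<le> degree g"
    "\<And>f. (\<integral>x. poly (pcompose f T * g) x \<partial>M) = (\<integral>x. poly (f * k) x \<partial>M)"
    using integral_compose_T[of g] by blast
  have "degree k = 0"
  proof (rule ccontr)
    assume "degree k \<noteq> 0"
    then have "d * 1 \<le> d * degree k" by (intro mult_le_mono2) simp
    then show False using k(1) assms by linarith
  qed
  then obtain \<kappa> where \<kappa>: "k = [:\<kappa>:]" by (meson degree_eq_zeroE)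
  have eq: "(\<integral>x. poly (pcompose f T * g) x \<partial>M) = \<kappa> * (\<integral>x. poly f x \<partial>M)" for f
  proof -
    have "(\<integral>x. poly (f * k) x \<partial>M) = (\<integral>x. \<kappa> * poly f x \<partial>M)"
      by (intro Lint_cong) (auto simp: \<kappa>)
    then show ?thesis unfolding k(2) by (simp del: poly_mult)
  qed
  have "(\<integral>x. poly (1::real poly) x \<partial>M) = (\<integral>x. 1 \<partial>M)"
    by (intro Lint_cong) auto
  then have "(\<integral>x. poly (pcompose 1 T * g) x \<partial>M) = \<kappa> * (\<integral>x. 1 \<partial>M)"
    by (simp only: eq)
  then have "(\<integral>x. poly g x \<partial>M) = \<kappa>" using prob_space by (simp add: pcompose_1)
  then show ?thesis using eq by simp
qed

abbreviation L :: "nat \<Rightarrow> real" where "L n \<equiv> lead_coeff (F n)"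

lemma L_nonzero: "L n \<noteq> 0" using degree_F_pos[of n] by auto

text \<open>The right-hand side is monic. It is orthogonal to every \<open>g\<close> of lower degree, since the adjoint of
composition maps \<open>g\<close> to a polynomial of degree less than \<open>j\<close>.\<close>

lemma Q_compose_T: "Q (j * d) = smult (1 / lead_coeff T ^ j) (pcompose (Q j) T)"
proof -
  let ?f = "smult (1 / lead_coeff T ^ j) (pcompose (Q j) T)"
  have l: "lead_coeff T \<noteq> 0" using degree_T by auto
  have deg: "degree (pcompose (Q j) T) = j * d" by (simp add: degree_pcompose)
  have "lead_coeff (pcompose (Q j) T) = lead_coeff T ^ j"
    using degree_T by (subst lead_coeff_comp) auto
  then have lead: "coeff ?f (j * d) = 1" using l deg by simp
  have "?f = Q (j * d)"
  proof (rule monic_orthogonal_unique)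
    show "degree ?f = j * d" using deg l by simp
    fix g :: "real poly" assume g: "degree g < j * d"
    obtain k where k: "d * degree k \<le> degree g"
      "\<And>f. (\<integral>x. poly (pcompose f T * g) x \<partial>M) = (\<integral>x. poly (f * k) x \<partial>M)"
      using integral_compose_T[of g] by blast
    have "d * degree k < d * j" using le_less_trans[OF k(1) g] by (simp only: mult.commute)
    then have dk: "degree k < j" by (metis mult_less_cancel1)
    have "(\<integral>x. poly (?f * g) x \<partial>M) = 1 / lead_coeff T ^ j * (\<integral>x. poly (pcompose (Q j) T * g) x \<partial>M)"
      by simp
    also have "\<dots> = 0" unfolding k(2) using integral_Q_mult[of k j] dk by (simp add: coeff_eq_0 del: poly_mult)
    finally show "(\<integral>x. poly (?f * g) x \<partial>M) = 0" .
  qed (rule lead)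
  then show ?thesis by simp
qed

lemma L_Suc: "L (Suc n) = L n * lead_coeff T ^ (d ^ n)"
  using degree_T by (simp add: lead_coeff_comp degree_F del: degree_pcompose)

lemma Q_compose_F: "Q (j * d ^ n) = smult (1 / L n ^ j) (pcompose (Q j) (F n))"
proof (induction n)
  case (Suc n)
  have "Q (j * d ^ Suc n) = Q (j * d ^ n * d)" by (simp add: mult_ac)
  also have "\<dots> = smult (1 / lead_coeff T ^ (j * d ^ n))
      (smult (1 / L n ^ j) (pcompose (pcompose (Q j) (F n)) T))"
    unfolding Q_compose_T Suc by (simp add: pcompose_smult)
  also have "\<dots> = smult (1 / L (Suc n) ^ j) (pcompose (Q j) (F (Suc n)))"
    unfolding L_Suc
    by (simp add: pcompose_assoc power_mult_distrib power_mult[symmetric] mult.commute)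
  finally show ?case .
qed simp

lemma integral_compose_F: "(\<integral>x. poly (pcompose f (F n)) x \<partial>M) = (\<integral>x. poly f x \<partial>M)"
proof (induction n)
  case (Suc n)
  have "(\<integral>x. poly (pcompose f (F (Suc n))) x \<partial>M) = (\<integral>x. poly (pcompose (pcompose f (F n)) T * 1) x \<partial>M)"
    by (simp add: pcompose_assoc)
  also have "\<dots> = (\<integral>x. poly (1::real poly) x \<partial>M) * (\<integral>x. poly (pcompose f (F n)) x \<partial>M)"
    using degree_T by (intro integral_compose_T_low) simp
  also have "(\<integral>x. poly (1::real poly) x \<partial>M) = (\<integral>x. 1 \<partial>M)"
    by (intro Lint_cong) auto
  finally show ?case using Suc prob_space by simp
qed (simp add: pcompose_idR)

lemma h_F: "h (j * d ^ n) = h j / L n ^ (2 * j)"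
proof -
  have "h (j * d ^ n) = (\<integral>x. poly (Q (j * d ^ n) * Q (j * d ^ n)) x \<partial>M)"
    using integral_Q_mult[of "Q (j * d ^ n)" "j * d ^ n"] by simp
  also have "\<dots> = (\<integral>x. (1 / L n ^ (2 * j)) * poly (pcompose (Q j * Q j) (F n)) x \<partial>M)"
    unfolding Q_compose_F
    by (simp add: pcompose_mult power_mult power2_eq_square power_mult_distrib del: F.simps)
  also have "\<dots> = (1 / L n ^ (2 * j)) * h j"
    using integral_compose_F[of "Q j * Q j" n] integral_Q_mult[of "Q j" j]
    by (simp del: F.simps)
  finally show ?thesis by simp
qed

text \<open>By balance the mean of \<open>x * (Q\<^sub>j (T x))\<^sup>2\<close> factors, because the preimage mean of \<open>x\<close> is a constant.\<close>

lemma b_F: "n \<ge> 1 \<Longrightarrow> b (j * d ^ n) = b 0"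
proof -
  have eq: "b (j * d) = b 0" for j
  proof -
    let ?X = "[:0, 1:] :: real poly"
    let ?l = "lead_coeff T ^ j"
    have l: "lead_coeff T \<noteq> 0" using degree_T by auto
    have hj: "h (j * d) = h j / ?l\<^sup>2" using h_F[of j 1]
      by (simp add: pcompose_pCons power_mult[symmetric] mult.commute[of 2])
    have "b (j * d) * h (j * d) = (\<integral>x. poly (Q (j * d) * (?X * Q (j * d))) x \<partial>M)"
      by (rule integral_x_Q_square[symmetric])
    also have "\<dots> = (\<integral>x. (1 / ?l\<^sup>2) * poly (pcompose (Q j * Q j) T * ?X) x \<partial>M)"
      unfolding Q_compose_T
      by (simp add: pcompose_mult power2_eq_square mult_ac)
    also have "\<dots> = 1 / ?l\<^sup>2 * (\<integral>x. poly (pcompose (Q j * Q j) T * ?X) x \<partial>M)" by simp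
    also have "(\<integral>x. poly (pcompose (Q j * Q j) T * ?X) x \<partial>M) =
        (\<integral>x. poly ?X x \<partial>M) * (\<integral>x. poly (Q j * Q j) x \<partial>M)"
      using degree_T by (intro integral_compose_T_low) simp
    also have "(\<integral>x. poly (Q j * Q j) x \<partial>M) = h j"
      using integral_Q_mult[of "Q j" j] by simp
    also have "(\<integral>x. poly ?X x \<partial>M) = b 0"
      using integral_x_Q_square[of 0] by simp
    finally have "b (j * d) * h (j * d) = b 0 * h (j * d)" unfolding hj by simp
    then show ?thesis using h_pos[of "j * d"] by simp
  qed
  assume "n \<ge> 1"
  then obtain m where "n = Suc m" by (cases n) auto
  then show "b (j * d ^ n) = b 0" using eq[of "j * d ^ m"] by (simp add: mult_ac)
qed

section \<open>Blocks of the Jacobi matrix\<close>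


text \<open>Multiplied by \<open>\<bar>\<phi> j (F c)\<bar>\<close>, this is the unnormalized spectral weight at the eigenvalue \<open>c\<close> of block \<open>j\<close>.\<close>

definition crit_weight :: "nat \<Rightarrow> real \<Rightarrow> real" where
  "crit_weight n c = real (d ^ n) / \<bar>F2 n c\<bar>"

lemma crit_weight_pos: "c \<in> crit n \<Longrightarrow> crit_weight n c > 0"
proof -
  assume "c \<in> crit n"
  then have "F2 n c \<noteq> 0" using second_derivative_crit[of c n] by auto
  then show ?thesis unfolding crit_weight_def using degree_T by simp
qed

lemma poly_F_funpow: "poly (F n) x = (poly T ^^ n) x"
  by (induction n arbitrary: x) (simp_all add: poly_pcompose funpow_swap1)

end

text \<open>Block \<open>j\<close> consists of the \<open>D - 1\<close> rows strictly between \<open>j * D\<close> and \<open>Suc j * D\<close>.\<close>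

locale jacobi_block = balanced_jacobi +
  fixes n j D :: nat
  assumes n_pos: "n \<ge> 1"
  defines "D \<equiv> d ^ n"
begin

lemma D_ge_2: "D \<ge> 2"
proof -
  have "d ^ 1 \<le> D" unfolding D_def using n_pos degree_T by (intro power_increasing) auto
  then show ?thesis using degree_T by simp
qed

text \<open>The recurrence read downwards from the first row of the block; \<open>bwd\<close> reads it upwards from the last
row.\<close>

definition fwd :: "nat \<Rightarrow> real poly" where
  "fwd = rec_poly (\<lambda>i. b (Suc (j * D + i))) (\<lambda>i. a (Suc (j * D + i)))"

definition bwd :: "nat \<Rightarrow> real poly" where
  "bwd = rec_poly (\<lambda>i. b (j * D + D - Suc i)) (\<lambda>i. a (j * D + D - i))"

lemma degree_fwd [simp]: "degree (fwd k) = k" and lead_fwd [simp]: "coeff (fwd k) k = 1"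
  and degree_bwd [simp]: "degree (bwd k) = k" and lead_bwd [simp]: "coeff (bwd k) k = 1"
  by (simp_all add: fwd_def bwd_def)

text \<open>Here the Cauchy transform carries the factor \<open>F' c = 0\<close>.\<close>

lemma S_multiple:
  assumes "c \<in> crit n"
  shows "S (i * D) c = 0"
proof -
  have "S (i * D) c = (\<integral>x. 1 / L n ^ i * (poly (pcompose (Q i) (F n)) x / (c - x)) \<partial>M)"
    unfolding S_def D_def Q_compose_F by simp
  also have "\<dots> = 1 / L n ^ i * (\<integral>x. poly (pcompose (Q i) (F n)) x / (c - x) \<partial>M)"
    by (rule integral_mult_right_zero)
  also have "\<dots> = 0"
    unfolding Cauchy_transform[OF crit_not_E[OF assms]] using assms by (simp add: crit_def)
  finally show ?thesis .
qed

lemma Q_multiple: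
  "poly (Q (i * D)) c = poly (Q i) (poly (F n) c) / L n ^ i"
  unfolding D_def Q_compose_F by (simp add: poly_pcompose)

lemma S_fwd:
  assumes c: "c \<in> crit n"
  shows "S (Suc (j * D + k)) c = S (Suc (j * D)) c * poly (fwd k) c"
proof -
  define y where "y = (\<lambda>k. S (Suc (j * D + k)) c)"
  note rec = S_rec(2)[OF crit_not_E[OF c]]
  have "y k = y 0 * poly (fwd k) c" unfolding fwd_def
  proof (rule rec_poly_solution)
    show "y 1 = (c - b (Suc (j * D + 0))) * y 0"
      using rec[of "j * D"] S_multiple[OF c, of j] by (simp add: y_def)
    show "y (Suc (Suc i)) = (c - b (Suc (j * D + Suc i))) * y (Suc i) - a (Suc (j * D + Suc i)) * y i" for i
      using rec[of "Suc (j * D + i)"] by (simp add: y_def)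
  qed (rule order_refl)
  then show ?thesis by (simp add: y_def)
qed

text \<open>Read upwards, the recurrence divides by \<open>a\<close> in each step. The quotients of \<open>h\<close> collect these divisors
and bring it to monic form. The starting value before the last row vanishes, by \<open>S_multiple\<close>.\<close>

lemma S_bwd:
  assumes c: "c \<in> crit n" and k: "k < D"
  shows "S (j * D + D - Suc k) c * h (j * D + D - 1) =
    S (j * D + D - 1) c * h (j * D + D - Suc k) * poly (bwd k) c"
proof -
  define m where "m = j * D + D"
  \<comment> \<open>\<open>y\<close> lists the entries of the block from the last row upwards, in monic normalization\<close>
  define y where "y = (\<lambda>i. S (m - Suc i) c * h (m - 1) / h (m - Suc i))"
  note rec = S_rec(2)[OF crit_not_E[OF c]]
  have Sm: "S m c = 0" using S_multiple[OF c, of "Suc j"] by (simp add: m_def add.commute)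
  have hp: "h i \<noteq> 0" for i using h_pos[of i] by simp
  have step: "S r c / h r = ((c - b (Suc r)) * S (Suc r) c - S (Suc (Suc r)) c) / h (Suc r)" for r
    using rec[of r] h_Suc[of r] hp[of r] hp[of "Suc r"] by (simp add: field_simps)
  have "y k = y 0 * poly (bwd k) c" unfolding bwd_def
  proof (rule rec_poly_solution[where n = "D - 1"])
    show "y 1 = (c - b (j * D + D - Suc 0)) * y 0" if "1 \<le> D - 1"
    proof -
      define r where "r = m - 2"
      have r: "m = Suc (Suc r)" using that by (simp add: m_def r_def)
      have "y 1 = S r c / h r * h (Suc r)" by (simp add: y_def r)
      also have "\<dots> = (c - b (Suc r)) * S (Suc r) c" unfolding step using hp Sm[unfolded r] by simp
      finally show ?thesis unfolding m_def[symmetric] using hp by (simp add: y_def r)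
    qed
    show "y (Suc (Suc i)) = (c - b (j * D + D - Suc (Suc i))) * y (Suc i) - a (j * D + D - Suc i) * y i"
      if "Suc (Suc i) \<le> D - 1" for i
    proof -
      define r where "r = m - Suc (Suc (Suc i))"
      have r: "m = Suc (Suc (Suc i)) + r" using that by (simp add: m_def r_def)
      have e: "m - Suc (Suc (Suc i)) = r" "m - Suc (Suc i) = Suc r" "m - Suc i = Suc (Suc r)"
        using r by auto
      have "y (Suc (Suc i)) = (S r c / h r) * h (m - 1)" by (simp add: y_def e)
      also have "\<dots> = (c - b (Suc r)) * y (Suc i) - S (Suc (Suc r)) c / h (Suc r) * h (m - 1)"
        unfolding step by (simp add: y_def e diff_divide_distrib add_divide_distrib algebra_simps)
      also have "S (Suc (Suc r)) c / h (Suc r) * h (m - 1) = a (Suc (Suc r)) * y i"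
        using hp[of "Suc r"] hp[of "Suc (Suc r)"] h_Suc[of "Suc r"] by (simp add: y_def e)
      finally show ?thesis unfolding m_def[symmetric] e .
    qed
  qed (use k in simp)
  then have "S (m - Suc k) c * h (m - 1) / h (m - Suc k) = S (m - 1) c * poly (bwd k) c"
    using hp by (simp add: y_def)
  then show ?thesis using hp[of "m - Suc k"] unfolding m_def[symmetric] by (simp add: field_simps)
qed

text \<open>At each of the two ends of the block one of the two products in the Casoratian vanishes. This
expresses \<open>\<phi> j (F c)\<close> by the ratio of the first to the last entry of the eigenvector \<open>S\<close>. So multiplying
by \<open>\<phi> j (F c)\<close> exchanges the eigenvector normalized at the top with the one normalized at the bottom.\<close>

lemma \<phi>_fwd:
  assumes c: "c \<in> crit n" and k: "Suc k < D"
  shows "\<phi> j (poly (F n) c) * poly (fwd k) c =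
    - (L n * (h (Suc (j * D + k)) / h (j * D)) * poly (bwd (D - 2 - k)) c)"
    and "- (L n * h (j * D + D - 1)) / \<phi> j (poly (F n) c) = h (j * D) * poly (fwd (D - 2)) c"
proof -
  define m where "m = j * D + D - 1"
  have Sucm: "Suc m = Suc j * D" using D_ge_2 by (simp add: m_def)
  define v where "v = poly (F n) c"
  have hp: "h i \<noteq> 0" for i using h_pos[of i] by simp
  have v: "\<bar>v\<bar> > \<xi>" using crit_value_outside[OF c] by (simp add: v_def)
  note Q0 = Q_nonzero[OF v] and l = L_nonzero[of n]
  note cas = casoratian[OF crit_not_E[OF c]]
  have 1: "poly (Q (j * D)) c * S (Suc (j * D)) c = - h (j * D)"
    using cas[of "j * D"] S_multiple[OF c, of j] by simp
  have 2: "poly (Q (Suc j * D)) c * S m c = h m"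
    using cas[of m] S_multiple[OF c, of "Suc j"] unfolding Sucm by simp
  have S0: "S (Suc (j * D)) c \<noteq> 0" "S m c \<noteq> 0" using 1 2 hp by auto
  have "\<phi> j v = L n * poly (Q (Suc j * D)) c / poly (Q (j * D)) c"
    unfolding \<phi>_def Q_multiple v_def[symmetric] using Q0 l by (simp add: field_simps)
  also have "poly (Q (Suc j * D)) c = h m / S m c" using 2 S0 by (simp add: field_simps)
  also have "poly (Q (j * D)) c = - h (j * D) / S (Suc (j * D)) c" using 1 S0 by (simp add: field_simps)
  finally have \<phi>: "\<phi> j v = - (L n * h m * S (Suc (j * D)) c / (h (j * D) * S m c))" by simp
  have "\<phi> j v * poly (fwd k) c = - (L n / h (j * D) * (h m * S (Suc (j * D + k)) c / S m c))"
    unfolding \<phi> S_fwd[OF c] by simp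
  also have "h m * S (Suc (j * D + k)) c / S m c = h (Suc (j * D + k)) * poly (bwd (D - 2 - k)) c"
  proof -
    have e: "j * D + D - Suc (D - 2 - k) = Suc (j * D + k)" and lt: "D - 2 - k < D" using k by auto
    have "S (Suc (j * D + k)) c * h m = S m c * h (Suc (j * D + k)) * poly (bwd (D - 2 - k)) c"
      using S_bwd[OF c lt] unfolding e m_def .
    then show ?thesis using S0(2) by (simp add: nonzero_divide_eq_eq mult_ac)
  qed
  finally show "\<phi> j (poly (F n) c) * poly (fwd k) c =
    - (L n * (h (Suc (j * D + k)) / h (j * D)) * poly (bwd (D - 2 - k)) c)" by (simp add: v_def)
  have "Suc (j * D + (D - 2)) = m" using D_ge_2 by (simp add: m_def)
  then have "S m c = S (Suc (j * D)) c * poly (fwd (D - 2)) c" using S_fwd[OF c, of "D - 2"] by simp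
  then have "S m c / S (Suc (j * D)) c = poly (fwd (D - 2)) c" using S0 by simp
  moreover have "- (L n * h m) / \<phi> j v = h (j * D) * (S m c / S (Suc (j * D)) c)"
    unfolding \<phi> using S0 l hp by (simp add: field_simps)
  ultimately show "- (L n * h (j * D + D - 1)) / \<phi> j (poly (F n) c) = h (j * D) * poly (fwd (D - 2)) c"
    by (simp add: v_def m_def)
qed

text \<open>The eigenvalue equation: the eigenvector \<open>S\<close> vanishes in the row after the block.\<close>

lemma fwd_last:
  assumes c: "c \<in> crit n"
  shows "poly (fwd (D - 1)) c = 0"
proof -
  have e: "Suc (j * D + (D - 1)) = Suc j * D" using D_ge_2 by simp
  have "S (Suc (j * D)) c * poly (fwd (D - 1)) c = 0"
    using S_fwd[OF c, of "D - 1"] S_multiple[OF c, of "Suc j"] unfolding e by simp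
  moreover have "S (Suc (j * D)) c \<noteq> 0"
    using casoratian[OF crit_not_E[OF c], of "j * D"] S_multiple[OF c, of j] h_pos[of "j * D"] by auto
  ultimately show ?thesis by simp
qed

text \<open>The signs agree because \<open>\<phi> j v\<close> has the sign of \<open>v = F c\<close>, and the second derivative the opposite one.\<close>

lemma \<phi>_abs_crit:
  assumes c: "c \<in> crit n"
  shows "crit_weight n c * \<bar>\<phi> j (poly (F n) c)\<bar> = - real D * \<phi> j (poly (F n) c) / F2 n c"
    and "crit_weight n c / \<bar>\<phi> j (poly (F n) c)\<bar> = - real D / \<phi> j (poly (F n) c) / F2 n c"
proof -
  define v f where "v = poly (F n) c" and "f = F2 n c"
  have v: "\<bar>v\<bar> > \<xi>" using crit_value_outside[OF c] by (simp add: v_def)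
  have \<phi>: "\<bar>\<phi> j v\<bar> = sgn v * \<phi> j v" by (rule \<phi>_abs[OF v])
  have "v * f < 0" using second_derivative_crit[OF c] by (simp add: v_def f_def)
  then have f: "\<bar>f\<bar> = - sgn v * f" "f \<noteq> 0" and s: "sgn v * sgn v = 1" "sgn v = 1 \<or> sgn v = -1"
    by (auto simp: sgn_if abs_if mult_less_0_iff)
  show "crit_weight n c * \<bar>\<phi> j (poly (F n) c)\<bar> = - real D * \<phi> j (poly (F n) c) / F2 n c"
    unfolding crit_weight_def D_def v_def[symmetric] f_def[symmetric] f(1) \<phi> using s(2) f(2) by auto
  show "crit_weight n c / \<bar>\<phi> j (poly (F n) c)\<bar> = - real D / \<phi> j (poly (F n) c) / F2 n c"
    unfolding crit_weight_def D_def v_def[symmetric] f_def[symmetric] f(1) \<phi> using s(2) f(2) by auto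
qed

lemma card_crit: "card (crit n) = D - 1"
  using finite_card_crit by (simp add: D_def)

lemma lead_pderiv_F: "lead_coeff (pderiv (F n)) = real D * L n"
  using degree_F_pos[of n] by (simp add: coeff_pderiv degree_pderiv degree_F D_def)

text \<open>By \<open>\<phi>_fwd\<close> the product of the weight with \<open>fwd k\<close> is a multiple of \<open>bwd (D - 2 - k)\<close>. So the sum is one of
Euler's identity for \<open>F'\<close>, which picks out the coefficient of degree \<open>D - 2\<close>.\<close>

lemma block_orthogonality:
  assumes k: "Suc k < D" and g: "degree g \<le> k"
  shows "(\<Sum>c\<in>crit n. crit_weight n c * \<bar>\<phi> j (poly (F n) c)\<bar> * poly (fwd k * g) c) =
    h (Suc (j * D + k)) / h (j * D) * coeff g k"
proof -
  define H where "H = h (Suc (j * D + k)) / h (j * D)"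
  define p where "p = bwd (D - 2 - k) * g"
  have term_eq: "crit_weight n c * \<bar>\<phi> j (poly (F n) c)\<bar> * poly (fwd k * g) c =
      real D * L n * H * (poly p c / F2 n c)" if c: "c \<in> crit n" for c
  proof -
    have "crit_weight n c * \<bar>\<phi> j (poly (F n) c)\<bar> * poly (fwd k * g) c =
        - real D * (\<phi> j (poly (F n) c) * poly (fwd k) c) * poly g c / F2 n c"
      unfolding \<phi>_abs_crit(1)[OF c] by simp
    also have "\<dots> = real D * L n * H * (poly p c / F2 n c)"
      unfolding \<phi>_fwd(1)[OF c k] by (simp add: p_def H_def)
    finally show ?thesis .
  qed
  have dp: "degree p < card (crit n)"
    using degree_mult_le[of "bwd (D - 2 - k)" g] k g unfolding card_crit p_def by simp
  have "coeff p (D - 2) = coeff g k"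
  proof (cases "degree g = k")
    case True
    have "D - 2 = degree (bwd (D - 2 - k)) + degree g" using True k by simp
    then have "coeff p (D - 2) = lead_coeff (bwd (D - 2 - k)) * lead_coeff g"
      unfolding p_def by (metis coeff_mult_degree_sum)
    then show ?thesis using True by simp
  next
    case False
    then have "degree g < k" using g by simp
    then have "degree p < D - 2"
      using degree_mult_le[of "bwd (D - 2 - k)" g] k unfolding p_def by simp
    then show ?thesis using \<open>degree g < k\<close> by (simp add: coeff_eq_0)
  qed
  moreover have "card (crit n) - 1 = D - 2" by (simp add: card_crit)
  ultimately have sum: "(\<Sum>c\<in>crit n. poly p c / F2 n c) = coeff g k / (real D * L n)"
    using sum_roots_div_pderiv[OF split_crit dp] unfolding lead_pderiv_F by simp
  have "(\<Sum>c\<in>crit n. crit_weight n c * \<bar>\<phi> j (poly (F n) c)\<bar> * poly (fwd k * g) c) =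
     (\<Sum>c\<in>crit n. real D * L n * H * (poly p c / F2 n c))"
    by (intro sum.cong refl term_eq)
  also have "\<dots> = real D * L n * H * (coeff g k / (real D * L n))"
    unfolding sum[symmetric] by (rule sum_distrib_left[symmetric])
  also have "\<dots> = H * coeff g k" using L_nonzero[of n] D_ge_2 by simp
  finally show ?thesis by (simp add: H_def)
qed

text \<open>Composition with \<open>F\<close> relates the norms at \<open>j * D\<close> and \<open>Suc j * D\<close> to those at \<open>j\<close> and \<open>Suc j\<close>, which
determines the product of the \<open>a\<close> over a block. The sum is again evaluated by Euler's identity, since
the reciprocal of \<open>\<phi> j (F c)\<close> is a multiple of \<open>fwd (D - 2)\<close>.\<close>

lemma block_last:
  "a (Suc j * D) = a (Suc j) / ((L n)\<^sup>2 * (h (j * D + D - 1) / h (j * D)))"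
  and block_inverse_sum:
  "a (Suc j * D) = a (Suc j) * (\<Sum>c\<in>crit n. crit_weight n c / \<bar>\<phi> j (poly (F n) c)\<bar>)"
proof -
  define m where "m = j * D + D - 1"
  have Sucm: "Suc m = Suc j * D" using D_ge_2 by (simp add: m_def)
  have hp: "h i > 0" for i by (rule h_pos)
  have hF: "h (i * D) * L n ^ (2 * i) = h i" for i
    unfolding D_def h_F using L_nonzero[of n] by simp
  have "(h m * a (Suc j * D) * (L n)\<^sup>2) * L n ^ (2 * j) = h (Suc j * D) * L n ^ (2 * Suc j)"
    using h_Suc[of m] unfolding Sucm by (simp add: power2_eq_square)
  also have "\<dots> = (h (j * D) * a (Suc j)) * L n ^ (2 * j)"
    unfolding hF h_Suc[of j] unfolding hF[of j, symmetric] by (simp only: mult_ac)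
  finally have "h m * a (Suc j * D) * (L n)\<^sup>2 = h (j * D) * a (Suc j)"
    using L_nonzero[of n] by simp
  then show 1: "a (Suc j * D) = a (Suc j) / ((L n)\<^sup>2 * (h (j * D + D - 1) / h (j * D)))"
    using hp[of m] hp[of "j * D"] L_nonzero[of n] unfolding m_def[symmetric] by (simp add: field_simps)
  have term_eq: "crit_weight n c / \<bar>\<phi> j (poly (F n) c)\<bar> =
     real D * h (j * D) / (L n * h m) * (poly (fwd (D - 2)) c / F2 n c)"
    if c: "c \<in> crit n" for c
  proof -
    have D2: "Suc 0 < D" using D_ge_2 by simp
    have "- real D / \<phi> j (poly (F n) c) =
        real D * (- (L n * h m) / \<phi> j (poly (F n) c)) / (L n * h m)"
      using hp[of m] L_nonzero[of n] by simp
    also have "- (L n * h m) / \<phi> j (poly (F n) c) = h (j * D) * poly (fwd (D - 2)) c"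
      using \<phi>_fwd(2)[OF c D2] unfolding m_def .
    finally show ?thesis unfolding \<phi>_abs_crit(2)[OF c] by simp
  qed
  have "degree (fwd (D - 2)) < card (crit n)" using D_ge_2 by (simp add: card_crit)
  note sum_roots_div_pderiv[OF split_crit this]
  moreover have "card (crit n) - 1 = D - 2" by (simp add: card_crit)
  ultimately have sum: "(\<Sum>c\<in>crit n. poly (fwd (D - 2)) c / F2 n c) = 1 / (real D * L n)"
    unfolding lead_pderiv_F by simp
  have "(\<Sum>c\<in>crit n. crit_weight n c / \<bar>\<phi> j (poly (F n) c)\<bar>) =
      (\<Sum>c\<in>crit n. real D * h (j * D) / (L n * h m) * (poly (fwd (D - 2)) c / F2 n c))"
    by (intro sum.cong refl term_eq)
  also have "\<dots> = real D * h (j * D) / (L n * h m) * (1 / (real D * L n))"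
    unfolding sum[symmetric] by (rule sum_distrib_left[symmetric])
  also have "\<dots> = 1 / ((L n)\<^sup>2 * (h m / h (j * D)))"
    using D_ge_2 by (simp add: power2_eq_square)
  finally show "a (Suc j * D) = a (Suc j) * (\<Sum>c\<in>crit n. crit_weight n c / \<bar>\<phi> j (poly (F n) c)\<bar>)"
    unfolding 1 m_def by simp
qed

lemma block_first: "a (Suc (j * D)) = (\<Sum>c\<in>crit n. crit_weight n c * \<bar>\<phi> j (poly (F n) c)\<bar>)"
  using block_orthogonality[of 0 1] D_ge_2 h_pos[of "j * D"] by (simp add: fwd_def h_Suc)

text \<open>Euler's identity for the constant 1, whose coefficient of degree \<open>D - 2\<close> is 0.\<close>

lemma sum_inverse_second_derivative:
  assumes "D \<ge> 3"
  shows "(\<Sum>c\<in>crit n. 1 / F2 n c) = 0"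
proof -
  have "degree (1::real poly) < card (crit n)" using assms by (simp add: card_crit)
  from sum_roots_div_pderiv[OF split_crit this] show ?thesis
    using assms by (simp add: card_crit)
qed

end

section \<open>Decay of the entries at multiples of the degree\<close>

text \<open>Tannery's theorem: each term tends to 0, and \<open>S\<close> times a bound of \<open>e\<close> dominates.\<close>

lemma convolution_null:
  fixes S e :: "nat \<Rightarrow> real"
  assumes S: "summable S" "\<And>k. S k \<ge> 0" and e: "e \<longlonglongrightarrow> 0"
  shows "(\<lambda>n. \<Sum>k<n. S k * e (n - Suc k)) \<longlonglongrightarrow> 0"
proof -
  define f where "f = (\<lambda>k n. if k < n then S k * e (n - Suc k) else 0)"
  have "Bseq e" using e by (intro convergent_imp_Bseq) (auto simp: convergent_def)
  then obtain B where B: "B > 0" "\<And>n. \<bar>e n\<bar> \<le> B" by (auto simp: Bseq_def)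
  have lim: "(\<lambda>n. f k n) \<longlonglongrightarrow> 0" for k
  proof -
    have "(\<lambda>n. S k * e n) \<longlonglongrightarrow> S k * 0" by (intro tendsto_intros e)
    then have "(\<lambda>n. f k (n + Suc k)) \<longlonglongrightarrow> 0" by (simp add: f_def)
    then show ?thesis by (rule LIMSEQ_offset)
  qed
  have bnd: "norm (f k n) \<le> S k * B" for k n
    using S(2)[of k] B by (auto simp: f_def abs_mult intro!: mult_left_mono)
  then have "\<forall>\<^sub>F (k, n) in at_top \<times>\<^sub>F sequentially. norm (f k n) \<le> S k * B"
    by (intro always_eventually) auto
  from tannerys_theorem[OF lim this summable_mult2[OF S(1)]]
  have "(\<lambda>n. suminf (\<lambda>k. f k n)) \<longlonglongrightarrow> suminf (\<lambda>k::nat. 0)" by simp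
  moreover have "suminf (\<lambda>k. f k n) = (\<Sum>k<n. S k * e (n - Suc k))" for n
  proof -
    have "(\<lambda>k. f k n) sums (\<Sum>k<n. f k n)" by (rule sums_finite) (auto simp: f_def)
    then show ?thesis by (simp add: sums_iff f_def)
  qed
  ultimately show ?thesis by simp
qed

lemma finite_uniform_gap:
  fixes g :: "nat \<Rightarrow> 'a \<Rightarrow> real"
  assumes "finite V" and g: "\<And>v i. v \<in> V \<Longrightarrow> g i v > 0"
    and lim: "\<And>v. v \<in> V \<Longrightarrow> filterlim (\<lambda>i. g i v) at_top sequentially"
  obtains \<eta> where "\<eta> > 0" "\<And>v i. v \<in> V \<Longrightarrow> \<eta> \<le> g i v"
proof -
  have "\<exists>\<eta>>0. \<forall>v\<in>V. \<forall>i. \<eta> \<le> g i v" using assms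
  proof (induction V rule: finite_induct)
    case empty
    then show ?case by (intro exI[of _ 1]) auto
  next
    case (insert v V)
    then obtain \<eta> where \<eta>: "\<eta> > 0" "\<And>u i. u \<in> V \<Longrightarrow> \<eta> \<le> g i u" by auto
    obtain N where N: "\<And>i. i \<ge> N \<Longrightarrow> 1 \<le> g i v"
      using insert.prems(2)[of v] unfolding filterlim_at_top eventually_sequentially by auto
    define \<eta>' where "\<eta>' = Min (insert 1 ((\<lambda>i. g i v) ` {..N}))"
    have "\<eta>' > 0" unfolding \<eta>'_def using insert.prems(1)[of v] by auto
    moreover have "\<eta>' \<le> g i v" for i
    proof (cases "i \<le> N")
      case True
      then show ?thesis unfolding \<eta>'_def by (intro Min_le) auto
    next
      case False
      have "\<eta>' \<le> 1" unfolding \<eta>'_def by (intro Min_le) auto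
      then show ?thesis using N[of i] False by simp
    qed
    ultimately show ?case using \<eta>
      by (intro exI[of _ "min \<eta> \<eta>'"]) (auto simp: min_le_iff_disj)
  qed
  then show ?thesis using that by blast
qed

context balanced_jacobi
begin

definition crit_values :: "real set" where "crit_values = poly T ` crit (Suc 0)"

lemma crit_values: "finite crit_values" "v \<in> crit_values \<Longrightarrow> \<bar>v\<bar> > \<xi>"
  using finite_card_crit[of "Suc 0"] crit_value_outside[of _ "Suc 0"]
  by (auto simp: crit_values_def F_1 simp del: F.simps)

lemma new_crit_value: "c \<in> new_crit k \<Longrightarrow> poly (F (Suc k)) c \<in> crit_values"
  using F_add[of "Suc 0" k] F_1
  by (auto simp: new_crit_def crit_values_def poly_pcompose simp del: F.simps)

lemma sum_crit: "(\<Sum>c\<in>crit n. f c) = (\<Sum>k<n. \<Sum>c\<in>new_crit k. (f c :: real))"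
proof (induction n)
  case (Suc n)
  then show ?case unfolding crit_Suc
    using finite_card_crit[of n] finite_card_new_crit[of n] crit_new_disjoint[of n]
    by (simp add: sum.union_disjoint)
qed (simp add: crit_0)

text \<open>By the chain rule, as the first derivative of \<open>F m\<close> vanishes at \<open>c\<close>.\<close>

lemma crit_weight_later:
  assumes "c \<in> crit m"
  shows "crit_weight (i + m) c = crit_weight m c * (real (d ^ i) / \<bar>poly (pderiv (F i)) (poly (F m) c)\<bar>)"
proof -
  have "poly (pderiv (pderiv (F (i + m)))) c = poly (pderiv (F i)) (poly (F m) c) * poly (pderiv (pderiv (F m))) c"
    unfolding pderiv_F_add using assms by (simp add: pderiv_mult poly_pcompose crit_def)
  then show ?thesis unfolding crit_weight_def by (simp add: power_add abs_mult mult_ac)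
qed

lemma crit_values_gap:
  obtains \<eta> where "\<eta> > 0" "\<And>v i. v \<in> crit_values \<Longrightarrow> \<eta> \<le> \<bar>poly (F i) v\<bar> - \<xi>"
proof (rule finite_uniform_gap[of crit_values "\<lambda>i v. \<bar>poly (F i) v\<bar> - \<xi>"])
  show "0 < \<bar>poly (F i) v\<bar> - \<xi>" if "v \<in> crit_values" for v i
    using F_outside[OF crit_values(2)[OF that], of i] by simp
  show "filterlim (\<lambda>i. \<bar>poly (F i) v\<bar> - \<xi>) at_top sequentially" if "v \<in> crit_values" for v
    using filterlim_tendsto_add_at_top[OF tendsto_const[of "-\<xi>"] escape[OF crit_values(2)[OF that]]]
    by (simp add: poly_F_funpow)
qed (use crit_values that in auto)

text \<open>The weights are taken at the time \<open>Suc k\<close> at which the points become critical.\<close>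

definition generation_mass :: "nat \<Rightarrow> real" where
  "generation_mass k = (\<Sum>c\<in>new_crit k. crit_weight (Suc k) c)"

lemma new_crit_weight:
  assumes c: "c \<in> new_crit k" and k: "k < n"
  shows "poly (F n) c = poly (F (n - Suc k)) (poly (F (Suc k)) c)"
    and "crit_weight n c = crit_weight (Suc k) c *
      (real (d ^ (n - Suc k)) / \<bar>poly (pderiv (F (n - Suc k))) (poly (F (Suc k)) c)\<bar>)"
    and "crit_weight (Suc k) c > 0"
proof -
  have n: "n = (n - Suc k) + Suc k" using k by simp
  have c': "c \<in> crit (Suc k)" using c by (simp add: crit_Suc)
  have "F n = pcompose (F (n - Suc k)) (F (Suc k))"
    using F_add[of "n - Suc k" "Suc k"] n by simp
  then show "poly (F n) c = poly (F (n - Suc k)) (poly (F (Suc k)) c)" by (simp only: poly_pcompose)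
  show "crit_weight n c = crit_weight (Suc k) c *
      (real (d ^ (n - Suc k)) / \<bar>poly (pderiv (F (n - Suc k))) (poly (F (Suc k)) c)\<bar>)"
    using crit_weight_later[OF c', of "n - Suc k"] n by simp
  show "crit_weight (Suc k) c > 0" using crit_weight_pos[OF c'] .
qed

lemma generation_mass_nonneg: "generation_mass k \<ge> 0"
  unfolding generation_mass_def using new_crit_weight(3)[of _ k "Suc k"] by (intro sum_nonneg less_imp_le) auto

text \<open>The formula \<open>block_first\<close> for \<open>a 1\<close> is a sum over all critical points of \<open>F n\<close>. A point of generation \<open>k\<close>
contributes its weight times \<open>d ^ i * \<bar>F\<^sub>i v - b 0\<bar> / \<bar>F\<^sub>i' v\<bar>\<close>, where \<open>v\<close> is a critical value of \<open>T\<close> and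
\<open>i = n - Suc k\<close>. By \<open>F_log_derivative\<close> this factor is at least \<open>\<bar>v\<bar> - \<xi>\<close>, so the partial sums are bounded.\<close>

lemma summable_generation_mass: "summable generation_mass"
proof -
  obtain \<eta> where \<eta>: "\<eta> > 0" "\<And>v i. v \<in> crit_values \<Longrightarrow> \<eta> \<le> \<bar>poly (F i) v\<bar> - \<xi>"
    by (rule crit_values_gap) blast
  have b0: "b 0 \<in> {-\<xi>..\<xi>}" using b_bound[of 0] by auto
  have bound: "(\<Sum>k<n. generation_mass k) \<le> a 1 / \<eta>" if n: "n \<ge> 1" for n
  proof -
    interpret B: jacobi_block M E \<xi> b a T n 0 "d ^ n" by unfold_locales (use n in auto)
    have term_le: "\<eta> * crit_weight (Suc k) c \<le> crit_weight n c * \<bar>\<phi> 0 (poly (F n) c)\<bar>" if "c \<in> new_crit k" "k < n" for k c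
    proof -
      define v i where "v = poly (F (Suc k)) c" and "i = n - Suc k"
      have v: "v \<in> crit_values" using new_crit_value[OF that(1)] by (simp add: v_def)
      have v\<xi>: "\<bar>v\<bar> > \<xi>" using crit_values(2)[OF v] .
      have nz: "\<bar>poly (pderiv (F i)) v\<bar> > 0"
      proof -
        have "0 < real (d ^ i) * \<bar>poly (F i) v - 0\<bar>"
          using F_outside[OF v\<xi>, of i] xi_nonneg degree_T by simp
        then have "0 < (\<bar>v\<bar> + \<xi>) * \<bar>poly (pderiv (F i)) v\<bar>"
          using F_log_derivative(1)[OF v\<xi> zero_in_interval, of i] by linarith
        then show ?thesis using xi_nonneg by (simp add: zero_less_mult_iff)
      qed
      have "\<eta> \<le> \<bar>v\<bar> - \<xi>" using \<eta>(2)[OF v, of 0] by simp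
      also have "\<dots> \<le> real (d ^ i) * \<bar>poly (F i) v - b 0\<bar> / \<bar>poly (pderiv (F i)) v\<bar>"
        using F_log_derivative(2)[OF v\<xi> b0, of i] nz by (simp add: pos_le_divide_eq)
      finally have "crit_weight (Suc k) c * \<eta> \<le> crit_weight (Suc k) c * (real (d ^ i) * \<bar>poly (F i) v - b 0\<bar> / \<bar>poly (pderiv (F i)) v\<bar>)"
        using new_crit_weight(3)[OF that] by (intro mult_left_mono) auto
      also have "\<dots> = crit_weight n c * \<bar>\<phi> 0 (poly (F n) c)\<bar>"
        unfolding new_crit_weight(1,2)[OF that] \<phi>_0 v_def i_def by simp
      finally show ?thesis by (simp add: mult.commute)
    qed
    have "\<eta> * (\<Sum>k<n. generation_mass k) = (\<Sum>k<n. \<Sum>c\<in>new_crit k. \<eta> * crit_weight (Suc k) c)"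
      by (simp add: generation_mass_def sum_distrib_left)
    also have "\<dots> \<le> (\<Sum>k<n. \<Sum>c\<in>new_crit k. crit_weight n c * \<bar>\<phi> 0 (poly (F n) c)\<bar>)"
      using term_le by (intro sum_mono) auto
    also have "\<dots> = a 1" using B.block_first by (simp add: sum_crit)
    finally show ?thesis using \<eta>(1) by (simp add: field_simps)
  qed
  have "(\<Sum>k<n. generation_mass k) \<le> a 1 / \<eta>" for n
  proof (cases "n = 0")
    case True
    then show ?thesis using a_pos[of 1] \<eta>(1) by simp
  next
    case False
    then show ?thesis by (intro bound) simp
  qed
  then show ?thesis using generation_mass_nonneg by (intro summableI_nonneg_bounded) auto
qed

definition inverse_sum :: "nat \<Rightarrow> real" where
  "inverse_sum n = (\<Sum>c\<in>crit n. crit_weight n c / (\<bar>poly (F n) c\<bar> - \<xi>))"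

text \<open>Relative to its weight, a point of generation \<open>k\<close> contributes at most \<open>e (n - Suc k)\<close>, and \<open>e\<close> is null
because critical values escape. It remains to apply \<open>convolution_null\<close>.\<close>

lemma inverse_sum_tendsto_0: "inverse_sum \<longlonglongrightarrow> 0"
proof -
  define e where "e = (\<lambda>i. \<Sum>v\<in>crit_values. (\<bar>v\<bar> + \<xi>) / ((\<bar>poly (F i) v\<bar> - \<xi>) * (\<bar>poly (F i) v\<bar> - \<xi>)))"
  have "e \<longlonglongrightarrow> (\<Sum>v\<in>crit_values. 0)" unfolding e_def
  proof (intro tendsto_sum)
    fix v assume v: "v \<in> crit_values"
    have "filterlim (\<lambda>i. \<bar>poly (F i) v\<bar> - \<xi>) at_top sequentially"
      using filterlim_tendsto_add_at_top[OF tendsto_const[of "-\<xi>"] escape[OF crit_values(2)[OF v]]]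
      by (simp add: poly_F_funpow)
    then show "(\<lambda>i. (\<bar>v\<bar> + \<xi>) / ((\<bar>poly (F i) v\<bar> - \<xi>) * (\<bar>poly (F i) v\<bar> - \<xi>))) \<longlonglongrightarrow> 0"
      by (intro tendsto_divide_0[OF tendsto_const] filterlim_at_top_imp_at_infinity
          filterlim_at_top_mult_at_top)
  qed
  then have e0: "e \<longlonglongrightarrow> 0" by simp
  have le: "inverse_sum n \<le> (\<Sum>k<n. generation_mass k * e (n - Suc k))" for n
  proof -
    have term_le: "crit_weight n c / (\<bar>poly (F n) c\<bar> - \<xi>) \<le> crit_weight (Suc k) c * e (n - Suc k)"
      if "c \<in> new_crit k" "k < n" for k c
    proof -
      define v i where "v = poly (F (Suc k)) c" and "i = n - Suc k"
      have v: "v \<in> crit_values" using new_crit_value[OF that(1)] by (simp add: v_def)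
      have v\<xi>: "\<bar>v\<bar> > \<xi>" using crit_values(2)[OF v] .
      define f f' where "f = poly (F i) v" and "f' = poly (pderiv (F i)) v"
      have f: "\<bar>f\<bar> > \<xi>" using F_outside[OF v\<xi>] by (simp add: f_def)
      have lg: "real (d ^ i) * \<bar>f\<bar> \<le> (\<bar>v\<bar> + \<xi>) * \<bar>f'\<bar>"
        using F_log_derivative(1)[OF v\<xi> zero_in_interval, of i] by (simp add: f_def f'_def)
      moreover have "0 < real (d ^ i) * \<bar>f\<bar>" using f xi_nonneg degree_T by simp
      ultimately have "0 < (\<bar>v\<bar> + \<xi>) * \<bar>f'\<bar>" by linarith
      then have f'0: "\<bar>f'\<bar> > 0" using xi_nonneg by (simp add: zero_less_mult_iff)
      have "real (d ^ i) * (\<bar>f\<bar> - \<xi>) \<le> real (d ^ i) * \<bar>f\<bar>"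
        using xi_nonneg by (intro mult_left_mono) auto
      then have "real (d ^ i) * (\<bar>f\<bar> - \<xi>) \<le> (\<bar>v\<bar> + \<xi>) * \<bar>f'\<bar>" using lg by linarith
      then have "real (d ^ i) / \<bar>f'\<bar> \<le> (\<bar>v\<bar> + \<xi>) / (\<bar>f\<bar> - \<xi>)"
        using f f'0 by (simp add: field_simps)
      then have "real (d ^ i) / \<bar>f'\<bar> / (\<bar>f\<bar> - \<xi>) \<le> (\<bar>v\<bar> + \<xi>) / (\<bar>f\<bar> - \<xi>) / (\<bar>f\<bar> - \<xi>)"
        using f by (intro divide_right_mono) auto
      also have "\<dots> = (\<bar>v\<bar> + \<xi>) / ((\<bar>poly (F i) v\<bar> - \<xi>) * (\<bar>poly (F i) v\<bar> - \<xi>))"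
        by (simp add: f_def)
      also have "\<dots> \<le> e i" unfolding e_def
      proof (rule member_le_sum[OF v _ crit_values(1)])
        fix u assume "u \<in> crit_values - {v}"
        then have "\<bar>u\<bar> > \<xi>" using crit_values(2) by auto
        then show "0 \<le> (\<bar>u\<bar> + \<xi>) / ((\<bar>poly (F i) u\<bar> - \<xi>) * (\<bar>poly (F i) u\<bar> - \<xi>))"
          using F_outside[of u i] xi_nonneg by (intro divide_nonneg_nonneg mult_nonneg_nonneg) auto
      qed
      finally have "crit_weight (Suc k) c * (real (d ^ i) / \<bar>f'\<bar> / (\<bar>f\<bar> - \<xi>)) \<le> crit_weight (Suc k) c * e i"
        using new_crit_weight(3)[OF that] by (intro mult_left_mono) auto
      then show ?thesis
        unfolding new_crit_weight(1,2)[OF that] f_def f'_def v_def i_def by simp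
    qed
    have "inverse_sum n \<le> (\<Sum>k<n. \<Sum>c\<in>new_crit k. crit_weight (Suc k) c * e (n - Suc k))"
      unfolding inverse_sum_def sum_crit using term_le by (intro sum_mono) auto
    then show ?thesis by (simp add: generation_mass_def sum_distrib_right)
  qed
  have ge: "0 \<le> inverse_sum n" for n
    unfolding inverse_sum_def using crit_weight_pos crit_value_outside
    by (intro sum_nonneg divide_nonneg_nonneg) (auto intro: less_imp_le simp: less_imp_le)
  show ?thesis
    by (rule tendsto_sandwich[OF _ _ tendsto_const convolution_null[OF summable_generation_mass generation_mass_nonneg e0]])
      (use ge le in auto)
qed

lemma a_multiple_le:
  assumes "n \<ge> 1"
  shows "a (Suc j * d ^ n) \<le> \<xi>\<^sup>2 * inverse_sum n"
proof -
  interpret B: jacobi_block M E \<xi> b a T n j "d ^ n" by unfold_locales (use assms in auto)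
  have le: "crit_weight n c / \<bar>\<phi> j (poly (F n) c)\<bar> \<le> crit_weight n c / (\<bar>poly (F n) c\<bar> - \<xi>)" if "c \<in> crit n" for c
    using crit_weight_pos[OF that] \<phi>_lower[OF crit_value_outside[OF that], of j]
      \<phi>_abs[OF crit_value_outside[OF that], of j] crit_value_outside[OF that]
    by (intro divide_left_mono) (auto intro: mult_pos_pos)
  have "a (Suc j * d ^ n) = a (Suc j) * (\<Sum>c\<in>crit n. crit_weight n c / \<bar>\<phi> j (poly (F n) c)\<bar>)"
    by (rule B.block_inverse_sum)
  also have "\<dots> \<le> a (Suc j) * inverse_sum n"
    unfolding inverse_sum_def using a_pos[of "Suc j"] le by (intro mult_left_mono sum_mono) auto
  also have "\<dots> \<le> \<xi>\<^sup>2 * inverse_sum n"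
  proof (intro mult_right_mono a_bound)
    show "0 \<le> inverse_sum n" unfolding inverse_sum_def using crit_weight_pos crit_value_outside
      by (intro sum_nonneg divide_nonneg_nonneg) (auto intro: less_imp_le simp: less_imp_le)
  qed
  finally show ?thesis .
qed

lemma a_multiple_small:
  assumes "\<delta> > 0"
  obtains n where "n \<ge> 2" "\<And>j. a (Suc j * d ^ n) \<le> \<delta>"
proof -
  have "(\<lambda>n. \<xi>\<^sup>2 * inverse_sum n) \<longlonglongrightarrow> \<xi>\<^sup>2 * 0"
    by (intro tendsto_intros inverse_sum_tendsto_0)
  then have "eventually (\<lambda>n. \<xi>\<^sup>2 * inverse_sum n < \<delta>) sequentially"
    using assms by (intro order_tendstoD(2)) auto
  then obtain N where N: "\<And>n. n \<ge> N \<Longrightarrow> \<xi>\<^sup>2 * inverse_sum n < \<delta>"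
    unfolding eventually_sequentially by blast
  show ?thesis
  proof (rule that[of "max N 2"])
    show "a (Suc j * d ^ max N 2) \<le> \<delta>" for j
      by (rule order_trans[OF a_multiple_le less_imp_le[OF N]]) auto
  qed simp
qed

lemma \<phi>_abs_Suc:
  assumes v: "\<bar>v\<bar> > \<xi>"
  shows "\<bar>\<phi> (Suc j) v\<bar> = \<bar>\<phi> 0 v\<bar> + sgn v * (b 0 - b (Suc j)) - a (Suc j) / \<bar>\<phi> j v\<bar>"
proof -
  have s: "sgn v = 1 \<or> sgn v = -1" using v xi_nonneg by (auto simp: sgn_if)
  then show ?thesis unfolding \<phi>_abs[OF v] unfolding \<phi>_Suc[OF v] \<phi>_0
    by (auto simp: algebra_simps)
qed

text \<open>Sum \<open>\<phi>_abs_Suc\<close> over the critical points of \<open>F n\<close>, with their weights. The terms with \<open>b\<close> cancel by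
\<open>sum_inverse_second_derivative\<close>; this takes at least two critical points, which \<open>n \<ge> 2\<close> ensures. The
last terms add up to \<open>a (s * d ^ n)\<close> by \<open>block_inverse_sum\<close>.\<close>

lemma a_after_multiple:
  assumes n: "n \<ge> 2" and s: "s \<ge> 1"
  shows "a (Suc (s * d ^ n)) = a 1 - a (s * d ^ n)"
proof -
  obtain j where j: "s = Suc j" using s by (cases s) auto
  interpret B0: jacobi_block M E \<xi> b a T n 0 "d ^ n" by unfold_locales (use n in auto)
  interpret Bj: jacobi_block M E \<xi> b a T n j "d ^ n" by unfold_locales (use n in auto)
  interpret Bs: jacobi_block M E \<xi> b a T n s "d ^ n" by unfold_locales (use n in auto)
  have D: "d ^ n \<ge> 3"
  proof -
    have "(2::nat) ^ 2 \<le> d ^ 2" using degree_T by (intro power_mono) auto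
    also have "\<dots> \<le> d ^ n" using n degree_T by (intro power_increasing) auto
    finally show ?thesis by simp
  qed
  have sgn_weight: "crit_weight n c * sgn (poly (F n) c) = - real (d ^ n) * (1 / F2 n c)"
    if "c \<in> crit n" for c
    using second_derivative_crit[OF that] unfolding crit_weight_def
    by (auto simp: sgn_if abs_if mult_less_0_iff)
  have "(\<Sum>c\<in>crit n. crit_weight n c * sgn (poly (F n) c)) =
      (\<Sum>c\<in>crit n. - real (d ^ n) * (1 / F2 n c))"
    by (intro sum.cong refl sgn_weight)
  also have "\<dots> = - real (d ^ n) * (\<Sum>c\<in>crit n. 1 / F2 n c)"
    by (rule sum_distrib_left[symmetric])
  finally have zero: "(\<Sum>c\<in>crit n. crit_weight n c * sgn (poly (F n) c)) = 0"
    using B0.sum_inverse_second_derivative[OF D] by simp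
  have "a (Suc (s * d ^ n)) = (\<Sum>c\<in>crit n. crit_weight n c * \<bar>\<phi> s (poly (F n) c)\<bar>)"
    by (rule Bs.block_first)
  also have "\<dots> = (\<Sum>c\<in>crit n. crit_weight n c * \<bar>\<phi> 0 (poly (F n) c)\<bar>
       + (b 0 - b s) * (crit_weight n c * sgn (poly (F n) c)) - a s * (crit_weight n c / \<bar>\<phi> j (poly (F n) c)\<bar>))"
    by (intro sum.cong refl) (simp add: j \<phi>_abs_Suc[OF crit_value_outside] algebra_simps)
  also have "\<dots> = (\<Sum>c\<in>crit n. crit_weight n c * \<bar>\<phi> 0 (poly (F n) c)\<bar>)
       + (b 0 - b s) * (\<Sum>c\<in>crit n. crit_weight n c * sgn (poly (F n) c))
       - a s * (\<Sum>c\<in>crit n. crit_weight n c / \<bar>\<phi> j (poly (F n) c)\<bar>)"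
    by (simp add: sum.distrib sum_subtractf sum_distrib_left)
  also have "\<dots> = a 1 - a (s * d ^ n)"
    using zero B0.block_first Bj.block_inverse_sum by (simp add: j)
  finally show ?thesis .
qed

end

section \<open>Comparison of blocks\<close>

lemma sqrt_close:
  fixes x y \<delta> \<xi> :: real
  assumes "0 \<le> x" "0 \<le> y" "x \<le> \<xi>\<^sup>2" "y \<le> \<xi>\<^sup>2" "0 \<le> \<xi>" "0 \<le> \<delta>" "\<delta> \<le> 1"
    and "(1 - \<delta>) * y \<le> x" "(1 - \<delta>) * x \<le> y"
  shows "\<bar>sqrt x - sqrt y\<bar> \<le> \<delta> * \<xi>"
proof -
  have aux: "sqrt y - sqrt x \<le> \<delta> * \<xi>" if "0 \<le> x" "0 \<le> y" "y \<le> \<xi>\<^sup>2" "(1 - \<delta>) * y \<le> x" for x y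
  proof -
    have "(1 - \<delta>) * sqrt y = sqrt ((1 - \<delta>)\<^sup>2 * y)" using assms by (simp add: real_sqrt_mult)
    also have "\<dots> \<le> sqrt x"
    proof (rule real_sqrt_le_mono)
      have "(1 - \<delta>)\<^sup>2 * y \<le> (1 - \<delta>) * y"
        using assms that by (intro mult_right_mono) (auto simp: power2_eq_square mult_left_le)
      then show "(1 - \<delta>)\<^sup>2 * y \<le> x" using that by linarith
    qed
    finally have "sqrt y - sqrt x \<le> \<delta> * sqrt y" by (simp add: algebra_simps)
    also have "sqrt y \<le> \<xi>" using that assms by (simp add: real_le_lsqrt)
    then have "\<delta> * sqrt y \<le> \<delta> * \<xi>" using assms by (intro mult_left_mono)
    finally show ?thesis .
  qed
  show ?thesis using aux[of x y] aux[of y x] assms by (simp add: abs_le_iff)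
qed

context balanced_jacobi
begin

lemma crit_gap:
  obtains \<eta> where "\<eta> > 0" "\<And>n c. c \<in> crit n \<Longrightarrow> \<eta> \<le> \<bar>poly (F n) c\<bar> - \<xi>"
proof -
  obtain \<eta> where \<eta>: "\<eta> > 0" "\<And>v i. v \<in> crit_values \<Longrightarrow> \<eta> \<le> \<bar>poly (F i) v\<bar> - \<xi>"
    by (rule crit_values_gap) blast
  have "\<eta> \<le> \<bar>poly (F n) c\<bar> - \<xi>" if c: "c \<in> crit n" for n c
  proof -
    have "crit n = (\<Union>k<n. new_crit k)"
      by (induction n) (auto simp: crit_0 crit_Suc lessThan_Suc)
    then obtain k where k: "k < n" "c \<in> new_crit k" using c by auto
    show ?thesis unfolding new_crit_weight(1)[OF k(2,1)]
      by (rule \<eta>(2)[OF new_crit_value[OF k(2)]])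
  qed
  then show ?thesis using that \<eta>(1) by blast
qed

text \<open>The rows after \<open>s * D * D\<close> form the block of index \<open>m = s * D\<close>. Its spectral weights differ from those
of block 0 by a factor between \<open>1 - \<delta>\<close> and 1, so \<open>orthogonal_polys_perturbation\<close> applies. The norms give
the \<open>a\<close> as successive quotients, and the subleading coefficients give the sums of the \<open>b\<close>. The last
row \<open>k = D\<close> lies outside the block and is treated by \<open>block_last\<close> and \<open>b_F\<close>.\<close>

lemma block_comparison:
  assumes n: "n \<ge> 2" and s: "s \<ge> 1" and \<delta>: "0 < \<delta>" "\<delta> \<le> 1/2" and \<eta>: "\<eta> > 0"
    and gap: "\<And>c. c \<in> crit n \<Longrightarrow> \<eta> \<le> \<bar>poly (F n) c\<bar> - \<xi>"
    and small: "\<And>j. a (Suc j * d ^ n) \<le> \<delta> * \<eta>\<^sup>2" "\<And>j. a (Suc j * d ^ n) \<le> \<delta> * a 1"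
    and k: "1 \<le> k" "k \<le> d ^ n"
  defines "D \<equiv> d ^ n"
  shows "(1 - \<delta>) * a k \<le> a (s * D * D + k)" "(1 - \<delta>) * a (s * D * D + k) \<le> a k"
    and "\<bar>b (s * D * D + k) - b k\<bar> \<le> 2 * (sqrt (2 * \<delta>) * \<xi>)"
proof -
  define m where "m = s * D"
  have D0: "D > 0" using degree_T by (simp add: D_def)
  then obtain m' where m': "m = Suc m'" using s by (cases m) (auto simp: m_def)
  interpret B0: jacobi_block M E \<xi> b a T n 0 D by unfold_locales (use n in \<open>auto simp: D_def\<close>)
  interpret Bm: jacobi_block M E \<xi> b a T n m D by unfold_locales (use n in \<open>auto simp: D_def\<close>)
  have D2: "D \<ge> 2" by (rule B0.D_ge_2)
  have "m = Suc (s - 1) * d ^ n" using s by (simp add: m_def D_def)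
  then have am: "a m \<le> \<delta> * \<eta>\<^sup>2" "a m \<le> \<delta> * a 1"
    using small[of "s - 1"] by (simp_all only:)
  have am0: "a m > 0" using a_pos[of m] m' by simp
  have bm: "b m = b 0" unfolding m_def D_def using n by (intro b_F) simp
  define w0 where "w0 = (\<lambda>c. crit_weight n c * \<bar>\<phi> 0 (poly (F n) c)\<bar>)"
  define w1 where "w1 = (\<lambda>c. crit_weight n c * \<bar>\<phi> m (poly (F n) c)\<bar>)"
  \<comment> \<open>for \<open>k = D - 1\<close> the polynomial vanishes on all critical points, so its norm is 0\<close>
  define H0 where "H0 = (\<lambda>k. if Suc k < D then h (Suc k) else 0)"
  define H1 where "H1 = (\<lambda>k. if Suc k < D then h (Suc (m * D + k)) / h (m * D) else 0)"
  have w: "0 \<le> w1 c" "w1 c \<le> w0 c" "(1 - \<delta>) * w0 c \<le> w1 c" if c: "c \<in> crit n" for c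
  proof -
    define v where "v = poly (F n) c"
    have v: "\<bar>v\<bar> > \<xi>" using crit_value_outside[OF c] by (simp add: v_def)
    have lo: "\<eta> \<le> \<bar>\<phi> i v\<bar>" for i
      using \<phi>_lower[OF v, of i] \<phi>_abs[OF v, of i] gap[OF c] by (simp add: v_def)
    have eq: "\<bar>\<phi> m v\<bar> = \<bar>\<phi> 0 v\<bar> - a m / \<bar>\<phi> m' v\<bar>"
      unfolding m' \<phi>_abs_Suc[OF v] using bm by (simp add: m')
    have "\<delta> * \<eta>\<^sup>2 \<le> \<delta> * (\<bar>\<phi> 0 v\<bar> * \<bar>\<phi> m' v\<bar>)"
      unfolding power2_eq_square using lo \<eta> \<delta> by (intro mult_left_mono mult_mono) auto
    then have "a m / \<bar>\<phi> m' v\<bar> \<le> \<delta> * \<bar>\<phi> 0 v\<bar>"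
      using am(1) lo[of m'] \<eta> by (simp add: pos_divide_le_eq mult.assoc)
    then have 1: "(1 - \<delta>) * \<bar>\<phi> 0 v\<bar> \<le> \<bar>\<phi> m v\<bar>" unfolding eq by (simp add: algebra_simps)
    have 2: "\<bar>\<phi> m v\<bar> \<le> \<bar>\<phi> 0 v\<bar>" unfolding eq using am0 lo[of m'] \<eta> by simp
    have wp: "0 \<le> crit_weight n c" using crit_weight_pos[OF c] by simp
    show "0 \<le> w1 c" using wp by (simp add: w1_def)
    show "w1 c \<le> w0 c" using mult_left_mono[OF 2 wp] by (simp add: w0_def w1_def v_def)
    show "(1 - \<delta>) * w0 c \<le> w1 c" using mult_left_mono[OF 1 wp] by (simp add: w0_def w1_def v_def mult_ac)
  qed
  have o0: "(\<Sum>c\<in>crit n. w0 c * poly (B0.fwd k * g) c) = H0 k * coeff g k"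
    if "k \<le> D - 1" "degree g \<le> k" for k g
  proof (cases "Suc k < D")
    case True
    then show ?thesis using B0.block_orthogonality[OF True that(2)] by (simp add: w0_def H0_def)
  next
    case False
    then have "k = D - 1" using that by simp
    then show ?thesis using B0.fwd_last by (simp add: H0_def)
  qed
  have o1: "(\<Sum>c\<in>crit n. w1 c * poly (Bm.fwd k * g) c) = H1 k * coeff g k"
    if "k \<le> D - 1" "degree g \<le> k" for k g
  proof (cases "Suc k < D")
    case True
    then show ?thesis using Bm.block_orthogonality[OF True that(2)] by (simp add: w1_def H1_def)
  next
    case False
    then have "k = D - 1" using that by simp
    then show ?thesis using Bm.fwd_last by (simp add: H1_def)
  qed
  have \<delta>1: "\<delta> < 1" using \<delta> by simp
  have fin: "finite (crit n)" using finite_card_crit by simp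
  note pert = orthogonal_polys_perturbation[where K = "D - 1", OF fin w \<delta>1 B0.degree_fwd B0.lead_fwd
      Bm.degree_fwd Bm.lead_fwd o0 o1]
  define G where "G = (\<lambda>i. h (m * D + i) / h (m * D))"
  have hp: "h i > 0" for i by (rule h_pos)
  have G: "(1 - \<delta>) * h i \<le> G i" "G i \<le> h i" if "i < D" for i
  proof -
    have "(1 - \<delta>) * h i \<le> G i \<and> G i \<le> h i"
    proof (cases i)
      case 0
      then show ?thesis using \<delta> hp[of "m * D"] by (simp add: G_def)
    next
      case (Suc r)
      then show ?thesis using pert(1,2)[of r] that by (simp add: H0_def H1_def G_def)
    qed
    then show "(1 - \<delta>) * h i \<le> G i" "G i \<le> h i" by auto
  qed
  have Gp: "G i > 0" for i unfolding G_def using hp by simp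
  have shift: "s * D * D + k = m * D + k" by (simp add: m_def)
  have both: "(1 - \<delta>) * a k \<le> a (m * D + k) \<and> (1 - \<delta>) * a (m * D + k) \<le> a k"
  proof -
    define r where "r = k - 1"
    have r: "k = Suc r" "r < D" using k by (auto simp: r_def D_def)
    \<comment> \<open>quotients of quantities that are comparable up to the factor \<open>1 - \<delta>\<close> are comparable in the same sense, because both deviate to the same side\<close>
    have main: "(1 - \<delta>) * (x / y) \<le> x' / y' \<and> (1 - \<delta>) * (x' / y') \<le> x / y"
      if "(1 - \<delta>) * x \<le> x'" "x' \<le> x" "(1 - \<delta>) * y \<le> y'" "y' \<le> y" "0 < x" "0 < x'" "0 < y" "0 < y'"
      for x y x' y' :: real
    proof
      have "(1 - \<delta>) * x * y' \<le> x' * y" using that \<delta>1 by (intro mult_mono) auto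
      then show "(1 - \<delta>) * (x / y) \<le> x' / y'" using that by (simp add: field_simps)
      have "((1 - \<delta>) * y) * x' \<le> y' * x" using that \<delta>1 by (intro mult_mono) auto
      then show "(1 - \<delta>) * (x' / y') \<le> x / y" using that by (simp add: field_simps)
    qed
    show ?thesis
    proof (cases "k < D")
      case True
      have "a k = h k / h r" unfolding r(1) h_Suc using hp[of r] by simp
      moreover have "a (m * D + k) = G k / G r"
        unfolding r(1) G_def using hp[of "m * D"] hp[of "m * D + r"] h_Suc[of "m * D + r"] by simp
      ultimately show ?thesis
        using main[OF G(1,2)[OF True] G(1,2)[OF r(2)] hp Gp hp Gp] by simp
    next
      case False
      then have kD: "k = D" using k by (simp add: D_def)
      have L2: "(L n)\<^sup>2 > 0" using L_nonzero[of n] by simp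
      have "m = s * d ^ n" by (simp add: m_def D_def)
      then have aS: "a (Suc m) = a 1 - a m" using a_after_multiple[OF n s] by simp
      have "a k = a 1 / ((L n)\<^sup>2 * h (D - 1))"
        using B0.block_last by (simp add: kD)
      moreover have "a (m * D + k) = a (Suc m) / ((L n)\<^sup>2 * G (D - 1))"
        using Bm.block_last D0 by (simp add: kD G_def add.commute)
      moreover have "(1 - \<delta>) * (a 1 / ((L n)\<^sup>2 * h (D - 1))) \<le> a (Suc m) / ((L n)\<^sup>2 * G (D - 1)) \<and>
          (1 - \<delta>) * (a (Suc m) / ((L n)\<^sup>2 * G (D - 1))) \<le> a 1 / ((L n)\<^sup>2 * h (D - 1))"
      proof (rule main)
        have "D - 1 < D" using D0 by simp
        note g = G[OF this]
        show "(1 - \<delta>) * ((L n)\<^sup>2 * h (D - 1)) \<le> (L n)\<^sup>2 * G (D - 1)"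
          using mult_left_mono[OF g(1), of "(L n)\<^sup>2"] by (simp add: mult_ac)
        show "(L n)\<^sup>2 * G (D - 1) \<le> (L n)\<^sup>2 * h (D - 1)"
          using mult_left_mono[OF g(2), of "(L n)\<^sup>2"] by simp
        show "(1 - \<delta>) * a 1 \<le> a (Suc m)" unfolding aS using am(2) by (simp add: algebra_simps)
      qed (use aS am0 a_pos[of 1] a_pos[of "Suc m"] L2 hp Gp in auto)
      ultimately show ?thesis by simp
    qed
  qed
  then show "(1 - \<delta>) * a k \<le> a (s * D * D + k)" "(1 - \<delta>) * a (s * D * D + k) \<le> a k"
    unfolding shift by auto
  have \<xi>0: "0 \<le> \<xi>" by (rule xi_nonneg)
  \<comment> \<open>differences of the partial sums of the diagonal, which are the subleading coefficients up to sign\<close>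
  define \<sigma> where "\<sigma> = (\<lambda>i. (\<Sum>l\<le>i. b (Suc (m * D + l))) - (\<Sum>l\<le>i. b (Suc l)))"
  have \<sigma>: "\<bar>\<sigma> i\<bar> \<le> sqrt (2 * \<delta>) * \<xi>" if i: "Suc i < D" for i
  proof -
    have c: "coeff (Bm.fwd (Suc i)) i - coeff (B0.fwd (Suc i)) i = - \<sigma> i"
      unfolding Bm.fwd_def B0.fwd_def rec_poly_subleading \<sigma>_def by simp
    have "(1 - \<delta>) * (H0 i * (\<sigma> i)\<^sup>2) \<le> \<delta> * H0 (Suc i)"
      using pert(3)[of i] i unfolding c by simp
    also have "\<dots> \<le> \<delta> * (H0 i * \<xi>\<^sup>2)"
    proof (rule mult_left_mono)
      have "h (Suc i) * a (Suc (Suc i)) \<le> h (Suc i) * \<xi>\<^sup>2"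
        using hp[of "Suc i"] a_bound[of "Suc i"] by (intro mult_left_mono) auto
      then show "H0 (Suc i) \<le> H0 i * \<xi>\<^sup>2"
        using i hp[of "Suc i"] by (auto simp: H0_def h_Suc)
    qed (use \<delta> in simp)
    finally have "H0 i * ((1 - \<delta>) * (\<sigma> i)\<^sup>2) \<le> H0 i * (\<delta> * \<xi>\<^sup>2)" by (simp add: mult_ac)
    moreover have "H0 i > 0" using i hp by (simp add: H0_def)
    ultimately have "(1 - \<delta>) * (\<sigma> i)\<^sup>2 \<le> \<delta> * \<xi>\<^sup>2" by simp
    moreover have "1 / 2 * (\<sigma> i)\<^sup>2 \<le> (1 - \<delta>) * (\<sigma> i)\<^sup>2"
      using \<delta> by (intro mult_right_mono) auto
    ultimately have "(\<sigma> i)\<^sup>2 \<le> (sqrt (2 * \<delta>) * \<xi>)\<^sup>2"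
      using \<delta> by (simp add: power_mult_distrib)
    moreover have "0 \<le> sqrt (2 * \<delta>) * \<xi>" using \<delta> \<xi>0 by simp
    ultimately show ?thesis using abs_le_square_iff[of "\<sigma> i" "sqrt (2 * \<delta>) * \<xi>"] by simp
  qed
  show "\<bar>b (s * D * D + k) - b k\<bar> \<le> 2 * (sqrt (2 * \<delta>) * \<xi>)"
  proof (cases "k < D")
    case True
    define r where "r = k - 1"
    have r: "k = Suc r" using k by (simp add: r_def)
    show ?thesis
    proof (cases r)
      case 0
      have "b (m * D + k) - b k = \<sigma> 0" by (simp add: \<sigma>_def r 0)
      then show ?thesis unfolding shift using \<sigma>[of 0] True r 0 \<delta> \<xi>0 D2 by simp
    next
      case (Suc l)
      have "b (m * D + k) - b k = \<sigma> r - \<sigma> l" by (simp add: \<sigma>_def r Suc)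
      then show ?thesis unfolding shift using \<sigma>[of r] \<sigma>[of l] True r Suc by simp
    qed
  next
    case False
    then have kD: "k = D" using k by (simp add: D_def)
    have n1: "n \<ge> 1" using n by simp
    have "b (m * D + k) = b 0" "b k = b 0"
      using b_F[OF n1, of "Suc m"] b_F[OF n1, of 1] by (simp_all add: kD D_def add.commute)
    then show ?thesis unfolding shift using \<delta> \<xi>0 by simp
  qed
qed

theorem jacobi_coefficients_recur:
  assumes "\<epsilon> > 0"
  shows "\<exists>n\<ge>1. \<forall>s. \<forall>k\<in>{1..d ^ n}.
    \<bar>sqrt (a (k + s * (d ^ n)\<^sup>2)) - sqrt (a k)\<bar> \<le> \<epsilon> \<and> \<bar>b (k + s * (d ^ n)\<^sup>2) - b k\<bar> \<le> \<epsilon>"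
proof -
  have \<xi>0: "0 \<le> \<xi>" by (rule xi_nonneg)
  obtain \<eta> where \<eta>: "\<eta> > 0" "\<And>n c. c \<in> crit n \<Longrightarrow> \<eta> \<le> \<bar>poly (F n) c\<bar> - \<xi>"
    by (rule crit_gap) blast
  \<comment> \<open>\<open>t\<close> turns the bounds \<open>2 * (sqrt (2 * \<delta>) * \<xi>)\<close> and \<open>\<delta> * \<xi>\<close> of the comparison into \<open>\<epsilon>\<close>\<close>
  define t where "t = \<epsilon> / (2 * (\<xi> + 1))"
  have t: "t > 0" using assms \<xi>0 by (simp add: t_def)
  have t\<xi>: "2 * (t * \<xi>) \<le> \<epsilon>"
  proof -
    have "2 * (t * \<xi>) = \<epsilon> * (\<xi> / (\<xi> + 1))" using \<xi>0 by (simp add: t_def field_simps)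
    also have "\<dots> \<le> \<epsilon> * 1" using \<xi>0 assms by (intro mult_left_mono) auto
    finally show ?thesis by simp
  qed
  define \<delta> where "\<delta> = min (1/2) (min (t\<^sup>2 / 2) t)"
  have \<delta>: "0 < \<delta>" "\<delta> \<le> 1/2" "2 * \<delta> \<le> t\<^sup>2" "\<delta> \<le> t"
    using t by (auto simp: \<delta>_def min_def)
  have sq: "sqrt (2 * \<delta>) \<le> t" using \<delta>(3) t by (simp add: real_le_lsqrt)
  \<comment> \<open>the bound by \<open>\<delta> * \<eta>\<^sup>2\<close> controls the weights, the one by \<open>\<delta> * a 1\<close> the entry \<open>a (Suc m)\<close>\<close>
  have "0 < \<delta> * min (\<eta>\<^sup>2) (a 1)" using \<delta> \<eta>(1) a_pos[of 1] by simp
  then obtain n where n: "n \<ge> 2" "\<And>j. a (Suc j * d ^ n) \<le> \<delta> * min (\<eta>\<^sup>2) (a 1)"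
    by (rule a_multiple_small) blast
  have m: "\<delta> * min (\<eta>\<^sup>2) (a 1) \<le> \<delta> * \<eta>\<^sup>2" "\<delta> * min (\<eta>\<^sup>2) (a 1) \<le> \<delta> * a 1"
    using \<delta>(1) by (auto intro!: mult_left_mono)
  have "\<bar>sqrt (a (k + s * (d ^ n)\<^sup>2)) - sqrt (a k)\<bar> \<le> \<epsilon> \<and> \<bar>b (k + s * (d ^ n)\<^sup>2) - b k\<bar> \<le> \<epsilon>"
    if k: "1 \<le> k" "k \<le> d ^ n" for s k
  proof (cases "s = 0")
    case True
    then show ?thesis using assms by simp
  next
    case False
    then have s: "s \<ge> 1" by simp
    have idx: "k + s * (d ^ n)\<^sup>2 = s * d ^ n * d ^ n + k" by (simp add: power2_eq_square)
    note cmp = block_comparison[OF n(1) s \<delta>(1,2) \<eta>(1) \<eta>(2) order_trans[OF n(2) m(1)]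
        order_trans[OF n(2) m(2)] k]
    have bounds: "a i \<le> \<xi>\<^sup>2" "0 \<le> a i" if "i \<ge> 1" for i
      using that a_bound[of "i - 1"] a_pos[of i] by auto
    have "\<bar>sqrt (a (s * d ^ n * d ^ n + k)) - sqrt (a k)\<bar> \<le> \<delta> * \<xi>"
      by (rule sqrt_close) (use cmp bounds k \<xi>0 \<delta> in auto)
    also have "\<dots> \<le> t * \<xi>" using \<delta>(4) \<xi>0 by (intro mult_right_mono)
    also have "\<dots> \<le> \<epsilon>" using t\<xi> t \<xi>0 mult_nonneg_nonneg[of t \<xi>] by linarith
    finally have 1: "\<bar>sqrt (a (s * d ^ n * d ^ n + k)) - sqrt (a k)\<bar> \<le> \<epsilon>" .
    have "2 * (sqrt (2 * \<delta>) * \<xi>) \<le> 2 * (t * \<xi>)"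
      using sq \<xi>0 by (intro mult_left_mono mult_right_mono) auto
    then have "\<bar>b (s * d ^ n * d ^ n + k) - b k\<bar> \<le> \<epsilon>" using cmp(3) t\<xi> by linarith
    then show ?thesis using 1 unfolding idx by simp
  qed
  then show ?thesis using n(1) by (intro exI[of _ n]) auto
qed

end

section \<open>Real Julia sets\<close>

definition escapes :: "complex poly \<Rightarrow> complex \<Rightarrow> bool" where
  "escapes T z \<longleftrightarrow> filterlim (\<lambda>n. norm ((poly T ^^ n) z)) at_top sequentially"

lemma escapes_image_iff: "escapes T (poly T z) \<longleftrightarrow> escapes T z"
proof -
  have "(poly T ^^ n) (poly T z) = (poly T ^^ Suc n) z" for n
    by (simp only: funpow_Suc_right o_apply)
  then show ?thesis unfolding escapes_def
    by (simp only: filterlim_sequentially_Suc[of "\<lambda>n. norm ((poly T ^^ n) z)"])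
qed

lemma continuous_on_funpow_poly: "continuous_on A (poly (T::complex poly) ^^ n)"
proof (induction n)
  case (Suc n)
  then show ?case
    by (auto intro!: continuous_intros continuous_on_compose2[of UNIV "poly T"] simp: o_def)
qed (simp add: continuous_on_id)

lemma poly_doubling_radius:
  fixes T :: "complex poly"
  assumes "degree T \<ge> 2"
  obtains R where "R \<ge> 1" "\<And>w. norm w \<ge> R \<Longrightarrow> norm (poly T w) \<ge> 2 * norm w"
proof -
  obtain a p where T: "T = pCons a p" by (cases T)
  obtain a' p' where p: "p = pCons a' p'" by (cases p)
  have "p' \<noteq> 0" using assms T p by (auto split: if_splits)
  then obtain r where r: "\<And>z. r \<le> norm z \<Longrightarrow> 3 \<le> norm (poly p z)"
    unfolding p by (meson poly_infinity)
  have "norm (poly T w) \<ge> 2 * norm w" if "norm w \<ge> max 1 (max r (norm a))" for w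
  proof -
    have "norm (w * poly p w) \<ge> norm w * 3"
      unfolding norm_mult using that r by (intro mult_left_mono) auto
    moreover have "norm (poly T w) \<ge> norm (w * poly p w) - norm a"
      unfolding T using norm_diff_ineq[of "w * poly p w" a] by (simp add: add.commute)
    ultimately show ?thesis using that by simp
  qed
  then show ?thesis using that[of "max 1 (max r (norm a))"] by simp
qed

locale escape_radius =
  fixes T :: "complex poly" and R :: real
  assumes R_ge_1: "R \<ge> 1"
    and doubling: "\<And>w. norm w \<ge> R \<Longrightarrow> norm (poly T w) \<ge> 2 * norm w"
begin

lemma iterate_growth: "norm w \<ge> R \<Longrightarrow> norm ((poly T ^^ n) w) \<ge> 2 ^ n * norm w"
proof (induction n)
  case (Suc n)
  have "1 * norm w \<le> 2 ^ n * norm w" by (intro mult_right_mono) auto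
  then have "norm ((poly T ^^ n) w) \<ge> R" using Suc by linarith
  then show ?case using doubling[of "(poly T ^^ n) w"] Suc by simp
qed simp

lemma iterate_growth_from:
  assumes "norm ((poly T ^^ N) z) > R"
  shows "norm ((poly T ^^ (N + n)) z) \<ge> 2 ^ n"
proof -
  have "(2::real) ^ n \<le> 2 ^ n * norm ((poly T ^^ N) z)"
    using assms R_ge_1 by simp
  moreover have "(poly T ^^ (N + n)) z = (poly T ^^ n) ((poly T ^^ N) z)"
    by (subst add.commute) (simp add: funpow_add)
  ultimately show ?thesis
    using iterate_growth[of "(poly T ^^ N) z" n] assms by (simp only:) linarith
qed

lemma escapes_iff: "escapes T z \<longleftrightarrow> (\<exists>N. norm ((poly T ^^ N) z) > R)"
proof
  assume "escapes T z"
  then show "\<exists>N. norm ((poly T ^^ N) z) > R"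
    unfolding escapes_def filterlim_at_top_dense eventually_sequentially by blast
next
  assume "\<exists>N. norm ((poly T ^^ N) z) > R"
  then obtain N where N: "norm ((poly T ^^ N) z) > R" by blast
  show "escapes T z"
    unfolding escapes_def filterlim_at_top_dense eventually_sequentially
  proof
    fix B :: real
    obtain j where j: "B < 2 ^ j" using real_arch_pow[of 2 B] by auto
    have "B < norm ((poly T ^^ n) z)" if "n \<ge> N + j" for n
    proof -
      note j
      also have "(2::real) ^ j \<le> 2 ^ (n - N)" using that by (intro power_increasing) auto
      also have "\<dots> \<le> norm ((poly T ^^ n) z)"
        using iterate_growth_from[OF N, of "n - N"] that by simp
      finally show ?thesis .
    qed
    then show "\<exists>m. \<forall>n\<ge>m. B < norm ((poly T ^^ n) z)" by blast
  qed
qed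

lemma open_escapes: "open {z. escapes T z}"
proof -
  have "open {z. norm ((poly T ^^ N) z) > R}" for N
    by (intro open_Collect_less continuous_intros continuous_on_funpow_poly)
  then have "open (\<Union>N. {z. norm ((poly T ^^ N) z) > R})" by blast
  then show ?thesis by (simp add: escapes_iff Collect_ex_eq)
qed

text \<open>On a small ball some iterate has absolute value greater than \<open>R\<close>, and from then on it doubles. Now a
sequence of iterates either repeats one iterate infinitely often or has a subsequence along which the
exponents tend to infinity.\<close>

lemma escapes_in_fatou:
  assumes "escapes T z"
  shows "z \<in> fatou_set T"
proof -
  obtain N where N: "norm ((poly T ^^ N) z) > R" using assms escapes_iff by blast
  have "open {w. norm ((poly T ^^ N) w) > R}"
    by (intro open_Collect_less continuous_intros continuous_on_funpow_poly)
  then obtain e where e: "e > 0" "ball z e \<subseteq> {w. norm ((poly T ^^ N) w) > R}"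
    using N open_contains_ball by blast
  have "normal_family_on (ball z e) (range (\<lambda>n. poly T ^^ n))"
    unfolding normal_family_on_def
  proof (intro allI impI)
    fix f :: "nat \<Rightarrow> complex \<Rightarrow> complex"
    assume "range f \<subseteq> range (\<lambda>n. poly T ^^ n)"
    then have "\<forall>n. \<exists>k. f n = poly T ^^ k" by blast
    then obtain m where m: "\<And>n. f n = poly T ^^ m n" by metis
    show "\<exists>r. strict_mono r \<and>
           ((\<exists>g. \<forall>K. compact K \<and> K \<subseteq> ball z e \<longrightarrow>
                 uniform_limit K (\<lambda>n. f (r n)) g sequentially) \<or>
            (\<forall>K. compact K \<and> K \<subseteq> ball z e \<longrightarrow>
                 (\<forall>B. \<forall>\<^sub>F n in sequentially. \<forall>z\<in>K. norm (f (r n) z) > B)))"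
    proof (cases "finite (range m)")
      case True
      then obtain k where k: "infinite {n. m n = k}"
        using pigeonhole_infinite[of "UNIV::nat set" m] by auto
      have "f (enumerate {n. m n = k} n) = poly T ^^ k" for n
        using enumerate_in_set[OF k, of n] m by auto
      then show ?thesis
        by (intro exI[of _ "enumerate {n. m n = k}"] conjI strict_mono_enumerate[OF k] disjI1
            exI[of _ "poly T ^^ k"]) (auto intro: uniform_limit_const)
    next
      case False
      have big: "\<exists>j>i. n \<le> m j" for i n
      proof (rule ccontr)
        assume "\<not> (\<exists>j>i. n \<le> m j)"
        then have "range m \<subseteq> {..<n} \<union> m ` {..i}"
          by (force simp: not_le not_less)
        then show False using False finite_subset by blast
      qed
      obtain r where r: "\<And>n. n \<le> m (r n)" "\<And>n. r n < r (Suc n)"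
        using dependent_nat_choice[of "\<lambda>n j. n \<le> m j" "\<lambda>n i j. i < j"] big by blast
      have "\<forall>\<^sub>F n in sequentially. \<forall>w\<in>K. norm (f (r n) w) > B" if K: "K \<subseteq> ball z e" for K B
      proof -
        obtain j where j: "B < 2 ^ j" using real_arch_pow[of 2 B] by auto
        have "norm (f (r n) w) > B" if "n \<ge> N + j" "w \<in> K" for n w
        proof -
          have "norm ((poly T ^^ N) w) > R" using e that K by auto
          from iterate_growth_from[OF this, of "m (r n) - N"]
          have "norm (f (r n) w) \<ge> 2 ^ (m (r n) - N)"
            using r(1)[of n] that m by simp
          moreover have "(2::real) ^ j \<le> 2 ^ (m (r n) - N)"
            using r(1)[of n] that by (intro power_increasing) auto
          ultimately show ?thesis using j by linarith
        qed
        then show ?thesis unfolding eventually_sequentially by blast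
      qed
      then show ?thesis
        using r(2) by (intro exI[of _ r]) (auto simp: strict_mono_Suc_iff)
    qed
  qed
  then show ?thesis unfolding fatou_set_def using e
    by (intro CollectI exI[of _ "ball z e"]) auto
qed

text \<open>The orbit of \<open>z\<close> stays bounded, which excludes convergence to infinity on \<open>U\<close>. So some subsequence of
iterates converges at \<open>w\<close>.\<close>

lemma bounded_orbit_near:
  assumes "normal_family_on U (range (\<lambda>n. poly T ^^ n))" "z \<in> U" "\<not> escapes T z" "w \<in> U"
  shows "\<not> escapes T w"
proof
  assume w: "escapes T w"
  obtain r where r: "strict_mono r" and
    alt: "(\<exists>g. \<forall>K. compact K \<and> K \<subseteq> U \<longrightarrow>
              uniform_limit K (\<lambda>n. poly T ^^ r n) g sequentially) \<or>
          (\<forall>K. compact K \<and> K \<subseteq> U \<longrightarrow>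
              (\<forall>B. \<forall>\<^sub>F n in sequentially. \<forall>z\<in>K. norm ((poly T ^^ r n) z) > B))"
    using assms(1)[unfolded normal_family_on_def, THEN spec, of "\<lambda>n. poly T ^^ n"] by blast
  from alt show False
  proof
    assume "\<exists>g. \<forall>K. compact K \<and> K \<subseteq> U \<longrightarrow> uniform_limit K (\<lambda>n. poly T ^^ r n) g sequentially"
    then obtain g where "uniform_limit {w} (\<lambda>n. poly T ^^ r n) g sequentially"
      using assms(4) by (metis compact_sing empty_subsetI insert_subset)
    then have "(\<lambda>n. (poly T ^^ r n) w) \<longlonglongrightarrow> g w"
      by (rule tendsto_uniform_limitI) simp
    then have "(\<lambda>n. norm ((poly T ^^ r n) w)) \<longlonglongrightarrow> norm (g w)" by (rule tendsto_norm)
    moreover have "filterlim (\<lambda>n. norm ((poly T ^^ r n) w)) at_top sequentially"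
      using filterlim_compose[OF w[unfolded escapes_def] filterlim_subseq[OF r]] by simp
    ultimately show False
      using not_tendsto_and_filterlim_at_infinity[OF sequentially_bot _
          filterlim_at_top_imp_at_infinity] by blast
  next
    assume "\<forall>K. compact K \<and> K \<subseteq> U \<longrightarrow>
              (\<forall>B. \<forall>\<^sub>F n in sequentially. \<forall>z\<in>K. norm ((poly T ^^ r n) z) > B)"
    from this[rule_format, of "{z}" R]
    have "\<forall>\<^sub>F n in sequentially. norm ((poly T ^^ r n) z) > R" using assms(2) by simp
    then obtain n where "norm ((poly T ^^ r n) z) > R"
      unfolding eventually_sequentially by blast
    then show False using assms(3) escapes_iff by blast
  qed
qed

text \<open>Escaping points form an open set, and so do the non-escaping points of the Fatou set. A real Julia
set cannot separate them: the open half plane on the side of \<open>z\<close>, together with \<open>z\<close> and a large real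
number \<open>p\<close>, is connected and avoids the Julia set.\<close>

lemma fatou_escapes:
  assumes real: "julia_set T \<subseteq> \<real>" and z: "z \<in> fatou_set T"
  shows "escapes T z"
proof -
  define p where "p = complex_of_real (R + 1)"
  have p: "escapes T p"
    unfolding escapes_iff p_def using R_ge_1 by (intro exI[of _ 0]) (simp add: norm_of_real del: of_real_add)
  define s :: real where "s = (if Im z \<ge> 0 then 1 else -1)"
  define S where "S = {w. inner (complex_of_real s * \<i>) w > 0}"
  have in_S: "w \<in> S \<longleftrightarrow> s * Im w > 0" for w
    unfolding S_def by (simp add: inner_complex_def)
  have S: "connected S" unfolding S_def by (intro convex_connected convex_halfspace_gt)
  have cl: "closure S = {w. s * Im w \<ge> 0}"
    unfolding S_def by (subst closure_halfspace_gt) (auto simp: inner_complex_def s_def)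
  define C where "C = insert z (insert p S)"
  have C: "connected C"
  proof (rule connected_intermediate_closure[OF S])
    show "C \<subseteq> closure S" unfolding cl by (auto simp: C_def p_def s_def in_S less_imp_le)
  qed (auto simp: C_def)
  have CF: "C \<subseteq> fatou_set T"
  proof -
    have "S \<subseteq> fatou_set T"
    proof
      fix w assume "w \<in> S"
      then have "w \<notin> \<real>" by (auto simp: in_S complex_is_Real_iff)
      then show "w \<in> fatou_set T" using real by (auto simp: julia_set_def)
    qed
    then show ?thesis unfolding C_def using z escapes_in_fatou[OF p] by auto
  qed
  \<comment> \<open>\<open>V\<close> is the interior of the set of non-escaping points\<close>
  define V where "V = {w. \<exists>U. open U \<and> w \<in> U \<and> (\<forall>u\<in>U. \<not> escapes T u)}"
  have "open V" unfolding open_subopen[of V] by (auto simp: V_def)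
  moreover have "C \<subseteq> {z. escapes T z} \<union> V"
  proof
    fix w assume w: "w \<in> C"
    then obtain U where "open U" "w \<in> U" "normal_family_on U (range (\<lambda>n. poly T ^^ n))"
      using CF by (auto simp: fatou_set_def)
    then show "w \<in> {z. escapes T z} \<union> V"
      unfolding V_def using bounded_orbit_near by blast
  qed
  ultimately have "{z. escapes T z} \<inter> C = {} \<or> V \<inter> C = {}"
    by (intro connectedD[OF C open_escapes]) (auto simp: V_def)
  then have "V \<inter> C = {}" using p by (auto simp: C_def)
  then show ?thesis using \<open>C \<subseteq> {z. escapes T z} \<union> V\<close> by (auto simp: C_def)
qed

end

lemma julia_set_real_eq:
  assumes "degree T \<ge> 2" "julia_set T \<subseteq> \<real>"
  shows "julia_set T = {z. \<not> escapes T z}"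
proof -
  obtain R where "R \<ge> 1" "\<And>w. norm w \<ge> R \<Longrightarrow> norm (poly T w) \<ge> 2 * norm w"
    using poly_doubling_radius[OF assms(1)] by blast
  then interpret escape_radius T R by unfold_locales
  show ?thesis using fatou_escapes[OF assms(2)] escapes_in_fatou by (auto simp: julia_set_def)
qed

lemma closed_julia_set: "closed (julia_set T)"
proof -
  have "open (fatou_set T)" unfolding open_subopen[of "fatou_set T"]
    by (auto simp: fatou_set_def)
  then show ?thesis by (simp add: julia_set_def closed_def)
qed

section \<open>Polynomials with real preimages\<close>

abbreviation cplx :: "real poly \<Rightarrow> complex poly" where "cplx \<equiv> map_poly of_real"

lemma poly_cplx: "poly (cplx p) (of_real x) = of_real (poly p x)"
  by (induction p) (simp_all add: map_poly_pCons)

lemma pderiv_cplx: "pderiv (cplx p) = cplx (pderiv p)"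
  by (rule poly_eqI) (simp add: coeff_pderiv coeff_map_poly)

lemma degree_cplx [simp]: "degree (cplx p) = degree p"
  by (intro degree_map_poly) simp

lemma cplx_diff_const: "cplx (p - [:x:]) = cplx p - [:of_real x:]"
  by (rule poly_eqI) (simp add: coeff_map_poly coeff_pCons split: nat.splits)

text \<open>Over the complex numbers a polynomial without multiple roots has as many roots as its degree; here
all of them are real.\<close>

lemma simple_split_real:
  assumes "\<And>z. poly (cplx q) z = 0 \<Longrightarrow> z \<in> of_real ` X \<and> poly (pderiv (cplx q)) z \<noteq> 0"
  shows "\<exists>R\<subseteq>X. simple_split q R"
proof -
  have q0: "q \<noteq> 0" using assms[of 0] by auto
  then have cq0: "cplx q \<noteq> 0" by (simp add: map_poly_eq_0_iff)
  have "rsquarefree (cplx q)" unfolding rsquarefree_roots using assms by blast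
  define Z where "Z = {z. poly (cplx q) z = 0}"
  have "degree (cplx q) = degree (smult (lead_coeff (cplx q)) (\<Prod>z\<in>Z. [:-z, 1:]))"
    using complex_poly_decompose_rsquarefree[OF \<open>rsquarefree (cplx q)\<close>] by (simp only: Z_def)
  also have "\<dots> = degree (\<Prod>z\<in>Z. [:-z, 1:])"
    using cq0 leading_coeff_0_iff[of "cplx q"] by (simp only: degree_smult_eq if_False)
  also have "\<dots> = card Z" by (subst degree_prod_eq_sum_degree) auto
  finally have card: "card Z = degree q" by simp
  define R where "R = {r. poly q r = 0}"
  have "Z = of_real ` R"
  proof
    show "of_real ` R \<subseteq> Z" by (auto simp: Z_def R_def poly_cplx)
    show "Z \<subseteq> of_real ` R"
    proof
      fix z assume z: "z \<in> Z"
      then obtain r where "z = of_real r" using assms[of z] by (auto simp: Z_def)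
      then show "z \<in> of_real ` R" using z by (auto simp: Z_def R_def poly_cplx)
    qed
  qed
  then have "card R = degree q" using card card_image[of "of_real :: real \<Rightarrow> complex" R]
    by (simp add: inj_on_def)
  moreover have "finite R" unfolding R_def using q0 by (rule poly_roots_finite)
  ultimately have "simple_split q R" using q0 by (intro simple_splitI_card) (auto simp: R_def)
  moreover have "R \<subseteq> X"
  proof
    fix r assume "r \<in> R"
    then have "complex_of_real r \<in> of_real ` X" using assms[of "of_real r"] by (simp add: R_def poly_cplx)
    then show "r \<in> X" by auto
  qed
  ultimately show ?thesis by blast
qed

text \<open>A sum of points in an open half plane lies in that half plane.\<close>

lemma Re_sum_mset_pos:
  fixes f :: "complex \<Rightarrow> complex"
  assumes "A \<noteq> {#}" "\<And>y. y \<in># A \<Longrightarrow> Re (w * f y) > 0"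
  shows "Re (w * (\<Sum>y\<in>#A. f y)) > 0"
  using assms
proof (induction A)
  case (add x A)
  then show ?case by (cases "A = {#}") (auto simp: distrib_left intro!: add_pos_pos)
qed simp

lemma Re_mult_inverse_pos:
  assumes "Re (w * cnj u) > 0"
  shows "Re (w * (1 / u)) > 0"
proof -
  have u: "u \<noteq> 0" using assms by auto
  have "w * (1 / u) = (w * cnj u) / of_real ((norm u)\<^sup>2)"
    unfolding complex_norm_square using u by simp
  then have "Re (w * (1 / u)) = Re (w * cnj u) / (norm u)\<^sup>2" by (simp only: Re_divide_of_real)
  then show ?thesis using assms u by simp
qed

text \<open>At the end points the hypothesis on the derivative comes from the expanding property; in the interior
it is a consequence, see \<open>preimage_simple\<close>.\<close>

locale real_preimage =
  fixes T :: "complex poly" and \<xi> :: real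
  assumes degree_T: "degree T \<ge> 2"
    and \<xi>_pos: "\<xi> > 0"
    and preimage: "\<And>z x. poly T z = of_real x \<Longrightarrow> x \<in> {-\<xi>..\<xi>} \<Longrightarrow> z \<in> of_real ` {-\<xi>..\<xi>}"
    and endpoints: "\<And>z x. poly T z = of_real x \<Longrightarrow> \<bar>x\<bar> = \<xi> \<Longrightarrow> poly (pderiv T) z \<noteq> 0"
begin

text \<open>Conjugating the coefficients does not change the value at points that are real and have real values.
There are infinitely many such points, the preimages of \<open>{-\<xi>..\<xi>}\<close>.\<close>

lemma real_coeffs: "T = cplx (map_poly Re T)"
proof -
  define T' where "T' = map_poly cnj T"
  define Z where "Z = {z. \<exists>x\<in>{-\<xi>..\<xi>}. poly T z = of_real x}"
  have root: "\<exists>z. poly T z = w" for w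
  proof -
    have "degree (T - [:w:]) > 0"
      using degree_T by (simp add: degree_diff_const)
    then have "\<exists>z. poly (T - [:w:]) z = 0"
      by (intro fundamental_theorem_of_algebra) (simp add: constant_degree)
    then show ?thesis by simp
  qed
  have "of_real ` {-\<xi>..\<xi>} \<subseteq> poly T ` Z" 
  proof
    fix w :: complex assume "w \<in> of_real ` {-\<xi>..\<xi>}"
    then obtain x where "x \<in> {-\<xi>..\<xi>}" "w = of_real x" by blast
    moreover obtain z where z: "poly T z = w" using root by blast
    ultimately show "w \<in> poly T ` Z"
      by (intro image_eqI[of _ _ z]) (auto simp: Z_def)
  qed
  moreover have "infinite (complex_of_real ` {-\<xi>..\<xi>})"
    using \<xi>_pos by (subst finite_image_iff) (auto simp: inj_on_def infinite_Icc)
  ultimately have inf: "infinite Z" using finite_subset by blast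
  have "poly T' z = poly T z" if "z \<in> Z" for z
  proof -
    obtain x where x: "x \<in> {-\<xi>..\<xi>}" "poly T z = of_real x" using \<open>z \<in> Z\<close> by (auto simp: Z_def)
    then obtain r where r: "z = of_real r" using preimage[OF x(2,1)] by blast
    have "poly T' (cnj z) = cnj (poly T z)" unfolding T'_def by (rule poly_cnj[symmetric])
    then show ?thesis using x r by simp
  qed
  then have "Z \<subseteq> {z. poly (T' - T) z = 0}" by auto
  then have "T' - T = 0" using inf poly_roots_finite[of "T' - T"] finite_subset by blast
  then have "T' = T" by simp
  then have cnj: "cnj (coeff T i) = coeff T i" for i
    using coeff_map_poly[of cnj T i] unfolding T'_def by (simp only: complex_cnj_zero)
  have "of_real (Re (coeff T i)) = coeff T i" for i
    using cnj[of i] by (simp add: complex_eq_iff)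
  then show ?thesis by (intro poly_eqI) (simp add: coeff_map_poly)
qed

lemma roots_mset:
  assumes "x \<in> {-\<xi>..\<xi>}"
  obtains A where "T - [:of_real x:] = smult (lead_coeff (T - [:of_real x:])) (\<Prod>y\<in>#A. [:-y, 1:])"
    "A \<noteq> {#}" "\<And>y. y \<in># A \<longleftrightarrow> poly T y = of_real x" "\<And>y. y \<in># A \<Longrightarrow> y \<in> of_real ` {-\<xi>..\<xi>}"
proof -
  let ?p = "T - [:of_real x:]"
  have deg: "degree ?p = degree T" using degree_T by (simp add: degree_diff_const)
  then have p0: "?p \<noteq> 0" using degree_T by (metis degree_0 not_numeral_le_zero)
  have m: "y \<in># proots ?p \<longleftrightarrow> poly T y = of_real x" for y using p0 by simp
  have "size (proots ?p) \<noteq> 0" unfolding size_proots_complex deg using degree_T by simp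
  then have "proots ?p \<noteq> {#}" by (metis size_empty)
  then show ?thesis
  proof (rule that[of "proots ?p", rotated])
    show "?p = smult (lead_coeff ?p) (\<Prod>y\<in>#proots ?p. [:-y, 1:])"
      by (rule complex_poly_decompose_multiset[symmetric])
    show "y \<in> of_real ` {-\<xi>..\<xi>}" if "y \<in># proots ?p" for y
      using that preimage[OF _ assms, of y] unfolding m by blast
  qed (rule m)
qed

text \<open>Laguerre's inequality. It holds for every level \<open>x\<close> whose preimages are real.\<close>

lemma second_derivative_sign:
  assumes c: "poly (pderiv T) (of_real c) = 0" and x: "x \<in> {-\<xi>..\<xi>}"
    and ne: "poly T (of_real c) \<noteq> of_real x"
  shows "\<exists>s. Re s > 0 \<and> poly (pderiv (pderiv T)) (of_real c) = - ((poly T (of_real c) - of_real x) * s)"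
proof -
  obtain A where A: "T - [:of_real x:] = smult (lead_coeff (T - [:of_real x:])) (\<Prod>y\<in>#A. [:-y, 1:])"
    "A \<noteq> {#}" "\<And>y. y \<in># A \<longleftrightarrow> poly T y = of_real x" "\<And>y. y \<in># A \<Longrightarrow> y \<in> of_real ` {-\<xi>..\<xi>}"
    by (rule roots_mset[OF x]) blast
  define s where "s = (\<Sum>y\<in>#A. 1 / (of_real c - y)\<^sup>2)"
  have cA: "of_real c \<notin># A" using A(3) ne by (simp only: not_False_eq_True)
  have "Re (1 * s) > 0" unfolding s_def
  proof (rule Re_sum_mset_pos[OF A(2), of 1 "\<lambda>y. 1 / (of_real c - y)\<^sup>2"])
    fix y assume y: "y \<in># A"
    then obtain r where r: "y = of_real r" using A(4) by blast
    have "c \<noteq> r"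
    proof
      assume "c = r"
      with y r have "of_real c \<in># A" by (simp only:)
      with cA show False by (rule notE)
    qed
    then have pos: "0 < 1 / (c - r)\<^sup>2" by simp
    have "1 * (1 / (of_real c - y)\<^sup>2) = complex_of_real (1 / (c - r)\<^sup>2)" unfolding r by simp
    then show "0 < Re (1 * (1 / (of_real c - y)\<^sup>2))" using pos by (simp only: Re_complex_of_real)
  qed
  moreover have "(poly T (of_real c) - of_real x) * poly (pderiv (pderiv T)) (of_real c) =
      - ((poly T (of_real c) - of_real x)\<^sup>2 * s)"
    using poly_pderiv2_linear_factors[OF A(1) cA] c by (simp add: pderiv_diff pderiv_pCons s_def)
  then have "(poly T (of_real c) - of_real x) * poly (pderiv (pderiv T)) (of_real c) =
      (poly T (of_real c) - of_real x) * (- ((poly T (of_real c) - of_real x) * s))"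
    by (simp add: power2_eq_square)
  then have "poly (pderiv (pderiv T)) (of_real c) = - ((poly T (of_real c) - of_real x) * s)"
    using ne by (simp only: mult_left_cancel right_minus_eq not_False_eq_True)
  ultimately show ?thesis by auto
qed

text \<open>At a critical point with value strictly between \<open>-\<xi>\<close> and \<open>\<xi>\<close>, Laguerre's inequality for the level \<open>\<xi>\<close>
and for the level \<open>-\<xi>\<close> would give the second derivative opposite signs.\<close>

lemma preimage_simple:
  assumes z: "poly T z = of_real x" and x: "x \<in> {-\<xi>..\<xi>}"
  shows "poly (pderiv T) z \<noteq> 0"
proof
  assume cr: "poly (pderiv T) z = 0"
  then have x': "-\<xi> < x" "x < \<xi>" using endpoints[OF z] x by force+
  obtain c where c: "z = of_real c" using preimage[OF z x] by blast
  have e1: "\<xi> \<in> {-\<xi>..\<xi>}" "-\<xi> \<in> {-\<xi>..\<xi>}" using \<xi>_pos by auto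
  have "poly T (of_real c) \<noteq> of_real \<xi>" "poly T (of_real c) \<noteq> of_real (-\<xi>)"
    using x' z c by (auto simp del: of_real_minus)
  then obtain s t where s: "Re s > 0" "poly (pderiv (pderiv T)) z = - ((of_real x - of_real \<xi>) * s)"
    and t: "Re t > 0" "poly (pderiv (pderiv T)) z = - ((of_real x - of_real (-\<xi>)) * t)"
    using second_derivative_sign[of c, OF _ e1(1)] second_derivative_sign[of c, OF _ e1(2)] cr
    unfolding c[symmetric] z by blast
  have "Re (poly (pderiv (pderiv T)) z) = (\<xi> - x) * Re s"
    unfolding s(2) by (simp add: algebra_simps)
  moreover have "Re (poly (pderiv (pderiv T)) z) = - ((x + \<xi>) * Re t)"
    unfolding t(2) by (simp add: algebra_simps)
  moreover have "(\<xi> - x) * Re s > 0" "(x + \<xi>) * Re t > 0" using x' s(1) t(1) by auto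
  ultimately show False by linarith
qed

text \<open>The first part is the Gauss-Lucas theorem: for \<open>z\<close> outside the segment all terms \<open>1 / (z - y)\<close> of the
logarithmic derivative lie in one open half plane. The second part is Laguerre's inequality.\<close>

lemma critical_points:
  assumes z: "poly (pderiv T) z = 0"
  shows "z \<in> of_real ` {-\<xi>..\<xi>} \<and> poly (pderiv (pderiv T)) z \<noteq> 0"
proof -
  have zero: "(0::real) \<in> {-\<xi>..\<xi>}" using \<xi>_pos by simp
  have Tz: "poly T z \<noteq> of_real 0" using preimage_simple[OF _ zero] z by blast
  obtain A where A: "T - [:of_real 0:] = smult (lead_coeff (T - [:of_real 0:])) (\<Prod>y\<in>#A. [:-y, 1:])"
    "A \<noteq> {#}" "\<And>y. y \<in># A \<longleftrightarrow> poly T y = of_real 0" "\<And>y. y \<in># A \<Longrightarrow> y \<in> of_real ` {-\<xi>..\<xi>}"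
    by (rule roots_mset[OF zero]) blast
  have zA: "z \<notin># A" using A(3)[of z] Tz by (simp only: not_False_eq_True)
  have sum0: "(\<Sum>y\<in>#A. 1 / (z - y)) = 0"
    using poly_pderiv_linear_factors[OF A(1) zA] z Tz by (simp add: pderiv_diff pderiv_pCons)
  have in_seg: "z \<in> of_real ` {-\<xi>..\<xi>}"
  proof (rule ccontr)
    assume out: "z \<notin> of_real ` {-\<xi>..\<xi>}"
    \<comment> \<open>\<open>w\<close> points to the side of the segment on which \<open>z\<close> lies\<close>
    define w where "w = (if Im z = 0 then of_real (Re z) else \<i> * of_real (Im z))"
    have "Re (w * (\<Sum>y\<in>#A. 1 / (z - y))) > 0"
    proof (rule Re_sum_mset_pos[OF A(2), of w "\<lambda>y. 1 / (z - y)"])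
      fix y assume "y \<in># A"
      then obtain r where r: "y = of_real r" "r \<in> {-\<xi>..\<xi>}" using A(4) by blast
      have "0 < Re (w * cnj (z - y))"
      proof (cases "Im z = 0")
        case True
        then have "of_real (Re z) = z" by (simp add: complex_eq_iff)
        then have "Re z \<notin> {-\<xi>..\<xi>}" using out imageI[of "Re z" "{-\<xi>..\<xi>}" complex_of_real] by metis
        then consider "Re z > \<xi>" | "Re z < -\<xi>" by auto
        then have "Re z * (Re z - r) > 0"
          using r \<xi>_pos by cases (auto intro!: mult_pos_pos mult_neg_neg)
        then show ?thesis using True by (simp add: w_def r)
      next
        case False
        have "Re (w * cnj (z - y)) = (Im z)\<^sup>2"
          using False by (simp add: w_def r(1) power2_eq_square)
        then show ?thesis using False by simp
      qed
      then show "0 < Re (w * (1 / (z - y)))" by (rule Re_mult_inverse_pos)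
    qed
    then show False unfolding sum0 by simp
  qed
  then obtain c where c: "z = of_real c" by blast
  obtain s where "Re s > 0" "poly (pderiv (pderiv T)) z = - ((poly T z - of_real 0) * s)"
    using second_derivative_sign[of c 0] z zero Tz unfolding c by auto
  then have "poly (pderiv (pderiv T)) z \<noteq> 0" using Tz by auto
  then show ?thesis using in_seg by blast
qed

end

section \<open>Recurrence of the Jacobi coefficients\<close>

text \<open>Comparing leading coefficients in the recurrence shows that the leading coefficient of \<open>P k\<close> is
\<open>p (Suc k)\<close> times that of \<open>P (Suc k)\<close>. This is the passage to monic form.\<close>

lemma orthonormal_to_monic:
  assumes on: "orthonormal_polys M P" and p: "\<And>k. k \<ge> 1 \<Longrightarrow> p k > 0"
    and rec: "\<And>k x. x * poly (P k) x = p k * (if k = 0 then 0 else poly (P (k - 1)) x)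
        + q k * poly (P k) x + p (k + 1) * poly (P (k + 1)) x"
    and prob: "prob_space M"
  shows "(\<integral>x. poly (rec_poly q (\<lambda>k. (p k)\<^sup>2) i) x * poly (rec_poly q (\<lambda>k. (p k)\<^sup>2) j) x \<partial>M) =
     (if i = j then \<Prod>l=1..i. (p l)\<^sup>2 else 0)"
proof -
  interpret prob_space M by (rule prob)
  let ?r = "rec_poly q (\<lambda>k. (p k)\<^sup>2)"
  define c where "c = (\<lambda>k. lead_coeff (P k))"
  have deg: "degree (P k) = k" and cp: "c k > 0" for k
    using on unfolding orthonormal_polys_def c_def by blast+
  have prec: "[:0, 1:] * P k = smult (p k) (if k = 0 then 0 else P (k - 1)) + smult (q k) (P k)
      + smult (p (k + 1)) (P (k + 1))" for k
  proof (rule poly_ext)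
    fix x show "poly ([:0, 1:] * P k) x = poly (smult (p k) (if k = 0 then 0 else P (k - 1))
        + smult (q k) (P k) + smult (p (k + 1)) (P (k + 1))) x"
      using rec[of x k] by simp
  qed
  have cc: "c k = p (Suc k) * c (Suc k)" for k
  proof -
    have "coeff ([:0, 1:] * P k) (Suc k) = c k" by (simp add: c_def deg)
    moreover have "coeff (smult (p k) (if k = 0 then 0 else P (k - 1)) + smult (q k) (P k)
      + smult (p (k + 1)) (P (k + 1))) (Suc k) = p (Suc k) * c (Suc k)"
      using deg by (simp add: c_def coeff_eq_0)
    ultimately show ?thesis unfolding prec by simp
  qed
  have P: "P k = smult (c k) (?r k)" for k
  proof (induction k rule: induct_nat_012)
    case 0
    then show ?case using deg[of 0] by (auto simp: c_def elim!: degree_eq_zeroE)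
  next
    case 1
    have "poly (P 0) x = c 0" for x using deg[of 0] by (auto simp: c_def elim!: degree_eq_zeroE)
    then have "p 1 * poly (P 1) x = p 1 * poly (smult (c 1) (?r 1)) x" for x
      using rec[of x 0] cc[of 0] by (simp add: algebra_simps)
    then show ?case using p[of 1] by (intro poly_ext) simp
  next
    case (ge2 k)
    let ?p = "p (Suc (Suc k))"
    have "?p * poly (P (Suc (Suc k))) x = ?p * poly (smult (c (Suc (Suc k))) (?r (Suc (Suc k)))) x" for x
    proof -
      define A B where "A = poly (?r k) x" and "B = poly (?r (Suc k)) x"
      have "?p * poly (P (Suc (Suc k))) x = (x - q (Suc k)) * poly (P (Suc k)) x - p (Suc k) * poly (P k) x"
        using rec[of x "Suc k"] by (simp add: algebra_simps)
      also have "\<dots> = (x - q (Suc k)) * (c (Suc k) * B) - p (Suc k) * (c k * A)"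
        unfolding ge2 by (simp add: A_def B_def)
      also have "\<dots> = c (Suc k) * ((x - q (Suc k)) * B - (p (Suc k))\<^sup>2 * A)"
        unfolding cc[of k] by (simp add: algebra_simps power2_eq_square)
      also have "c (Suc k) = ?p * c (Suc (Suc k))" by (rule cc)
      also have "(x - q (Suc k)) * B - (p (Suc k))\<^sup>2 * A = poly (?r (Suc (Suc k))) x"
        by (simp add: A_def B_def algebra_simps)
      finally show ?thesis by (simp add: mult.assoc)
    qed
    then show ?case using p[of "Suc (Suc k)"] by (intro poly_ext) simp
  qed
  have c2: "(\<Prod>l=1..k. (p l)\<^sup>2) * (c k)\<^sup>2 = (c 0)\<^sup>2" for k
  proof (induction k)
    case (Suc k)
    have "(\<Prod>l=1..Suc k. (p l)\<^sup>2) * (c (Suc k))\<^sup>2 = (\<Prod>l=1..k. (p l)\<^sup>2) * (p (Suc k) * c (Suc k))\<^sup>2"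
      by (simp add: power_mult_distrib)
    also have "\<dots> = (c 0)\<^sup>2" using Suc by (simp only: cc[symmetric])
    finally show ?case .
  qed simp
  have int: "c i * c j * (\<integral>x. poly (?r i) x * poly (?r j) x \<partial>M) = (if i = j then 1 else 0)" for i j
  proof -
    have "(\<integral>x. poly (P i) x * poly (P j) x \<partial>M) = (\<integral>x. (c i * c j) * (poly (?r i) x * poly (?r j) x) \<partial>M)"
      unfolding P by (simp add: mult_ac)
    also have "\<dots> = c i * c j * (\<integral>x. poly (?r i) x * poly (?r j) x \<partial>M)" by (rule integral_mult_right_zero)
    finally show ?thesis using on by (simp add: orthonormal_polys_def)
  qed
  have c0: "(c 0)\<^sup>2 = 1" using int[of 0 0] prob_space by (simp add: power2_eq_square)
  show ?thesis
  proof (cases "i = j")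
    case True
    have "(c i)\<^sup>2 * (\<integral>x. poly (?r i) x * poly (?r j) x \<partial>M) = (c i)\<^sup>2 * (\<Prod>l=1..i. (p l)\<^sup>2)"
      using int[of i j] c2[of i] True c0 by (simp add: power2_eq_square mult_ac)
    then show ?thesis using cp[of i] True by simp
  next
    case False
    then show ?thesis using int[of i j] cp[of i] cp[of j] by simp
  qed
qed

text \<open>The hull of a compact set is the segment between its minimum and its maximum.\<close>

lemma julia_endpoints:
  assumes E: "compact E" "E \<noteq> {}" and hull: "is_interval hull E = {-\<xi>..\<xi>::real}"
  shows "-\<xi> \<in> E" "\<xi> \<in> E"
proof -
  have sub: "E \<subseteq> {-\<xi>..\<xi>}" using hull_subset[of E is_interval] hull by simp
  have \<xi>: "-\<xi> \<le> \<xi>" using sub E(2) by fastforce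
  obtain s where s: "s \<in> E" "\<And>t. t \<in> E \<Longrightarrow> t \<le> s" using compact_attains_sup[OF E] by blast
  have "is_interval hull E \<subseteq> {..s}" using s(2) by (intro hull_minimal) (auto simp: is_interval_ic)
  then have "\<xi> \<le> s" using hull \<xi> by auto
  then show "\<xi> \<in> E" using s(1) sub by (metis atLeastAtMost_iff order_antisym subsetD)
  obtain i where i: "i \<in> E" "\<And>t. t \<in> E \<Longrightarrow> i \<le> t" using compact_attains_inf[OF E] by blast
  have "is_interval hull E \<subseteq> {i..}" using i(2) by (intro hull_minimal) (auto simp: is_interval_ci)
  then have "i \<le> -\<xi>" using hull \<xi> by auto
  then show "-\<xi> \<in> E" using i(1) sub by (metis atLeastAtMost_iff order_antisym subsetD)
qed

lemma expanding_pderiv_nonzero: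
  assumes "expanding T" "z \<in> julia_set T"
  shows "poly (pderiv T) z \<noteq> 0"
proof
  assume 0: "poly (pderiv T) z = 0"
  obtain A c where Ac: "A > 0" "c > 1" "\<And>x n. x \<in> julia_set T \<Longrightarrow> n \<ge> 1 \<Longrightarrow> norm (deriv (poly T ^^ n) x) \<ge> A * c ^ n"
    using assms(1) unfolding expanding_def by blast
  have "deriv (poly T) z = 0" using DERIV_imp_deriv[OF poly_DERIV[of T z]] 0 by simp
  then have "A * c ^ 1 \<le> 0" using Ac(3)[OF assms(2), of 1] by simp
  then show False using Ac(1,2) by (simp add: mult_le_0_iff)
qed

text \<open>Such a polynomial is a monomial. This excludes \<open>\<xi> = 0\<close>, where the Julia set would consist of a
critical point.\<close>

lemma pderiv_zero_at_only_root:
  fixes T :: "complex poly"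
  assumes "degree T \<ge> 2" "\<And>z. poly T z = 0 \<Longrightarrow> z = 0"
  shows "poly (pderiv T) 0 = 0"
proof -
  have "\<exists>z. poly T z = 0"
    using assms(1) by (intro fundamental_theorem_of_algebra) (simp add: constant_degree)
  then have T0: "poly T 0 = 0" using assms(2) by metis
  then obtain p where p: "T = [:-0, 1:] * p" by (metis dvdE poly_eq_0_iff_dvd)
  have p0: "p \<noteq> 0" using p assms(1) by auto
  have "degree p > 0"
  proof -
    have "degree T = degree [:-0, 1::complex:] + degree p" unfolding p using p0 by (intro degree_mult_eq) auto
    then show ?thesis using assms(1) by simp
  qed
  then have "\<exists>z. poly p z = 0"
    by (intro fundamental_theorem_of_algebra) (simp add: constant_degree)
  then obtain z where z: "poly p z = 0" by blast
  then have "poly T z = 0" by (simp add: p)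
  then have "z = 0" by (rule assms(2))
  then have "poly p 0 = 0" using z by simp
  then show ?thesis unfolding p pderiv_linear_times by simp
qed

lemma balanced_measure_space:
  assumes "balanced_measure T \<mu>"
  shows "space \<mu> = julia_set T" and "Re \<in> measurable \<mu> borel"
proof -
  have sets: "sets \<mu> = sets (restrict_space borel (julia_set T))"
    using assms by (simp add: balanced_measure_def)
  show "space \<mu> = julia_set T"
    using sets_eq_imp_space_eq[OF sets] by (simp add: space_restrict_space)
  have "Re \<in> measurable (restrict_space borel (julia_set T)) borel"
    by (intro measurable_restrict_space1) measurable
  then show "Re \<in> measurable \<mu> borel" using measurable_cong_sets[OF sets refl] by blast
qed

text \<open>All preimages of Julia points are real and simple, so on real-valued functions the multiplicities in
the transfer operator are 1 and the sum runs over real roots.\<close>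

lemma balanced_measure_real:
  fixes Tr :: "real poly"
  defines "T \<equiv> cplx Tr"
  assumes bal: "balanced_measure T \<mu>" and real: "julia_set T \<subseteq> \<real>" and d: "degree Tr > 0"
    and simple: "\<And>x. complex_of_real x \<in> julia_set T \<Longrightarrow>
       \<exists>R. simple_split (Tr - [:x:]) R \<and> {z. poly T z = of_real x} = of_real ` R \<and>
         (\<forall>r\<in>R. poly (pderiv T) (of_real r) \<noteq> 0)"
    and g: "g \<in> borel_measurable borel" "continuous_on {x. of_real x \<in> julia_set T} g"
    and k: "k \<in> borel_measurable borel"
    and sum: "\<And>x R. of_real x \<in> julia_set T \<Longrightarrow> simple_split (Tr - [:x:]) R \<Longrightarrow>
      (\<Sum>y\<in>R. g y) = real (degree Tr) * k x"
  shows "(\<integral>x. k x \<partial>distr \<mu> borel Re) = (\<integral>x. g x \<partial>distr \<mu> borel Re)"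
proof -
  have inv: "\<And>g. continuous_on (julia_set T) g \<Longrightarrow>
        (\<integral>x. transfer_operator T g x \<partial>\<mu>) = (\<integral>x. g x \<partial>\<mu>)"
    using bal by (auto simp: balanced_measure_def)
  note space = balanced_measure_space(1)[OF bal] and Re = balanced_measure_space(2)[OF bal]
  let ?G = "\<lambda>z. complex_of_real (g (Re z))"
  have "continuous_on (julia_set T) ?G"
  proof (intro continuous_intros continuous_on_compose2[OF g(2)])
    show "Re ` julia_set T \<subseteq> {x. of_real x \<in> julia_set T}" using real by auto
  qed
  from inv[OF this] have "(\<integral>z. transfer_operator T ?G z \<partial>\<mu>) = of_real (\<integral>z. g (Re z) \<partial>\<mu>)"
    by simp
  moreover have "(\<integral>z. transfer_operator T ?G z \<partial>\<mu>) = (\<integral>z. complex_of_real (k (Re z)) \<partial>\<mu>)"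
  proof (intro Lint_cong refl)
    fix z assume "z \<in> space \<mu>"
    then have z: "z \<in> julia_set T" by (simp add: space)
    define x where "x = Re z"
    have zx: "z = of_real x" using z real by (auto simp: x_def)
    have xj: "of_real x \<in> julia_set T" using z by (simp only: zx)
    from simple[OF this] obtain R
      where R': "simple_split (Tr - [:x:]) R \<and> {z. poly T z = of_real x} = of_real ` R \<and>
         (\<forall>r\<in>R. poly (pderiv T) (of_real r) \<noteq> 0)" by (rule exE)
    then have R: "simple_split (Tr - [:x:]) R" "{z. poly T z = of_real x} = of_real ` R"
      and R3: "\<And>r. r \<in> R \<Longrightarrow> poly (pderiv T) (of_real r) \<noteq> 0" by simp_all
    have nz: "T - [:z:] \<noteq> 0"
    proof -
      have "degree (T - [:z:]) = degree Tr" using d by (subst degree_diff_const) (auto simp: T_def)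
      then show ?thesis using d by auto
    qed
    have "rsquarefree (T - [:z:])" unfolding rsquarefree_roots
    proof (intro allI notI)
      fix u assume u: "poly (T - [:z:]) u = 0 \<and> poly (pderiv (T - [:z:])) u = 0"
      then have "u \<in> of_real ` R" unfolding R(2)[symmetric] zx by simp
      then show False using u R3 by (auto simp: pderiv_diff pderiv_pCons)
    qed
    then have ord: "order y (T - [:z:]) = 1" if "poly T y = z" for y
      using rsquarefree_root_order[of "T - [:z:]" y] nz that by simp
    have "(\<Sum>y | poly T y = z. of_nat (order y (T - [:z:])) * ?G y) = (\<Sum>y\<in>of_real ` R. ?G y)"
      by (rule sum.cong) (use R(2) ord zx in auto)
    also have "\<dots> = (\<Sum>r\<in>R. ?G (of_real r))" by (subst sum.reindex) (auto simp: inj_on_def)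
    also have "\<dots> = of_real (\<Sum>r\<in>R. g r)" by simp
    also have "(\<Sum>r\<in>R. g r) = real (degree Tr) * k x" using sum[OF xj R(1)] .
    finally show "transfer_operator T ?G z = complex_of_real (k (Re z))"
      unfolding transfer_operator_def x_def using d by (simp add: T_def)
  qed
  ultimately have "complex_of_real (\<integral>z. k (Re z) \<partial>\<mu>) = of_real (\<integral>z. g (Re z) \<partial>\<mu>)" by simp
  then have "(\<integral>z. k (Re z) \<partial>\<mu>) = (\<integral>z. g (Re z) \<partial>\<mu>)" by (simp only: of_real_eq_iff)
  then show ?thesis using integral_distr[OF Re, of g] integral_distr[OF Re, of k] g k by simp
qed

theorem theorem1p2:
  fixes T :: "complex poly" and \<xi> :: real and \<mu> :: "complex measure"
    and J :: "nat \<Rightarrow> nat \<Rightarrow> real" and p q :: "nat \<Rightarrow> real"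
  assumes "degree T \<ge> 2"
    and "expanding T"
    and "julia_set T \<subseteq> \<real>"
    and "is_interval hull {x. complex_of_real x \<in> julia_set T} = {-\<xi>..\<xi>}"
    and "poly T -` (complex_of_real ` {-\<xi>..\<xi>}) \<subseteq> complex_of_real ` {-\<xi>..\<xi>}"
    and "balanced_measure T \<mu>"
    and "is_jacobi_matrix_of J (distr \<mu> borel Re)"
    and "\<And>k. q k = J k k"
    and "\<And>k. k \<ge> 1 \<Longrightarrow> p k = J (k - 1) k"
  shows "\<forall>\<epsilon>>0. \<exists>n\<ge>1. \<forall>s. \<forall>k\<in>{1..degree T ^ n}.
           \<bar>p (k + s * (degree T ^ n)\<^sup>2) - p k\<bar> \<le> \<epsilon> \<and>
           \<bar>q (k + s * (degree T ^ n)\<^sup>2) - q k\<bar> \<le> \<epsilon>"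
proof -
  define E where "E = {x. complex_of_real x \<in> julia_set T}"
  define M where "M = distr \<mu> borel Re"
  note julia = julia_set_real_eq[OF assms(1,3)]
  have prob\<mu>: "prob_space \<mu>" using assms(6) by (simp add: balanced_measure_def)
  note space = balanced_measure_space(1)[OF assms(6)] and Re = balanced_measure_space(2)[OF assms(6)]
  have ReE: "Re z \<in> E" "of_real (Re z) = z" if "z \<in> julia_set T" for z
    using that assms(3) by (auto simp: E_def)
  have "E \<noteq> {}" using prob_space.not_empty[OF prob\<mu>] ReE(1) space by auto
  have E_sub: "E \<subseteq> {-\<xi>..\<xi>}" using hull_subset[of E is_interval] assms(4) by (simp add: E_def)
  have "closed E"
  proof -
    have "E = of_real -` julia_set T" by (auto simp: E_def)
    then show ?thesis using closed_julia_set[of T]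
      by (simp add: continuous_closed_vimage)
  qed
  then have "compact E" using E_sub bounded_subset[OF bounded_closed_interval] compact_eq_bounded_closed
    by blast
  note endp = julia_endpoints[OF \<open>compact E\<close> \<open>E \<noteq> {}\<close> assms(4)[folded E_def]]
  have pre: "z \<in> of_real ` {-\<xi>..\<xi>}" if "poly T z = of_real x" "x \<in> {-\<xi>..\<xi>}" for z x
  proof -
    have "z \<in> poly T -` (complex_of_real ` {-\<xi>..\<xi>})" using that by auto
    then show ?thesis using assms(5) by blast
  qed
  have T_julia: "poly T z \<in> julia_set T \<longleftrightarrow> z \<in> julia_set T" for z
    unfolding julia by (simp add: escapes_image_iff)
  have "\<xi> \<ge> 0" using endp(2) E_sub by fastforce
  moreover have "\<xi> \<noteq> 0"
  proof
    assume 0: "\<xi> = 0"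
    have "z = 0" if "poly T z = 0" for z using pre[of z 0] that 0 by auto
    then have "poly (pderiv T) 0 = 0" by (rule pderiv_zero_at_only_root[OF assms(1)])
    moreover have "0 \<in> julia_set T" using endp(2) 0 by (simp add: E_def)
    ultimately show False using expanding_pderiv_nonzero[OF assms(2)] by blast
  qed
  ultimately have "\<xi> > 0" by simp
  interpret rp: real_preimage T \<xi>
  proof
    fix z x assume zx: "poly T z = complex_of_real x" "\<bar>x\<bar> = \<xi>"
    then have "x = \<xi> \<or> x = -\<xi>" by linarith
    then have "poly T z \<in> julia_set T" using endp zx(1) by (auto simp: E_def)
    then show "poly (pderiv T) z \<noteq> 0"
      using expanding_pderiv_nonzero[OF assms(2)] T_julia by blast
  qed (use assms(1) \<open>\<xi> > 0\<close> pre in auto)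
  define Tr where "Tr = map_poly Re T"
  have T: "T = cplx Tr" unfolding Tr_def by (rule rp.real_coeffs)
  have degT: "degree T = degree Tr" by (subst T) simp
  have polyT: "poly T (of_real x) = of_real (poly Tr x)" for x by (subst T) (rule poly_cplx)
  have split: "\<exists>R\<subseteq>{-\<xi>..\<xi>}. simple_split (Tr - [:x:]) R" if x: "x \<in> {-\<xi>..\<xi>}" for x
  proof (rule simple_split_real)
    fix z assume "poly (cplx (Tr - [:x:])) z = 0"
    then have z: "poly T z = of_real x" unfolding cplx_diff_const T[symmetric] by simp
    then show "z \<in> of_real ` {-\<xi>..\<xi>} \<and> poly (pderiv (cplx (Tr - [:x:]))) z \<noteq> 0"
      using pre[OF z x] rp.preimage_simple[OF z x] unfolding cplx_diff_const T[symmetric]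
      by (simp add: pderiv_diff pderiv_pCons)
  qed
  have split': "\<exists>R\<subseteq>{-\<xi>..\<xi>}. simple_split (pderiv Tr) R"
  proof (rule simple_split_real)
    fix z assume "poly (cplx (pderiv Tr)) z = 0"
    then show "z \<in> of_real ` {-\<xi>..\<xi>} \<and> poly (pderiv (cplx (pderiv Tr))) z \<noteq> 0"
      using rp.critical_points[of z] unfolding pderiv_cplx[symmetric] T[symmetric] by simp
  qed
  obtain p' q' P where J: "J = jacobi_matrix p' q'" and p'pos: "\<And>k. k \<ge> 1 \<Longrightarrow> p' k > 0"
    and on: "orthonormal_polys M P"
    and rec: "\<And>k x. x * poly (P k) x = p' k * (if k = 0 then 0 else poly (P (k - 1)) x)
        + q' k * poly (P k) x + p' (k + 1) * poly (P (k + 1)) x"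
    using assms(7) unfolding is_jacobi_matrix_of_def M_def by metis
  have q: "q k = q' k" for k using assms(8) by (simp add: J jacobi_matrix_def)
  have p: "p k = p' k" if "k \<ge> 1" for k
    using assms(9)[OF that] that by (cases k) (simp_all add: J jacobi_matrix_def)
  have probM: "prob_space M" unfolding M_def by (rule prob_space.prob_space_distr[OF prob\<mu> Re])
  interpret M: prob_space M by (rule probM)
  interpret balanced_jacobi M E \<xi> q' "\<lambda>k. (p' k)\<^sup>2" Tr
  proof
    show "sets M = sets borel" by (simp add: M_def)
    show "AE x in M. x \<in> E"
    proof -
      have "{x \<in> space borel. x \<in> E} \<in> sets borel" using \<open>closed E\<close> by simp
      then show ?thesis unfolding M_def AE_distr_iff[OF Re \<open>{x \<in> space borel. x \<in> E} \<in> sets borel\<close>]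
        using ReE(1) by (intro AE_I2) (simp add: space)
    qed
    show "(\<integral>x. poly (rec_poly q' (\<lambda>k. (p' k)\<^sup>2) i) x * poly (rec_poly q' (\<lambda>k. (p' k)\<^sup>2) j) x \<partial>M) =
        (if i = j then \<Prod>l=1..i. (p' l)\<^sup>2 else 0)" for i j
      by (rule orthonormal_to_monic[OF on p'pos rec probM])
    show "poly Tr x \<in> E \<longleftrightarrow> x \<in> E" for x
      unfolding E_def using T_julia[of "of_real x"] by (simp add: polyT)
    show "(\<integral>x. k x \<partial>M) = (\<integral>x. g x \<partial>M)"
      if g: "g \<in> borel_measurable borel" "continuous_on E g" and k: "k \<in> borel_measurable borel"
        and s: "\<And>x R. x \<in> E \<Longrightarrow> simple_split (Tr - [:x:]) R \<Longrightarrow> (\<Sum>y\<in>R. g y) = real (degree Tr) * k x"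
      for g k
      unfolding M_def
    proof (rule balanced_measure_real[where Tr = Tr, unfolded T[symmetric]])
      fix x assume x: "complex_of_real x \<in> julia_set T"
      then have x': "x \<in> {-\<xi>..\<xi>}" using E_sub by (auto simp: E_def)
      obtain R where R: "simple_split (Tr - [:x:]) R" using split[OF x'] by blast
      have root: "poly Tr r = x \<longleftrightarrow> r \<in> R" for r using simple_split_root[OF R, of r] by simp
      have "{z. poly T z = of_real x} = of_real ` R"
      proof (intro subset_antisym subsetI)
        fix z assume "z \<in> {z. poly T z = of_real x}"
        then have z: "poly T z = of_real x" by simp
        obtain r where r: "z = of_real r" using pre[OF z x'] by blast
        have "poly Tr r = x" using z unfolding r polyT by (simp only: of_real_eq_iff)
        then show "z \<in> of_real ` R" using r root by blast
      next
        fix z :: complex assume "z \<in> of_real ` R"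
        then show "z \<in> {z. poly T z = of_real x}" using root by (auto simp: polyT)
      qed
      moreover have "poly (pderiv T) (of_real r) \<noteq> 0" if "r \<in> R" for r
        using rp.preimage_simple[OF _ x', of "of_real r"] that root[of r] by (simp add: polyT)
      ultimately show "\<exists>R. simple_split (Tr - [:x:]) R \<and> {z. poly T z = of_real x} = of_real ` R \<and>
         (\<forall>r\<in>R. poly (pderiv T) (of_real r) \<noteq> 0)" using R by blast
    qed (use assms(1,3,6) degT g k s in \<open>auto simp: E_def\<close>)
    show "filterlim (\<lambda>i. \<bar>(poly Tr ^^ i) v\<bar>) at_top sequentially" if v: "\<bar>v\<bar> > \<xi>" for v
    proof -
      have iter: "(poly T ^^ i) (of_real v) = of_real ((poly Tr ^^ i) v)" for i
        by (induction i) (simp_all add: polyT)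
      have "v \<notin> {-\<xi>..\<xi>}" using v by auto
      then have "v \<notin> E" using E_sub by blast
      then have "escapes T (of_real v)" by (simp add: E_def julia)
      then show ?thesis unfolding escapes_def iter by simp
    qed
    show "0 < (p' k)\<^sup>2" if "k \<ge> 1" for k using p'pos[OF that] by simp
    show "2 \<le> degree Tr" using assms(1) degT by simp
    show "\<exists>R\<subseteq>{-\<xi>..\<xi>}. simple_split (Tr - [:x:]) R" if "x \<in> {-\<xi>..\<xi>}" for x
      using split[OF that] .
    show "\<exists>R\<subseteq>{-\<xi>..\<xi>}. simple_split (pderiv Tr) R" by (rule split')
  qed (rule \<open>compact E\<close> E_sub)+
  show ?thesis
  proof (intro allI impI)
    fix \<epsilon> :: real assume "\<epsilon> > 0"
    from jacobi_coefficients_recur[OF this] obtain n where n: "n \<ge> 1"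
      "\<And>s k. k \<in> {1..degree Tr ^ n} \<Longrightarrow>
        \<bar>sqrt ((p' (k + s * (degree Tr ^ n)\<^sup>2))\<^sup>2) - sqrt ((p' k)\<^sup>2)\<bar> \<le> \<epsilon> \<and>
        \<bar>q' (k + s * (degree Tr ^ n)\<^sup>2) - q' k\<bar> \<le> \<epsilon>" by blast
    have sq: "sqrt ((p' k)\<^sup>2) = p k" if "k \<ge> 1" for k using p[OF that] p'pos[OF that] by simp
    have "\<bar>p (k + s * (degree T ^ n)\<^sup>2) - p k\<bar> \<le> \<epsilon> \<and> \<bar>q (k + s * (degree T ^ n)\<^sup>2) - q k\<bar> \<le> \<epsilon>"
      if k: "k \<in> {1..degree T ^ n}" for s k
    proof -
      have k1: "k \<ge> 1" "k + s * (degree Tr ^ n)\<^sup>2 \<ge> 1" using k by auto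
      show ?thesis using n(2)[of k s] k unfolding degT q sq[OF k1(1)] sq[OF k1(2)] by blast
    qed
    then show "\<exists>n\<ge>1. \<forall>s. \<forall>k\<in>{1..degree T ^ n}.
           \<bar>p (k + s * (degree T ^ n)\<^sup>2) - p k\<bar> \<le> \<epsilon> \<and>
           \<bar>q (k + s * (degree T ^ n)\<^sup>2) - q k\<bar> \<le> \<epsilon>" using n(1) by blast
  qed
qed

end
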